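(* Let $\Omega \subset \mathbb{R}^2$ be an open bounded set with Lipschitz boundary. Suppose that $\phi: \overline{\Omega}\times\mathbb{R}^2 \to [0,\infty)$ is a metric integrand and that $u \in BV_\phi(\Omega)$ is a function of $\phi$-least gradient in $\Omega$. Then $u \in L^\infty_{loc}(\Omega)$.
   Context: A continuous function $\phi: \overline{\Omega} \times \mathbb{R}^N \to [0,\infty)$ (here $N=2$) is a metric integrand if: (1) $\phi(x,\cdot)$ is convex for a.e. $x \in \overline{\Omega}$; (2) $\phi(x,t\xi) = |t|\phi(x,\xi)$ for all $x \in \overline{\Omega}$, $\xi \in \mathbb{R}^N$, $t \in \mathbb{R}$; (3) there exist $\lambda, \Lambda > 0$ such that $\lambda|\xi| \leq \phi(x,\xi) \leq \Lambda|\xi|$ for all $x \in \overline{\Omega}$, $\xi \in \mathbb{R}^N$. The polar function of $\phi$ is $\phi^0(x,\xi^* ) = \sup\{\langle \xi^*,\xi\rangle : \xi \in \mathbb{R}^N,\ \phi(x,\xi) \leq 1\}$. For $u \in L^1(\Omega)$ the $\phi$-total variation is $$\int_\Omega |Du|_\phi = \sup\Big\{\int_\Omega u\, \mathrm{div}\,\mathbf{z}\, dx : \mathbf{z} \in C_c^1(\Omega;\mathbb{R}^N),\ \phi^0(x,\mathbf{z}(x)) \leq 1 \text{ a.e.}\Big\},$$ and $BV_\phi(\Omega)$ is the set of $u \in L^1(\Omega)$ with finite $\phi$-total variation; by (3), $BV_\phi(\Omega) = BV(\Omega)$ as sets. A function $u \in BV_\phi(\Omega)$ is of $\phi$-least gradient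 in $\Omega$ if $\int_\Omega |Du|_\phi \leq \int_\Omega |D(u+v)|_\phi$ for every $v \in BV_\phi(\Omega)$ compactly supported in $\Omega$. *)

theory Defs
  imports "HOL-Analysis.Analysis"
begin

text \<open>
  A set has Lipschitz boundary if, near each boundary point and for a suitable unit vector \<open>e\<close>
  (the vertical direction), it is the strict epigraph of a Lipschitz function on the
  hyperplane orthogonal to \<open>e\<close>.
\<close>

definition lipschitz_boundary :: "'a::euclidean_space set \<Rightarrow> bool" where
  "lipschitz_boundary \<Omega> \<longleftrightarrow>
     (\<forall>p \<in> frontier \<Omega>. \<exists>U e \<gamma> L.
        open U \<and> p \<in> U \<and> norm e = 1 \<and>
        L-lipschitz_on {y. y \<bullet> e = 0} (\<gamma> :: 'a \<Rightarrow> real) \<and>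
        \<Omega> \<inter> U = {x \<in> U. \<gamma> (x - (x \<bullet> e) *\<^sub>R e) < x \<bullet> e})"

definition metric_integrand :: "'a::euclidean_space set \<Rightarrow> ('a \<Rightarrow> 'a \<Rightarrow> real) \<Rightarrow> bool" where
  "metric_integrand \<Omega> \<phi> \<longleftrightarrow>
     (\<forall>x \<in> closure \<Omega>. \<forall>\<xi>. 0 \<le> \<phi> x \<xi>) \<and>
     continuous_on (closure \<Omega> \<times> UNIV) (\<lambda>(x, \<xi>). \<phi> x \<xi>) \<and>
     (AE x in lebesgue_on (closure \<Omega>). convex_on UNIV (\<phi> x)) \<and>
     (\<forall>x \<in> closure \<Omega>. \<forall>\<xi> t. \<phi> x (t *\<^sub>R \<xi>) = \<bar>t\<bar> * \<phi> x \<xi>) \<and>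
     (\<exists>m>0. \<exists>M>0. \<forall>x \<in> closure \<Omega>. \<forall>\<xi>.
        m * norm \<xi> \<le> \<phi> x \<xi> \<and> \<phi> x \<xi> \<le> M * norm \<xi>)"

text \<open>
  For a metric integrand and \<open>x\<close> in the closure of the domain, the set below contains \<open>0\<close> and is
  bounded above (by the lower growth bound), so the real-valued supremum is the intended one.
\<close>

definition polar :: "('a::euclidean_space \<Rightarrow> 'a \<Rightarrow> real) \<Rightarrow> 'a \<Rightarrow> 'a \<Rightarrow> real" where
  "polar \<phi> x \<xi>' = Sup {\<xi>' \<bullet> \<xi> | \<xi>. \<phi> x \<xi> \<le> 1}"

definition divergence :: "('a::euclidean_space \<Rightarrow> 'a) \<Rightarrow> 'a \<Rightarrow> real" where
  "divergence z x = (\<Sum>b\<in>Basis. frechet_derivative z (at x) b \<bullet> b)"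

text \<open>
  Functions on an open set \<open>\<Omega>\<close> are represented by total functions whose values outside \<open>\<Omega>\<close> are
  irrelevant.
\<close>

definition C1c :: "'a::euclidean_space set \<Rightarrow> ('a \<Rightarrow> 'b::euclidean_space) set" where
  "C1c \<Omega> = {z. (\<forall>x \<in> \<Omega>. z differentiable (at x)) \<and>
     (\<forall>h. continuous_on \<Omega> (\<lambda>x. frechet_derivative z (at x) h)) \<and>
     (\<exists>K. compact K \<and> K \<subseteq> \<Omega> \<and> (\<forall>x \<in> \<Omega> - K. z x = 0))}"

definition total_variation ::
    "('a::euclidean_space \<Rightarrow> 'a \<Rightarrow> real) \<Rightarrow> 'a set \<Rightarrow> ('a \<Rightarrow> real) \<Rightarrow> ereal" where
  "total_variation \<phi> \<Omega> u =
     (SUP z \<in> {z \<in> C1c \<Omega>. AE x in lebesgue_on \<Omega>. polar \<phi> x (z x) \<le> 1}.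
        ereal (integral\<^sup>L (lebesgue_on \<Omega>) (\<lambda>x. u x * divergence z x)))"

definition BV :: "('a::euclidean_space \<Rightarrow> 'a \<Rightarrow> real) \<Rightarrow> 'a set \<Rightarrow> ('a \<Rightarrow> real) set" where
  "BV \<phi> \<Omega> = {u. integrable (lebesgue_on \<Omega>) u \<and> total_variation \<phi> \<Omega> u < \<infinity>}"

text \<open>
  Elements of \<open>BV\<close> stand for their almost-everywhere classes, so compact support is understood
  up to null sets.
\<close>

definition compactly_supported :: "'a::euclidean_space set \<Rightarrow> ('a \<Rightarrow> real) \<Rightarrow> bool" where
  "compactly_supported \<Omega> v \<longleftrightarrow>
     (\<exists>K. compact K \<and> K \<subseteq> \<Omega> \<and> (AE x in lebesgue_on (\<Omega> - K). v x = 0))"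

definition least_gradient ::
    "('a::euclidean_space \<Rightarrow> 'a \<Rightarrow> real) \<Rightarrow> 'a set \<Rightarrow> ('a \<Rightarrow> real) \<Rightarrow> bool" where
  "least_gradient \<phi> \<Omega> u \<longleftrightarrow>
     u \<in> BV \<phi> \<Omega> \<and>
     (\<forall>v \<in> BV \<phi> \<Omega>. compactly_supported \<Omega> v \<longrightarrow>
        total_variation \<phi> \<Omega> u \<le> total_variation \<phi> \<Omega> (\<lambda>x. u x + v x))"

definition Linf_loc :: "'a::euclidean_space set \<Rightarrow> ('a \<Rightarrow> real) set" where
  "Linf_loc \<Omega> = {u. u \<in> borel_measurable (lebesgue_on \<Omega>) \<and>
     (\<forall>K. compact K \<and> K \<subseteq> \<Omega> \<longrightarrow> (\<exists>C. AE x in lebesgue_on K. \<bar>u x\<bar> \<le> C))}"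

end

theory Submission
  imports Defs
begin

text \<open>
  The proof is De Giorgi's iteration, carried out on the dual side so that no structure theory of
  functions of bounded variation is needed. Splitting an admissible field along a level set of the
  mollified \<open>u\<close> shows that the variations of \<open>min u k\<close> and of \<open>(u - k)\<^sup>+\<close> add up to at most that
  of \<open>u\<close>. Comparing \<open>u\<close> with \<open>u - \<eta> (u - k)\<^sup>+\<close> for a cutoff \<open>\<eta>\<close> then gives a Caccioppoli
  inequality, which bounds the variation of \<open>\<eta> (u - k)\<^sup>+\<close> by the integral of \<open>(u - k)\<^sup>+\<close> over the
  support of \<open>\<eta>\<close>. In the plane the integral of a nonnegative function is at most a constant times
  its variation times the square root of the measure of its support, and the resulting gain makes
  the integrals of \<open>(u - k)\<^sup>+\<close> over shrinking balls with increasing levels \<open>k\<close> tend to \<open>0\<close>. The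
  same argument applies to \<open>- u\<close>.
\<close>

subsection \<open>Continuously differentiable maps\<close>

text \<open>The growth bounds of \<phi> enter on the side of the fields: every field of length at
  most the lower constant is admissible, and every admissible field has length at most the upper
  one. Since \<phi> depends on \<open>x\<close>, mollifying an admissible field does not keep it
  admissible. This obstacle shapes the truncation inequality; a relative error \<open>1 + e\<close>
  is harmless there because it can be divided out of the field. The functional grows linearly, so
  the Caccioppoli inequality involves first powers only. The dimension enters through the kernel
  \<open>x\<close> over the square of its length: in the plane its divergence concentrates at the
  origin, and its integral over any set is at most a constant times the square root of the area. In
  the iteration the area of a superlevel set is in turn controlled by the previous integral, so each
  integral is bounded by the power 3/2 of the one before, up to a geometric factor. A level
  \<open>d\<close> that grows linearly with the L1 norm of \<open>u\<close> brings the starting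
  value below the threshold where such a recursion decays.\<close>

definition C1 :: "('a::euclidean_space \<Rightarrow> 'b::euclidean_space) \<Rightarrow> bool" where
  "C1 f \<longleftrightarrow> (\<forall>x. f differentiable (at x)) \<and>
     (\<forall>h. continuous_on UNIV (\<lambda>x. frechet_derivative f (at x) h))"

lemma C1_I:
  assumes "\<And>x. (f has_derivative f' x) (at x)" "\<And>h. continuous_on UNIV (\<lambda>x. f' x h)"
  shows "C1 f"
proof -
  have "(\<lambda>x. frechet_derivative f (at x) h) = (\<lambda>x. f' x h)" for h
    by (rule ext) (simp only: frechet_derivative_at[OF assms(1), symmetric])
  moreover have "f differentiable (at x)" for x
    by (rule differentiableI[OF assms(1)])
  ultimately show ?thesis
    unfolding C1_def by (simp only: assms(2) simp_thms)
qed

lemma C1_has_derivative: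
  "C1 f \<Longrightarrow> (f has_derivative frechet_derivative f (at x)) (at x)"
  by (simp add: C1_def frechet_derivative_works[symmetric])

lemma C1_continuous_derivative:
  "C1 f \<Longrightarrow> continuous_on UNIV (\<lambda>x. frechet_derivative f (at x) h)"
  by (auto simp: C1_def)

lemma C1_continuous: "C1 f \<Longrightarrow> continuous_on S f"
  by (intro continuous_at_imp_continuous_on ballI has_derivative_continuous[OF C1_has_derivative])

lemma C1_measurable: "C1 f \<Longrightarrow> f \<in> borel_measurable borel"
  by (intro borel_measurable_continuous_onI C1_continuous)

lemma C1_derivative_measurable:
  "C1 f \<Longrightarrow> (\<lambda>x. frechet_derivative f (at x) h) \<in> borel_measurable borel"
  by (intro borel_measurable_continuous_onI C1_continuous_derivative)

lemma C1_linear_derivative: "C1 f \<Longrightarrow> linear (frechet_derivative f (at x))"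
  by (rule has_derivative_linear[OF C1_has_derivative])

text \<open>\<open>C1\<close> gives continuity of the derivative only for each fixed direction.
  Expansion in the basis carries this over to directions that vary with the point.\<close>

lemma linear_eq_sum_Basis:
  fixes f :: "'a::euclidean_space \<Rightarrow> 'b::real_vector"
  assumes "linear f"
  shows "f x = (\<Sum>b\<in>Basis. (x \<bullet> b) *\<^sub>R f b)"
proof -
  have "f x = f (\<Sum>b\<in>Basis. (x \<bullet> b) *\<^sub>R b)" by (simp add: euclidean_representation)
  then show ?thesis by (simp add: linear_sum[OF assms] linear_cmul[OF assms])
qed

lemma continuous_on_C1_derivative_apply:
  assumes "C1 f" "continuous_on UNIV g"
  shows "continuous_on UNIV (\<lambda>x. frechet_derivative f (at x) (g x))"
proof -
  have "frechet_derivative f (at x) (g x) =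
      (\<Sum>b\<in>Basis. (g x \<bullet> b) *\<^sub>R frechet_derivative f (at x) b)" for x
    by (rule linear_eq_sum_Basis[OF C1_linear_derivative[OF assms(1)]])
  then show ?thesis
    using assms by (auto intro!: continuous_intros C1_continuous_derivative)
qed

lemma C1_const: "C1 (\<lambda>x. c)"
  by (rule C1_I[where f'="\<lambda>x h. 0"]) auto

lemma C1_add:
  assumes "C1 f" "C1 g"
  shows "C1 (\<lambda>x. f x + g x)"
  by (rule C1_I[OF has_derivative_add[OF assms[THEN C1_has_derivative]]])
    (intro continuous_intros assms[THEN C1_continuous_derivative])

lemma C1_scaleR:
  assumes "C1 f" "C1 g"
  shows "C1 (\<lambda>x. f x *\<^sub>R g x)"
  by (rule C1_I[OF has_derivative_scaleR[OF assms[THEN C1_has_derivative]]])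
    (intro continuous_intros assms[THEN C1_continuous_derivative] assms[THEN C1_continuous])

lemma C1_compose_real:
  fixes f :: "'a::euclidean_space \<Rightarrow> real"
  assumes "C1 f" "\<And>t. (T has_real_derivative T' t) (at t)" "continuous_on UNIV T'"
  shows "C1 (\<lambda>x. T (f x))"
    and "frechet_derivative (\<lambda>x. T (f x)) (at x) = (\<lambda>h. T' (f x) * frechet_derivative f (at x) h)"
proof -
  have D: "((\<lambda>x. T (f x)) has_derivative (\<lambda>h. T' (f x) * frechet_derivative f (at x) h)) (at x)"
    for x
    using diff_chain_at[OF C1_has_derivative[OF assms(1)] assms(2)[unfolded has_field_derivative_def]]
    by (simp add: o_def)
  have "continuous_on UNIV (\<lambda>x. T' (f x))"
    using continuous_on_compose2[OF assms(3) C1_continuous[OF assms(1)]] by simp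
  then show "C1 (\<lambda>x. T (f x))"
    by (intro C1_I[OF D] continuous_intros C1_continuous_derivative assms)
  show "frechet_derivative (\<lambda>x. T (f x)) (at x) = (\<lambda>h. T' (f x) * frechet_derivative f (at x) h)"
    using frechet_derivative_at[OF D] by simp
qed

lemma divergence_add:
  assumes "C1 y" "C1 z"
  shows "divergence (\<lambda>x. y x + z x) x = divergence y x + divergence z x"
  using frechet_derivative_at[OF has_derivative_add[OF assms[THEN C1_has_derivative]], symmetric]
  by (simp add: divergence_def inner_add_left sum.distrib)

lemma divergence_scaleR:
  assumes "C1 f" "C1 z"
  shows "divergence (\<lambda>x. f x *\<^sub>R z x) x = f x * divergence z x + frechet_derivative f (at x) (z x)"
proof -
  let ?D = "frechet_derivative f (at x)"
  have "?D (z x) = (\<Sum>b\<in>Basis. (z x \<bullet> b) *\<^sub>R ?D b)"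
    by (rule linear_eq_sum_Basis[OF C1_linear_derivative[OF assms(1)]])
  then show ?thesis
    using frechet_derivative_at[OF has_derivative_scaleR[OF assms[THEN C1_has_derivative]], symmetric]
    by (simp add: divergence_def inner_add_left sum.distrib sum_distrib_left mult.commute)
qed

lemma divergence_cmult:
  assumes "C1 z"
  shows "divergence (\<lambda>x. c *\<^sub>R z x) x = c * divergence z x"
proof -
  have "frechet_derivative (\<lambda>x. c) (at x) = (\<lambda>h. 0)" for x :: 'a and c :: real
    using frechet_derivative_at[OF has_derivative_const[of c "at x"]] by simp
  then show ?thesis
    using divergence_scaleR[OF C1_const assms, of c x] by simp
qed

lemma continuous_on_divergence: "C1 z \<Longrightarrow> continuous_on UNIV (divergence z)"
  unfolding divergence_def[abs_def]
  by (intro continuous_intros C1_continuous_derivative)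

lemma divergence_measurable: "C1 z \<Longrightarrow> divergence z \<in> borel_measurable borel"
  by (intro borel_measurable_continuous_onI continuous_on_divergence)

lemma frechet_derivative_eq_0:
  assumes "closed K" "\<And>x. x \<notin> K \<Longrightarrow> f x = 0" "x \<notin> K"
  shows "frechet_derivative f (at x) = (\<lambda>h. 0)"
proof -
  have "(f has_derivative (\<lambda>h. 0)) (at x)"
  proof (rule has_derivative_transform_within_open[of "\<lambda>x. 0"])
    show "open (- K)" using assms(1) by (rule open_Compl)
  qed (use assms in auto)
  then show ?thesis
    using frechet_derivative_at by metis
qed

lemma divergence_eq_0:
  assumes "closed K" "\<And>x. x \<notin> K \<Longrightarrow> f x = 0" "x \<notin> K"
  shows "divergence f x = 0"
  by (simp add: divergence_def frechet_derivative_eq_0[OF assms])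

text \<open>Outside \<open>K\<close> the derivative vanishes, and on the compact set
  \<open>K\<close> each partial derivative is bounded. Linearity in \<open>h\<close> then gives one
  constant for all points and directions.\<close>

lemma C1_derivative_bounded:
  assumes "C1 f" "compact K" "\<And>x. x \<notin> K \<Longrightarrow> f x = 0"
  obtains C where "C > 0" "\<And>x h. norm (frechet_derivative f (at x) h) \<le> C * norm h"
proof -
  let ?D = "\<lambda>x. frechet_derivative f (at x)"
  have "\<exists>c. \<forall>x. norm (?D x b) \<le> c" for b
  proof -
    have "bounded ((\<lambda>x. ?D x b) ` K)"
      by (intro compact_imp_bounded compact_continuous_image assms
          continuous_on_subset[OF C1_continuous_derivative]) auto
    then obtain c where c: "\<And>x. x \<in> K \<Longrightarrow> norm (?D x b) \<le> c"
      by (auto simp: bounded_iff)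
    have "norm (?D x b) \<le> \<bar>c\<bar>" for x
    proof (cases "x \<in> K")
      case True
      with c[of x] show ?thesis by linarith
    next
      case False
      with frechet_derivative_eq_0[OF compact_imp_closed[OF assms(2)] assms(3)] show ?thesis
        by simp
    qed
    then show ?thesis by blast
  qed
  then obtain c where c: "\<And>b x. norm (?D x b) \<le> c b" by metis
  show ?thesis
  proof
    have "0 \<le> c b" for b using order_trans[OF norm_ge_zero c] .
    then have "0 \<le> (\<Sum>b\<in>Basis. c b)" by (intro sum_nonneg)
    then show "0 < 1 + (\<Sum>b\<in>(Basis::'a set). c b)" by simp
    show "norm (?D x h) \<le> (1 + (\<Sum>b\<in>Basis. c b)) * norm h" for x h
    proof -
      have "?D x h = (\<Sum>b\<in>Basis. (h \<bullet> b) *\<^sub>R ?D x b)"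
    by (rule linear_eq_sum_Basis[OF C1_linear_derivative[OF assms(1)]])
      also have "norm \<dots> \<le> (\<Sum>b\<in>Basis. norm ((h \<bullet> b) *\<^sub>R ?D x b))" by (rule norm_sum)
      also have "\<dots> \<le> (\<Sum>b\<in>Basis. norm h * c b)"
        by (intro sum_mono) (auto intro!: mult_mono c Basis_le_norm)
      also have "\<dots> \<le> (1 + (\<Sum>b\<in>Basis. c b)) * norm h"
        by (simp add: sum_distrib_left[symmetric] algebra_simps)
      finally show ?thesis .
    qed
  qed
qed

lemma norm_diff_le_of_derivative_bound:
  fixes f :: "'a::euclidean_space \<Rightarrow> 'b::euclidean_space"
  assumes "\<And>x. (f has_derivative f' x) (at x)" "\<And>x h. norm (f' x h) \<le> C * norm h"
  shows "norm (f x - f y) \<le> C * norm (x - y)"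
proof (rule differentiable_bound[of UNIV f f'])
  show "onorm (f' x) \<le> C" for x
    by (rule onorm_le) (use assms in simp)
qed (use assms in auto)

lemma divergence_bounded:
  assumes "C1 z" "compact K" "\<And>x. x \<notin> K \<Longrightarrow> z x = 0"
  obtains C where "C > 0" "\<And>x. \<bar>divergence z x\<bar> \<le> C"
proof -
  obtain C where C: "C > 0" "\<And>x h. norm (frechet_derivative z (at x) h) \<le> C * norm h"
    using C1_derivative_bounded[OF assms] by blast
  show ?thesis
  proof
    show "0 < C * DIM('a)" using C by simp
    have "\<bar>divergence z x\<bar> \<le> (\<Sum>b\<in>Basis. \<bar>frechet_derivative z (at x) b \<bullet> b\<bar>)" for x
      unfolding divergence_def by (rule sum_abs)
    also have "\<dots> x \<le> (\<Sum>b\<in>(Basis::'a set). C)" for x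
    proof (rule sum_mono)
      fix b :: 'a assume "b \<in> Basis"
      then show "\<bar>frechet_derivative z (at x) b \<bullet> b\<bar> \<le> C"
        using Basis_le_norm[of b "frechet_derivative z (at x) b"] C(2)[of x b] by simp
    qed
    finally show "\<bar>divergence z x\<bar> \<le> C * DIM('a)" for x by (simp add: mult.commute)
  qed
qed

subsection \<open>Integration by parts\<close>

lemma integrable_lborel_compact_support:
  fixes f :: "'a::euclidean_space \<Rightarrow> real"
  assumes "f \<in> borel_measurable borel" "compact K" "\<And>x. x \<notin> K \<Longrightarrow> f x = 0" "\<And>x. \<bar>f x\<bar> \<le> C"
  shows "integrable lborel f"
proof (rule Bochner_Integration.integrable_bound[of _ "\<lambda>x. indicator K x * C"])
  show "integrable lborel (\<lambda>x. indicator K x * C)"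
    using fmeasurable_compact[OF assms(2)]
    by (intro integrable_mult_left) (auto simp: fmeasurable_def)
  show "AE x in lborel. norm (f x) \<le> norm (indicator K x * C)"
    using assms(3,4) by (auto simp: indicator_def intro!: AE_I2 order_trans[OF assms(4)])
qed (use assms in simp)

lemma lborel_integral_translate:
  fixes f :: "'a::euclidean_space \<Rightarrow> 'b::{banach, second_countable_topology}"
  assumes [measurable]: "f \<in> borel_measurable borel"
  shows "(LINT x|lborel. f (c + x)) = (LINT x|lborel. f x)"
    and "integrable lborel (\<lambda>x. f (c + x)) \<longleftrightarrow> integrable lborel f"
proof -
  have "(LINT x|lborel. f x) = (LINT x|distr lborel borel ((+) c). f x)"
    by (simp add: lborel_distr_plus)
  also have "\<dots> = (LINT x|lborel. f (c + x))"
    by (subst integral_distr) simp_all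
  finally show "(LINT x|lborel. f (c + x)) = (LINT x|lborel. f x)" by simp
  have "integrable lborel f \<longleftrightarrow> integrable (distr lborel borel ((+) c)) f"
    by (simp add: lborel_distr_plus)
  also have "\<dots> \<longleftrightarrow> integrable lborel (\<lambda>x. f (c + x))"
    by (subst integrable_distr_eq) simp_all
  finally show "integrable lborel (\<lambda>x. f (c + x)) \<longleftrightarrow> integrable lborel f" by simp
qed

text \<open>Translation invariance makes the integral of every difference quotient vanish.\<close>

lemma integral_directional_derivative_eq_0:
  fixes f :: "'a::euclidean_space \<Rightarrow> real"
  assumes f: "C1 f" and K: "compact K" "\<And>x. x \<notin> K \<Longrightarrow> f x = 0"
  shows "(LINT x|lborel. frechet_derivative f (at x) b) = 0"
proof -
  note [measurable] = C1_measurable[OF f] C1_derivative_measurable[OF f]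
  obtain C where C: "C > 0" "\<And>x h. norm (frechet_derivative f (at x) h) \<le> C * norm h"
    using C1_derivative_bounded[OF f K] by blast
  define t where "t n = 1 / real (Suc n)" for n
  define q where "q n x = (f (t n *\<^sub>R b + x) - f x) / t n" for n x
  obtain B where B: "\<And>x. x \<in> K \<Longrightarrow> norm x \<le> B"
    using compact_imp_bounded[OF K(1)] by (auto simp: bounded_iff)
  \<comment> \<open>Since \<open>t n \<le> 1\<close>, neither \<open>x\<close> nor its translate
    lies in \<open>K\<close> once \<open>x\<close> is outside this ball, so one multiple of its
    indicator dominates all difference quotients.\<close>
  let ?K = "cball 0 (B + norm b)"
  have t: "0 < t n" "t n \<le> 1" for n by (auto simp: t_def)
  have t_lim: "t \<longlonglongrightarrow> 0"
    using LIMSEQ_inverse_real_of_nat by (simp add: t_def[abs_def] inverse_eq_divide)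
  have f0: "integrable lborel f"
  proof -
    have "bounded (f ` K)"
      by (intro compact_imp_bounded compact_continuous_image K C1_continuous f)
    then obtain c where "\<And>x. x \<in> K \<Longrightarrow> \<bar>f x\<bar> \<le> c" by (auto simp: bounded_iff)
    then have "\<bar>f x\<bar> \<le> \<bar>c\<bar>" for x using K(2)[of x] by (cases "x \<in> K") (auto intro: order_trans[OF _ abs_ge_self])
    then show ?thesis using K by (intro integrable_lborel_compact_support) auto
  qed
  have "(\<lambda>n. LINT x|lborel. q n x) \<longlonglongrightarrow> (LINT x|lborel. frechet_derivative f (at x) b)"
  proof (rule integral_dominated_convergence)
    show "integrable lborel (\<lambda>x. indicator ?K x * (C * norm b))"
      by (intro integrable_mult_left integrable_real_indicator)
        (simp_all add: emeasure_lborel_cball_finite[unfolded infinity_ennreal_def])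
    show "AE x in lborel. (\<lambda>n. q n x) \<longlonglongrightarrow> frechet_derivative f (at x) b"
    proof (rule AE_I2)
      fix x
      have "((\<lambda>s. (f (x + s *\<^sub>R b) - f x) / s) \<longlongrightarrow> frechet_derivative f (at x) b) (at 0)"
      proof -
        have "((\<lambda>s. f (x + s *\<^sub>R b)) has_derivative (\<lambda>s. frechet_derivative f (at x) (s *\<^sub>R b))) (at 0)"
          by (rule has_derivative_compose[of "\<lambda>s. x + s *\<^sub>R b", simplified])
            (auto intro!: derivative_eq_intros C1_has_derivative f)
        then have "((\<lambda>s. f (x + s *\<^sub>R b)) has_real_derivative frechet_derivative f (at x) b) (at 0)"
          by (simp add: has_field_derivative_def linear_cmul[OF C1_linear_derivative[OF f]] mult_commute_abs)
        then show ?thesis by (simp add: DERIV_def)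
      qed
      moreover have "filterlim t (at 0) sequentially"
        unfolding filterlim_at using t LIMSEQ_inverse_real_of_nat t_lim
        by (simp add: less_imp_neq[symmetric])
      ultimately have "(\<lambda>n. (f (x + t n *\<^sub>R b) - f x) / t n) \<longlonglongrightarrow> frechet_derivative f (at x) b"
        by (rule filterlim_compose)
      then show "(\<lambda>n. q n x) \<longlonglongrightarrow> frechet_derivative f (at x) b"
        by (simp add: q_def add.commute)
    qed
    show "AE x in lborel. norm (q n x) \<le> indicator ?K x * (C * norm b)" for n
    proof (rule AE_I2)
      fix x
      show "norm (q n x) \<le> indicator ?K x * (C * norm b)"
      proof (cases "x \<in> ?K")
        case True
        have "norm (f (t n *\<^sub>R b + x) - f x) \<le> C * norm (t n *\<^sub>R b + x - x)"
          by (rule norm_diff_le_of_derivative_bound[OF C1_has_derivative[OF f] C(2)])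
        then show ?thesis using True t[of n] by (simp add: q_def field_simps)
      next
        case False
        have "t n * norm b \<le> 1 * norm b" using t[of n] by (intro mult_right_mono) auto
        then have "norm (t n *\<^sub>R b) \<le> norm b" using t[of n] by simp
        then have "norm (t n *\<^sub>R b + x) > B" "norm x > B"
          using False norm_triangle_ineq4[of "t n *\<^sub>R b + x" "t n *\<^sub>R b"] norm_ge_zero[of b]
          by (simp_all only: mem_cball_0 add_diff_cancel_left')
        then have "x \<notin> K" "t n *\<^sub>R b + x \<notin> K" using B by (meson not_le)+
        then have "f x = 0" "f (t n *\<^sub>R b + x) = 0" using K(2) by auto
        then show ?thesis using False by (simp add: q_def)
      qed
    qed
  qed (auto simp: q_def)
  moreover have "(LINT x|lborel. q n x) = 0" for n
  proof -
    have "integrable lborel (\<lambda>x. f (t n *\<^sub>R b + x))"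
      using f0 by (simp add: lborel_integral_translate)
    then show ?thesis
      using f0 by (simp add: q_def lborel_integral_translate)
  qed
  ultimately show ?thesis by (simp add: LIMSEQ_const_iff)
qed

lemma integral_divergence_eq_0:
  assumes z: "C1 z" and K: "compact K" "\<And>x. x \<notin> K \<Longrightarrow> z x = 0"
  shows "(LINT x|lborel. divergence z x) = 0"
proof -
  obtain C where C: "C > 0" "\<And>x h. norm (frechet_derivative z (at x) h) \<le> C * norm h"
    using C1_derivative_bounded[OF assms] by blast
  have D: "((\<lambda>x. z x \<bullet> b) has_derivative (\<lambda>h. frechet_derivative z (at x) h \<bullet> b)) (at x)" for x b
    by (intro has_derivative_inner_left C1_has_derivative z)
  have c: "C1 (\<lambda>x. z x \<bullet> b)" for b
    by (rule C1_I[OF D]) (intro continuous_intros C1_continuous_derivative z)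
  have e: "frechet_derivative z (at x) h \<bullet> b = frechet_derivative (\<lambda>x. z x \<bullet> b) (at x) h" for x h b
    using frechet_derivative_at[OF D] by metis
  have "integrable lborel (\<lambda>x. frechet_derivative z (at x) b \<bullet> b)" if "b \<in> Basis" for b
  proof (rule integrable_lborel_compact_support[OF _ K(1), of _ C])
    show "(\<lambda>x. frechet_derivative z (at x) b \<bullet> b) \<in> borel_measurable borel"
      by (intro borel_measurable_inner C1_derivative_measurable z) auto
    show "\<bar>frechet_derivative z (at x) b \<bullet> b\<bar> \<le> C" for x
      using Basis_le_norm[OF that, of "frechet_derivative z (at x) b"] C(2)[of x b] that by simp
  qed (simp add: frechet_derivative_eq_0[OF compact_imp_closed[OF K(1)] K(2)])
  then show ?thesis
    unfolding divergence_def e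
    by (subst Bochner_Integration.integral_sum)
       (auto simp: integral_directional_derivative_eq_0[OF c K(1)] K(2))
qed

text \<open>The divergence theorem is applied to the product of \<open>h\<close> and
  \<open>z\<close>. Its support is compact because that of \<open>z\<close> is, so \<open>h\<close>
  may be any \<open>C1\<close> function, such as a mollification.\<close>

lemma integral_by_parts:
  assumes h: "C1 h" and z: "C1 z" and K: "compact K" "\<And>x. x \<notin> K \<Longrightarrow> z x = 0"
  shows "(LINT x|lborel. h x * divergence z x) = - (LINT x|lborel. frechet_derivative h (at x) (z x))"
    and "integrable lborel (\<lambda>x. h x * divergence z x)"
    and "integrable lborel (\<lambda>x. frechet_derivative h (at x) (z x))"
proof -
  have I: "integrable lborel f" if f: "continuous_on UNIV f" "\<And>x. x \<notin> K \<Longrightarrow> f x = 0" for f :: "'a \<Rightarrow> real"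
  proof -
    have "bounded (f ` K)"
      by (intro compact_imp_bounded compact_continuous_image K continuous_on_subset[OF f(1)]) simp
    then obtain c where "\<And>x. x \<in> K \<Longrightarrow> \<bar>f x\<bar> \<le> c" by (auto simp: bounded_iff)
    then have "\<bar>f x\<bar> \<le> \<bar>c\<bar>" for x using f(2)[of x] by (cases "x \<in> K") (auto intro: order_trans[OF _ abs_ge_self])
    then show ?thesis
      using K f by (intro integrable_lborel_compact_support borel_measurable_continuous_onI) auto
  qed
  show i1: "integrable lborel (\<lambda>x. h x * divergence z x)"
    by (intro I continuous_intros continuous_on_divergence z C1_continuous h)
       (simp add: divergence_eq_0[OF compact_imp_closed[OF K(1)] K(2)])
  show i2: "integrable lborel (\<lambda>x. frechet_derivative h (at x) (z x))"
    by (intro I continuous_on_C1_derivative_apply h C1_continuous z)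
       (simp add: K(2) linear_0[OF C1_linear_derivative[OF h]])
  have "(LINT x|lborel. divergence (\<lambda>x. h x *\<^sub>R z x) x) = 0"
    by (rule integral_divergence_eq_0[OF C1_scaleR[OF h z] K(1)]) (simp add: K(2))
  then show "(LINT x|lborel. h x * divergence z x) = - (LINT x|lborel. frechet_derivative h (at x) (z x))"
    using i1 i2 by (simp add: divergence_scaleR[OF h z])
qed

subsection \<open>Convolution with a smooth kernel\<close>

text \<open>By the mean value inequality the remainder divided by the length of the increment is at
  most \<open>2 * B y\<close>, uniformly in the increment. It tends to 0 for each \<open>y\<close>,
  so dominated convergence along sequences applies.\<close>

lemma has_derivative_integral_dominated:
  fixes G :: "'a::euclidean_space \<Rightarrow> 'm \<Rightarrow> 'b::euclidean_space"
  assumes int: "\<And>x. integrable M (G x)"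
    and D: "\<And>x y. ((\<lambda>x. G x y) has_derivative G' x y) (at x)"
    and meas: "\<And>x h. (\<lambda>y. G' x y h) \<in> borel_measurable M"
    and bd: "\<And>x y h. norm (G' x y h) \<le> B y * norm h"
    and B: "integrable M B"
  shows "((\<lambda>x. LINT y|M. G x y) has_derivative (\<lambda>h. LINT y|M. G' x y h)) (at x)"
proof -
  have lin: "linear (G' x y)" for x y
    using D has_derivative_linear by blast
  have B0: "0 \<le> B y * norm h" for y and h :: 'a
    using bd order_trans[OF norm_ge_zero] by blast
  have int': "integrable M (\<lambda>y. G' x y h)" for x h
  proof (rule Bochner_Integration.integrable_bound)
    show "integrable M (\<lambda>y. B y * norm h)" using B by simp
    show "AE y in M. norm (G' x y h) \<le> norm (B y * norm h)"
      using bd by (intro AE_I2) (simp only: real_norm_def abs_of_nonneg[OF B0])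
  qed (rule meas)
  have "linear (\<lambda>h. LINT y|M. G' x y h)"
    by (rule linearI)
       (simp_all add: linear_add[OF lin] linear_cmul[OF lin] int')
  moreover have "((\<lambda>z. norm (((LINT y|M. G z y) - (LINT y|M. G x y)) - (LINT y|M. G' x y (z - x))) / norm (z - x))
      \<longlongrightarrow> 0) (at x)"
    unfolding tendsto_at_iff_sequentially
  proof (intro allI impI)
    fix X assume X: "\<forall>i. X i \<in> UNIV - {x}" "X \<longlonglongrightarrow> x"
    define N where "N n y = norm (G (X n) y - G x y - G' x y (X n - x)) / norm (X n - x)" for n y
    have intN: "integrable M (\<lambda>y. G (X n) y - G x y - G' x y (X n - x))" for n
      using int int' by simp
    have "(\<lambda>n. LINT y|M. N n y) \<longlonglongrightarrow> (LINT y|M. 0)"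
    proof (rule integral_dominated_convergence)
      show "N n \<in> borel_measurable M" for n
        using borel_measurable_integrable[OF intN, of n] unfolding N_def by measurable
      show "integrable M (\<lambda>y. 2 * B y)" using B by simp
      show "AE y in M. (\<lambda>n. N n y) \<longlonglongrightarrow> 0"
      proof (rule AE_I2)
        fix y
        have "((\<lambda>z. norm (G z y - G x y - G' x y (z - x)) / norm (z - x)) \<longlongrightarrow> 0) (at x)"
          using D[of y x] by (simp add: has_derivative_iff_norm)
        then show "(\<lambda>n. N n y) \<longlonglongrightarrow> 0"
          using X by (simp add: tendsto_at_iff_sequentially comp_def N_def)
      qed
      show "AE y in M. norm (N n y) \<le> 2 * B y" for n
      proof (rule AE_I2)
        fix y
        have "norm (G (X n) y - G x y) \<le> B y * norm (X n - x)"
          by (rule norm_diff_le_of_derivative_bound[OF D bd])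
        then have "norm (G (X n) y - G x y - G' x y (X n - x)) \<le> 2 * B y * norm (X n - x)"
          using bd[of x y "X n - x"] norm_triangle_ineq4[of "G (X n) y - G x y" "G' x y (X n - x)"]
          by linarith
        moreover have "norm (X n - x) > 0" using X by simp
        ultimately show "norm (N n y) \<le> 2 * B y"
          by (simp add: N_def pos_divide_le_eq)
      qed
    qed simp
    then have N0: "(\<lambda>n. LINT y|M. N n y) \<longlonglongrightarrow> 0" by simp
    have le: "norm (((LINT y|M. G (X n) y) - (LINT y|M. G x y)) - (LINT y|M. G' x y (X n - x))) / norm (X n - x)
        \<le> (LINT y|M. N n y)" for n
    proof -
      have "((LINT y|M. G (X n) y) - (LINT y|M. G x y)) - (LINT y|M. G' x y (X n - x))
          = (LINT y|M. G (X n) y - G x y - G' x y (X n - x))"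
        using int int' by simp
      moreover have "norm (LINT y|M. G (X n) y - G x y - G' x y (X n - x))
          \<le> (LINT y|M. norm (G (X n) y - G x y - G' x y (X n - x)))"
        by (rule integral_norm_bound)
      ultimately show ?thesis
        by (simp add: N_def divide_right_mono)
    qed
    show "((\<lambda>z. norm (((LINT y|M. G z y) - (LINT y|M. G x y)) - (LINT y|M. G' x y (z - x))) / norm (z - x)) \<circ> X)
        \<longlonglongrightarrow> 0"
      unfolding comp_def
      by (rule tendsto_sandwich[OF _ _ tendsto_const N0]) (use le in auto)
  qed
  ultimately show ?thesis
    by (simp add: has_derivative_iff_norm linear_conv_bounded_linear)
qed

text \<open>The weight is scalar and the kernel may be vector valued, so the same operator mollifies
  functions and turns the indicator of a set into a vector field.\<close>

definition conv :: "('a::euclidean_space \<Rightarrow> real) \<Rightarrow> ('a \<Rightarrow> 'b::euclidean_space) \<Rightarrow> 'a \<Rightarrow> 'b" where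
  "conv f k x = (LINT y|lborel. f y *\<^sub>R k (x - y))"

lemma integrable_scaleR_bounded:
  fixes f :: "'a::euclidean_space \<Rightarrow> real" and g :: "'a \<Rightarrow> 'b::euclidean_space"
  assumes f: "integrable lborel f" and g: "g \<in> borel_measurable borel" "\<And>x. norm (g x) \<le> c"
  shows "integrable lborel (\<lambda>x. f x *\<^sub>R g x)"
proof (rule Bochner_Integration.integrable_bound)
  show "integrable lborel (\<lambda>x. f x * c)" using f by simp
  show "(\<lambda>x. f x *\<^sub>R g x) \<in> borel_measurable lborel"
    using borel_measurable_integrable[OF f] g by measurable
  show "AE x in lborel. norm (f x *\<^sub>R g x) \<le> norm (f x * c)"
  proof (rule AE_I2)
    fix x
    have "\<bar>f x\<bar> * norm (g x) \<le> \<bar>f x\<bar> * \<bar>c\<bar>"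
      using g(2)[of x] by (intro mult_left_mono) auto
    then show "norm (f x *\<^sub>R g x) \<le> norm (f x * c)" by (simp add: abs_mult)
  qed
qed

text \<open>All regularity comes from the kernel: \<open>f\<close> is merely integrable, and the
  bounds on \<open>k\<close> and its derivative dominate the integrands.\<close>

lemma
  fixes f :: "'a::euclidean_space \<Rightarrow> real" and k :: "'a \<Rightarrow> 'b::euclidean_space"
  assumes f: "integrable lborel f" and k: "C1 k" "\<And>x. norm (k x) \<le> c"
    "\<And>x h. norm (frechet_derivative k (at x) h) \<le> C * norm h"
  shows C1_conv: "C1 (conv f k)"
    and frechet_derivative_conv:
      "frechet_derivative (conv f k) (at x) = (\<lambda>h. LINT y|lborel. f y *\<^sub>R frechet_derivative k (at (x - y)) h)"
proof -
  let ?D = "\<lambda>x. frechet_derivative k (at x)"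
  have k_meas: "k \<in> borel_measurable borel" by (rule C1_measurable[OF k(1)])
  have Dmeas: "(\<lambda>x. ?D x h) \<in> borel_measurable borel" for h by (rule C1_derivative_measurable[OF k(1)])
  have f_meas: "f \<in> borel_measurable borel" using borel_measurable_integrable[OF f] by simp
  have Dmeas': "(\<lambda>y. ?D (x - y) h) \<in> borel_measurable borel" for x h
    by (rule measurable_compose[OF _ Dmeas]) simp
  have 1: "((\<lambda>x. LINT y|lborel. f y *\<^sub>R k (x - y)) has_derivative
      (\<lambda>h. LINT y|lborel. f y *\<^sub>R ?D (x - y) h)) (at x)" for x
  proof (rule has_derivative_integral_dominated)
    show "integrable lborel (\<lambda>y. f y *\<^sub>R k (x - y))" for x
      by (rule integrable_scaleR_bounded[OF f measurable_compose[OF _ k_meas] k(2)]) simp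
    show "((\<lambda>x. f y *\<^sub>R k (x - y)) has_derivative (\<lambda>h. f y *\<^sub>R ?D (x - y) h)) (at x)" for x y
      by (intro has_derivative_scaleR_right has_derivative_compose[of "\<lambda>x. x - y" "\<lambda>h. h", OF _ C1_has_derivative[OF k(1)]])
         (auto intro!: derivative_eq_intros)
    show "(\<lambda>y. f y *\<^sub>R ?D (x - y) h) \<in> borel_measurable lborel" for x h
      using f_meas Dmeas' by measurable
    show "norm (f y *\<^sub>R ?D (x - y) h) \<le> (\<bar>f y\<bar> * C) * norm h" for x y h
      using mult_left_mono[OF k(3)[of "x - y" h] abs_ge_zero[of "f y"]] by (simp add: mult.assoc)
    show "integrable lborel (\<lambda>y. \<bar>f y\<bar> * C)" using f by simp
  qed
  have conv_eq: "conv f k = (\<lambda>x. LINT y|lborel. f y *\<^sub>R k (x - y))"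
    by (auto simp: conv_def)
  show "C1 (conv f k)"
  proof (rule C1_I)
    show "(conv f k has_derivative (\<lambda>h. LINT y|lborel. f y *\<^sub>R ?D (x - y) h)) (at x)" for x
      unfolding conv_eq by (rule 1)
    show "continuous_on UNIV (\<lambda>x. LINT y|lborel. f y *\<^sub>R ?D (x - y) h)" for h
    proof (rule continuous_on_sequentiallyI)
      fix u :: "nat \<Rightarrow> 'a" and a assume u: "u \<longlonglongrightarrow> a"
      show "(\<lambda>n. LINT y|lborel. f y *\<^sub>R ?D (u n - y) h) \<longlonglongrightarrow> (LINT y|lborel. f y *\<^sub>R ?D (a - y) h)"
      proof (rule integral_dominated_convergence)
        show "(\<lambda>y. f y *\<^sub>R ?D (x - y) h) \<in> borel_measurable lborel" for x
          using f_meas Dmeas' by measurable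
        then show "(\<lambda>y. f y *\<^sub>R ?D (u n - y) h) \<in> borel_measurable lborel" for n .
        show "integrable lborel (\<lambda>y. \<bar>f y\<bar> * (C * norm h))" using f by simp
        show "AE y in lborel. (\<lambda>n. f y *\<^sub>R ?D (u n - y) h) \<longlonglongrightarrow> f y *\<^sub>R ?D (a - y) h"
        proof (intro AE_I2 tendsto_scaleR tendsto_const)
          fix y
          have "isCont (\<lambda>x. ?D x h) (a - y)"
            using C1_continuous_derivative[OF k(1)] by (simp add: continuous_on_eq_continuous_at)
          then show "(\<lambda>n. ?D (u n - y) h) \<longlonglongrightarrow> ?D (a - y) h"
            by (rule isCont_tendsto_compose) (intro tendsto_intros u)
        qed
        show "AE y in lborel. norm (f y *\<^sub>R ?D (u n - y) h) \<le> \<bar>f y\<bar> * (C * norm h)" for n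
          using k(3) by (intro AE_I2) (simp add: mult_left_mono)
      qed
    qed
  qed
  show "frechet_derivative (conv f k) (at x) = (\<lambda>h. LINT y|lborel. f y *\<^sub>R ?D (x - y) h)"
    using frechet_derivative_at[OF 1] unfolding conv_eq by simp
qed

subsection \<open>The bump function\<close>

text \<open>Squaring the positive part removes the kink at the sphere of radius \<open>r\<close>.
  One continuous derivative is all that cutoffs and test fields require, and here it is
  explicit.\<close>

definition bump :: "real \<Rightarrow> 'a::euclidean_space \<Rightarrow> real" where
  "bump r x = (max 0 (1 - (norm x)\<^sup>2 / r\<^sup>2))\<^sup>2"

definition bump' :: "real \<Rightarrow> 'a::euclidean_space \<Rightarrow> 'a \<Rightarrow> real" where
  "bump' r x h = - (4 * max 0 (1 - (norm x)\<^sup>2 / r\<^sup>2) * (x \<bullet> h) / r\<^sup>2)"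

lemma has_real_derivative_max_0_squared:
  "((\<lambda>s. (max 0 s)\<^sup>2) has_real_derivative 2 * max 0 s) (at s)" for s :: real
proof (cases "s = 0")
  case True
  have "((\<lambda>h. ((max 0 h)\<^sup>2 - (max 0 0)\<^sup>2) / h) \<longlongrightarrow> (0::real)) (at 0)"
  proof (rule Lim_null_comparison)
    show "\<forall>\<^sub>F h::real in at 0. norm (((max 0 h)\<^sup>2 - (max 0 0)\<^sup>2) / h) \<le> \<bar>h\<bar>"
      by (intro always_eventually allI) (auto simp: max_def power2_eq_square)
    show "((\<lambda>h::real. \<bar>h\<bar>) \<longlongrightarrow> 0) (at 0)"
      by (intro tendsto_rabs_zero tendsto_ident_at)
  qed
  then show ?thesis using True by (simp add: DERIV_def)
next
  case False
  then consider "s < 0" | "s > 0" by linarith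
  then show ?thesis
  proof cases
    case 1
    have "((\<lambda>s. 0) has_real_derivative 2 * max 0 s) (at s)" using 1 by simp
    then show ?thesis
      by (rule has_field_derivative_transform_within_open[of _ _ _ "{..<0}"]) (use 1 in auto)
  next
    case 2
    have "((\<lambda>s. s\<^sup>2) has_real_derivative 2 * max 0 s) (at s)"
      using 2 by (auto intro!: derivative_eq_intros)
    then show ?thesis
      by (rule has_field_derivative_transform_within_open[of _ _ _ "{0<..}"]) (use 2 in auto)
  qed
qed

lemma has_derivative_bump: "(bump r has_derivative bump' r x) (at x)"
proof -
  have "((\<lambda>x::'a. 1 - (norm x)\<^sup>2 / r\<^sup>2) has_derivative (\<lambda>h. - (2 * (x \<bullet> h) / r\<^sup>2))) (at x)"
  proof -
    have "((\<lambda>x::'a. 1 - (x \<bullet> x) * c) has_derivative (\<lambda>h. - (2 * (x \<bullet> h) * c))) (at x)" for c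
      by (auto intro!: derivative_eq_intros simp: inner_commute)
    then show ?thesis by (simp add: power2_norm_eq_inner divide_inverse)
  qed
  from has_derivative_compose[OF this has_real_derivative_max_0_squared[unfolded has_field_derivative_def]]
  show ?thesis
    by (simp add: bump_def[abs_def] bump'_def[abs_def] algebra_simps)
qed

lemma continuous_on_bump': "continuous_on UNIV (\<lambda>x. bump' r x h)"
  unfolding bump'_def by (cases "r = 0") (auto intro!: continuous_intros)

lemma C1_bump: "C1 (bump r)"
  by (rule C1_I[OF has_derivative_bump continuous_on_bump'])

lemma frechet_derivative_bump: "frechet_derivative (bump r) (at x) = bump' r x"
  by (rule frechet_derivative_at[OF has_derivative_bump, symmetric])

lemma bump_nonneg: "0 \<le> bump r x"
  by (simp add: bump_def)

lemma bump_le_1: "bump r x \<le> 1"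
proof -
  have "max 0 (1 - (norm x)\<^sup>2 / r\<^sup>2) \<le> 1" by simp
  then show ?thesis unfolding bump_def by (intro power_le_one) auto
qed

lemma bump_eq_0: "0 < r \<Longrightarrow> r \<le> norm x \<Longrightarrow> bump r x = 0"
  using power_mono[of r "norm x" 2] by (simp add: bump_def field_simps)

lemma bump_ge:
  assumes "0 < r" "norm x \<le> s" "s \<le> r"
  shows "(1 - s\<^sup>2 / r\<^sup>2)\<^sup>2 \<le> bump r x"
proof -
  have "(norm x)\<^sup>2 \<le> s\<^sup>2" "s\<^sup>2 \<le> r\<^sup>2"
    using assms order_trans[OF norm_ge_zero assms(2)] by (auto intro: power_mono)
  then show ?thesis
    unfolding bump_def using assms
    by (intro power_mono) (auto simp: field_simps)
qed

lemma bump_minus: "bump r (- x) = bump r x"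
  by (simp add: bump_def)

lemma bump'_minus: "bump' r (- x) h = - bump' r x h"
  by (simp add: bump'_def)

lemma bump'_bound:
  assumes "0 < r"
  shows "\<bar>bump' r x h\<bar> \<le> 4 / r * norm h"
proof (cases "norm x \<le> r")
  case True
  have "\<bar>x \<bullet> h\<bar> \<le> r * norm h"
    using Cauchy_Schwarz_ineq2[of x h] mult_right_mono[OF True norm_ge_zero[of h]] by linarith
  moreover have "\<bar>max 0 (1 - (norm x)\<^sup>2 / r\<^sup>2)\<bar> \<le> 1" by simp
  ultimately have "\<bar>max 0 (1 - (norm x)\<^sup>2 / r\<^sup>2)\<bar> * \<bar>x \<bullet> h\<bar> \<le> 1 * (r * norm h)"
    by (intro mult_mono) auto
  then have "4 * (\<bar>max 0 (1 - (norm x)\<^sup>2 / r\<^sup>2)\<bar> * \<bar>x \<bullet> h\<bar>) / r\<^sup>2 \<le> 4 * (r * norm h) / r\<^sup>2"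
    by (intro divide_right_mono) auto
  also have "\<dots> = 4 / r * norm h" using assms by (simp add: power2_eq_square)
  finally show ?thesis by (simp add: bump'_def abs_mult)
next
  case False
  then have "1 - (norm x)\<^sup>2 / r\<^sup>2 \<le> 0"
    using assms power_mono[of r "norm x" 2] by (simp add: field_simps)
  then show ?thesis using assms by (simp add: bump'_def max_absorb1)
qed

lemma bump_measurable [measurable]: "bump r \<in> borel_measurable borel"
  by (rule C1_measurable[OF C1_bump])

lemma integrable_bump:
  assumes "0 < r"
  shows "integrable lborel (bump r)"
proof (rule integrable_lborel_compact_support[of _ "cball 0 r"])
  show "\<bar>bump r x\<bar> \<le> 1" for x :: 'a using bump_nonneg[of r x] bump_le_1[of r x] by linarith
  show "bump r x = 0" if "x \<notin> cball 0 r" for x :: 'a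
    using that by (intro bump_eq_0 assms) simp
qed auto

text \<open>Scaling expresses \<open>moll r\<close> through one fixed constant, the integral of the
  unit bump. This makes the later comparison with the divergence of \<open>newton \<delta>\<close>
  uniform in \<delta>.\<close>

lemma integral_bump_scale:
  assumes "0 < r"
  shows "(LINT x|lborel. bump r (x::'a::euclidean_space)) = r ^ DIM('a) * (LINT x|lborel. bump 1 (x::'a))"
proof -
  have eq: "bump r (r *\<^sub>R x) = bump 1 x" for x :: 'a
    using assms by (simp add: bump_def power_mult_distrib)
  have "(LINT x|lborel. bump r (x::'a)) =
      (LINT x|density (distr lborel borel (\<lambda>x. 0 + r *\<^sub>R x)) (\<lambda>_. ennreal (\<bar>r\<bar> ^ DIM('a))). bump r (x::'a))"
    using lborel_affine[of r "0::'a"] assms by simp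
  also have "\<dots> = (LINT x|distr lborel borel (\<lambda>x. 0 + r *\<^sub>R x). \<bar>r\<bar> ^ DIM('a) *\<^sub>R bump r (x::'a))"
    by (rule integral_density) auto
  also have "\<dots> = (LINT x|lborel. \<bar>r\<bar> ^ DIM('a) *\<^sub>R bump r (0 + r *\<^sub>R (x::'a)))"
    by (rule integral_distr) measurable
  finally show ?thesis using assms by (simp add: eq)
qed

lemma integral_bump_pos:
  assumes "0 < r"
  shows "0 < (LINT x|lborel. bump r (x::'a::euclidean_space))"
proof -
  have "(LINT x|lborel. indicator (cball (0::'a) (1/2)) x * (1/2)) \<le> (LINT x|lborel. bump 1 (x::'a))"
  proof (rule integral_mono)
    show "integrable lborel (\<lambda>x. indicator (cball (0::'a) (1/2)) x * (1/2::real))"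
      by (intro integrable_mult_left integrable_real_indicator)
        (simp_all add: emeasure_lborel_cball_finite[unfolded infinity_ennreal_def])
    show "indicator (cball 0 (1/2)) x * (1/2) \<le> bump 1 x" for x :: 'a
      using bump_ge[of 1 x "1/2"] bump_nonneg[of 1 x]
      by (auto simp: indicator_def power2_eq_square)
  qed (simp add: integrable_bump)
  moreover have "0 < measure lborel (cball (0::'a) (1/2))"
    using content_cball_pos[of "1/2" "0::'a"] by simp
  ultimately have "0 < (LINT x|lborel. bump 1 (x::'a))" by (simp, linarith)
  then show ?thesis using assms by (subst integral_bump_scale) simp_all
qed

section \<open>Normalised bumps as mollifiers\<close>

definition moll :: "real \<Rightarrow> 'a::euclidean_space \<Rightarrow> real" where
  "moll r x = bump r x / (LINT x|lborel. bump r (x::'a))"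

lemma
  fixes x :: "'a::euclidean_space"
  assumes "0 < r"
  shows moll_nonneg: "0 \<le> moll r x"
    and moll_eq_0: "r \<le> norm x \<Longrightarrow> moll r x = 0"
    and integrable_moll: "integrable lborel (moll r :: 'a \<Rightarrow> real)"
    and integral_moll: "(LINT x|lborel. moll r (x::'a)) = 1"
    and moll_minus: "moll r (- x) = moll r x"
    and C1_moll: "C1 (moll r :: 'a \<Rightarrow> real)"
    and moll_bounded: "\<exists>c. \<forall>x::'a. norm (moll r x) \<le> c"
    and moll'_bounded: "\<exists>C. \<forall>(x::'a) h. norm (frechet_derivative (moll r) (at x) h) \<le> C * norm h"
    and moll'_minus: "frechet_derivative (moll r) (at (- x)) h = - frechet_derivative (moll r) (at x) h"
proof -
  define I where "I = (LINT x|lborel. bump r (x::'a))"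
  have I: "I > 0" using integral_bump_pos[OF assms] by (simp add: I_def)
  have m: "moll r = (\<lambda>x::'a. bump r x / I)" by (auto simp: moll_def I_def)
  have D: "(moll r has_derivative (\<lambda>h. bump' r x h / I)) (at x)" for x :: 'a
    unfolding m by (rule bounded_linear.has_derivative[OF bounded_linear_divide has_derivative_bump])
  have D': "frechet_derivative (moll r) (at x) = (\<lambda>h. bump' r x h / I)" for x :: 'a
    by (rule frechet_derivative_at[OF D, symmetric])
  show "0 \<le> moll r x" using I by (simp add: m bump_nonneg)
  show "r \<le> norm x \<Longrightarrow> moll r x = 0" using assms by (simp add: m bump_eq_0)
  show "integrable lborel (moll r :: 'a \<Rightarrow> real)" by (simp add: m integrable_bump assms)
  show "(LINT x|lborel. moll r (x::'a)) = 1" using I by (simp add: m I_def[symmetric])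
  show "moll r (- x) = moll r x" by (simp add: m bump_minus)
  show "C1 (moll r :: 'a \<Rightarrow> real)" by (rule C1_I[OF D]) (use I in \<open>auto intro!: continuous_intros continuous_on_bump'\<close>)
  show "\<exists>c. \<forall>x::'a. norm (moll r x) \<le> c"
    using I by (auto simp: m bump_nonneg bump_le_1 intro!: exI[of _ "1 / I"] divide_right_mono)
  show "\<exists>C. \<forall>(x::'a) h. norm (frechet_derivative (moll r) (at x) h) \<le> C * norm h"
    using I divide_right_mono[OF bump'_bound[OF assms], of I] by (auto simp: D' intro!: exI[of _ "4 / r / I"])
  show "frechet_derivative (moll r) (at (- x)) h = - frechet_derivative (moll r) (at x) h"
    by (simp add: D' bump'_minus)
qed

subsection \<open>Mollification converges in the mean\<close>

text \<open>The modulus of continuity of \<open>f\<close> in the L1 norm, as a function of the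
  translation vector.\<close>

definition shift_dist :: "('a::euclidean_space \<Rightarrow> real) \<Rightarrow> 'a \<Rightarrow> real" where
  "shift_dist f y = (LINT x|lborel. \<bar>f (y + x) - f x\<bar>)"

lemma integrable_translate:
  fixes f :: "'a::euclidean_space \<Rightarrow> real"
  shows "integrable lborel f \<Longrightarrow> integrable lborel (\<lambda>x. f (y + x))"
  using lborel_integral_translate(2)[of f y] borel_measurable_integrable[of lborel f] by simp

text \<open>Translation preserves the L1 distance of \<open>f\<close> and \<open>g\<close>, so
  \<open>shift_dist f y\<close> exceeds \<open>shift_dist g y\<close> by at most twice that
  distance. Continuity of translations therefore passes to L1 limits.\<close>

lemma shift_dist_tendsto_0_approx:
  fixes f :: "'a::euclidean_space \<Rightarrow> real"
  assumes f: "integrable lborel f"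
    and approx: "\<And>e. 0 < e \<Longrightarrow> \<exists>g. integrable lborel g \<and> (shift_dist g \<longlongrightarrow> 0) (at 0) \<and>
      (LINT x|lborel. \<bar>g x - f x\<bar>) \<le> e"
  shows "(shift_dist f \<longlongrightarrow> 0) (at 0)"
proof (rule tendstoI)
  fix e :: real assume "0 < e"
  then obtain g where g: "integrable lborel g" "(shift_dist g \<longlongrightarrow> 0) (at 0)"
    "(LINT x|lborel. \<bar>g x - f x\<bar>) \<le> e / 4"
    using approx[of "e / 4"] by auto
  have m: "f \<in> borel_measurable borel" "g \<in> borel_measurable borel"
    using f g(1) by (auto dest: borel_measurable_integrable)
  have "\<forall>\<^sub>F y in at 0. \<bar>shift_dist g y\<bar> < e / 4"
    using tendstoD[OF g(2), of "e / 4"] \<open>0 < e\<close> by simp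
  then show "\<forall>\<^sub>F y in at 0. dist (shift_dist f y) 0 < e"
  proof eventually_elim
    case (elim y)
    have i: "integrable lborel (\<lambda>x. f (y + x))" "integrable lborel (\<lambda>x. g (y + x))"
      using f g(1) m by (simp_all add: lborel_integral_translate)
    have "shift_dist f y \<le> (LINT x|lborel. \<bar>g (y + x) - f (y + x)\<bar> + \<bar>g (y + x) - g x\<bar> + \<bar>g x - f x\<bar>)"
      unfolding shift_dist_def using i f g(1) by (intro integral_mono) auto
    also have "\<dots> = (LINT x|lborel. \<bar>g (y + x) - f (y + x)\<bar>) + shift_dist g y + (LINT x|lborel. \<bar>g x - f x\<bar>)"
      using i f g(1) by (simp add: shift_dist_def)
    also have "(LINT x|lborel. \<bar>g (y + x) - f (y + x)\<bar>) = (LINT x|lborel. \<bar>g x - f x\<bar>)"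
      using m by (subst lborel_integral_translate(1)[of "\<lambda>x. \<bar>g x - f x\<bar>"]) auto
    finally have "shift_dist f y < e" using g(3) elim \<open>0 < e\<close> by linarith
    moreover have "0 \<le> shift_dist f y" by (simp add: shift_dist_def)
    ultimately show ?case by simp
  qed
qed

text \<open>The symmetric difference of \<open>U\<close> and its translate has twice the measure of
  \<open>U\<close> minus twice that of the overlap, so only the overlap needs a limit. Shifted
  indicators converge at the points of the open set \<open>U\<close>, but may fail to do so on its
  boundary, which can have positive measure.\<close>

lemma shift_dist_indicator_open:
  fixes U :: "'a::euclidean_space set"
  assumes U: "open U" "emeasure lborel U < \<infinity>"
  shows "(shift_dist (indicator U) \<longlongrightarrow> 0) (at 0)"
  unfolding tendsto_at_iff_sequentially
proof (intro allI impI)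
  fix Y :: "nat \<Rightarrow> 'a" assume Y: "Y \<longlonglongrightarrow> 0"
  let ?i = "indicator U :: 'a \<Rightarrow> real"
  have [measurable]: "U \<in> sets borel" using U by simp
  have iU: "integrable lborel ?i" using U by (intro integrable_real_indicator) auto
  have iY: "integrable lborel (\<lambda>x. ?i (Y n + x))" for n
    using iU by (simp add: lborel_integral_translate)
  have iP: "integrable lborel (\<lambda>x. ?i x * ?i (Y n + x))" for n
    by (rule Bochner_Integration.integrable_bound[OF iU]) (auto simp: indicator_def)
  have "(\<lambda>n. LINT x|lborel. ?i x * ?i (Y n + x)) \<longlonglongrightarrow> (LINT x|lborel. ?i x)"
  proof (rule integral_dominated_convergence[OF _ _ iU])
    show "AE x in lborel. (\<lambda>n. ?i x * ?i (Y n + x)) \<longlonglongrightarrow> ?i x"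
    proof (rule AE_I2)
      fix x
      show "(\<lambda>n. ?i x * ?i (Y n + x)) \<longlonglongrightarrow> ?i x"
      proof (cases "x \<in> U")
        case True
        have "(\<lambda>n. Y n + x) \<longlonglongrightarrow> 0 + x" by (intro tendsto_intros Y)
        then have "\<forall>\<^sub>F n in sequentially. Y n + x \<in> U"
          using U(1) True by (intro topological_tendstoD) auto
        then have "\<forall>\<^sub>F n in sequentially. ?i x * ?i (Y n + x) = ?i x"
          by eventually_elim (simp add: True)
        then show ?thesis by (rule tendsto_eventually)
      qed simp
    qed
  qed (auto simp: indicator_def)
  then have "(\<lambda>n. 2 * (LINT x|lborel. ?i x) - 2 * (LINT x|lborel. ?i x * ?i (Y n + x))) \<longlonglongrightarrow>
      2 * (LINT x|lborel. ?i x) - 2 * (LINT x|lborel. ?i x)"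
    by (intro tendsto_intros)
  moreover have "shift_dist ?i (Y n) = 2 * (LINT x|lborel. ?i x) - 2 * (LINT x|lborel. ?i x * ?i (Y n + x))" for n
  proof -
    have "\<bar>?i (Y n + x) - ?i x\<bar> = ?i (Y n + x) + ?i x - 2 * (?i x * ?i (Y n + x))" for x
      by (auto simp: indicator_def)
    then have "shift_dist ?i (Y n) = (LINT x|lborel. ?i (Y n + x) + ?i x - 2 * (?i x * ?i (Y n + x)))"
      by (simp only: shift_dist_def)
    also have "\<dots> = (LINT x|lborel. ?i (Y n + x)) + (LINT x|lborel. ?i x) - 2 * (LINT x|lborel. ?i x * ?i (Y n + x))"
      by (subst Bochner_Integration.integral_diff)
         (intro Bochner_Integration.integrable_add Bochner_Integration.integrable_mult_right iU iY iP
           | simp only: Bochner_Integration.integral_add iU iY Bochner_Integration.integral_mult_right_zero)+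
    also have "(LINT x|lborel. ?i (Y n + x)) = (LINT x|lborel. ?i x)"
      by (rule lborel_integral_translate) simp
    finally show ?thesis by simp
  qed
  ultimately show "(shift_dist ?i \<circ> Y) \<longlonglongrightarrow> 0" by (simp add: comp_def)
qed

text \<open>Continuity of translations in L1, by induction over integrable functions. Borel sets of
  finite measure are approximated from outside by open sets, and monotone domination of the
  approximating sequence by \<open>f\<close> gives its convergence in L1.\<close>

lemma shift_dist_tendsto_0:
  fixes f :: "'a::euclidean_space \<Rightarrow> real"
  assumes "integrable lborel f"
  shows "(shift_dist f \<longlongrightarrow> 0) (at 0)"
  using assms
proof (induction rule: integrable_induct)
  case (base A c)
  have A[measurable]: "A \<in> sets borel" using base by simp
  have iA: "integrable lborel (indicator A :: 'a \<Rightarrow> real)"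
    using base by (intro integrable_real_indicator) auto
  have "(shift_dist (indicator A) \<longlongrightarrow> 0) (at 0)"
  proof (rule shift_dist_tendsto_0_approx[OF iA])
    fix e :: real assume e: "0 < e"
    obtain U where U: "open U" "A \<subseteq> U" "emeasure lborel (U - A) \<le> ennreal e"
      using outer_regular_lborel_le[OF A e] by blast
    have [measurable]: "U \<in> sets borel" using U by simp
    have UA: "emeasure lborel (U - A) < \<infinity>" using U(3) by (auto intro: le_less_trans)
    have "emeasure lborel U = emeasure lborel A + emeasure lborel (U - A)"
      using U(2) by (subst plus_emeasure) (auto simp: Un_absorb1)
    then have fU: "emeasure lborel U < \<infinity>" using base(2) UA by simp
    have "(LINT x|lborel. \<bar>indicator U x - indicator A x :: real\<bar>) = (LINT x|lborel. indicator (U - A) x)"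
      using U(2) by (intro Bochner_Integration.integral_cong) (auto simp: indicator_def)
    also have "\<dots> = measure lborel (U - A)" by simp
    also have "\<dots> \<le> e" using U(3) e by (simp add: measure_def enn2real_leI)
    finally show "\<exists>g. integrable lborel g \<and> (shift_dist g \<longlongrightarrow> 0) (at 0) \<and>
        (LINT x|lborel. \<bar>g x - indicator A x :: real\<bar>) \<le> e"
      using fU U(1) by (intro exI[of _ "indicator U"] conjI shift_dist_indicator_open integrable_real_indicator) auto
  qed
  then have "((\<lambda>y. shift_dist (indicator A) y * \<bar>c\<bar>) \<longlongrightarrow> 0 * \<bar>c\<bar>) (at 0)" by (rule tendsto_mult_right)
  moreover have "shift_dist (\<lambda>x. indicator A x *\<^sub>R c) = (\<lambda>y. shift_dist (indicator A) y * \<bar>c\<bar>)"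
    by (auto simp: shift_dist_def fun_eq_iff left_diff_distrib[symmetric] abs_mult)
  ultimately show ?case by simp
next
  case (add f g)
  have "((\<lambda>y. shift_dist f y + shift_dist g y) \<longlongrightarrow> 0 + 0) (at 0)"
    by (intro tendsto_add add)
  then have T: "((\<lambda>y. shift_dist f y + shift_dist g y) \<longlongrightarrow> 0) (at 0)" by simp
  have i: "integrable lborel (\<lambda>x. f (y + x))" "integrable lborel (\<lambda>x. g (y + x))" for y
    by (intro integrable_translate add)+
  show ?case
  proof (rule tendsto_sandwich[OF _ _ tendsto_const T])
    have "shift_dist (\<lambda>x. f x + g x) y \<le> shift_dist f y + shift_dist g y" for y
    proof -
      have "shift_dist (\<lambda>x. f x + g x) y \<le> (LINT x|lborel. \<bar>f (y + x) - f x\<bar> + \<bar>g (y + x) - g x\<bar>)"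
        unfolding shift_dist_def using add.hyps i by (intro integral_mono) auto
      also have "\<dots> = shift_dist f y + shift_dist g y"
        using add.hyps i by (simp add: shift_dist_def)
      finally show ?thesis .
    qed
    then show "\<forall>\<^sub>F y in at 0. shift_dist (\<lambda>x. f x + g x) y \<le> shift_dist f y + shift_dist g y" by simp
    show "\<forall>\<^sub>F y in at 0. 0 \<le> shift_dist (\<lambda>x. f x + g x) y" by (simp add: shift_dist_def)
  qed
next
  case (lim f s)
  have "(\<lambda>i. LINT x|lborel. \<bar>s i x - f x\<bar>) \<longlonglongrightarrow> (LINT x|(lborel :: 'a measure). 0)"
  proof (rule integral_dominated_convergence)
    show "integrable lborel (\<lambda>x. 3 * \<bar>f x\<bar>)" using lim by simp
    show "(\<lambda>x. \<bar>s i x - f x\<bar>) \<in> borel_measurable lborel" for i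
      using lim by simp
    show "AE x in lborel. (\<lambda>i. \<bar>s i x - f x\<bar>) \<longlonglongrightarrow> 0"
    proof (rule AE_I2)
      fix x
      have "(\<lambda>i. s i x) \<longlonglongrightarrow> f x" using lim by simp
      then show "(\<lambda>i. \<bar>s i x - f x\<bar>) \<longlonglongrightarrow> 0" by (intro tendsto_rabs_zero LIM_zero)
    qed
    show "AE x in lborel. norm \<bar>s i x - f x\<bar> \<le> 3 * \<bar>f x\<bar>" for i
    proof (rule AE_I2)
      fix x
      have "norm (s i x) \<le> 2 * norm (f x)" using lim by simp
      then show "norm \<bar>s i x - f x\<bar> \<le> 3 * \<bar>f x\<bar>" by simp
    qed
  qed simp
  then have L: "(\<lambda>i. LINT x|lborel. \<bar>s i x - f x\<bar>) \<longlonglongrightarrow> 0" by simp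
  show ?case
  proof (rule shift_dist_tendsto_0_approx[OF lim(4)])
    fix e :: real assume "0 < e"
    from order_tendstoD(2)[OF L this] obtain i where "(LINT x|lborel. \<bar>s i x - f x\<bar>) < e"
      by (auto simp: eventually_sequentially)
    then show "\<exists>g. integrable lborel g \<and> (shift_dist g \<longlongrightarrow> 0) (at 0) \<and> (LINT x|lborel. \<bar>g x - f x\<bar>) \<le> e"
      using lim(1,5) by (intro exI[of _ "s i"]) auto
  qed
qed

section \<open>Reflections and the L1 error of mollification\<close>

lemma lborel_distr_reflect: "distr lborel borel (\<lambda>x. c - x) = (lborel :: 'a::euclidean_space measure)"
  using lborel_affine[of "-1" c, symmetric] by (simp add: density_1)

lemma lborel_integral_reflect:
  fixes f :: "'a::euclidean_space \<Rightarrow> 'b::{banach, second_countable_topology}"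
  assumes [measurable]: "f \<in> borel_measurable borel"
  shows "(LINT x|lborel. f (c - x)) = (LINT x|lborel. f x)"
proof -
  have "(LINT x|lborel. f x) = (LINT x|distr lborel borel (\<lambda>x. c - x). f x)"
    by (simp add: lborel_distr_reflect)
  also have "\<dots> = (LINT x|lborel. f (c - x))"
    by (subst integral_distr) simp_all
  finally show ?thesis by simp
qed

lemma lborel_integrable_reflect:
  fixes f :: "'a::euclidean_space \<Rightarrow> 'b::{banach, second_countable_topology}"
  assumes [measurable]: "f \<in> borel_measurable borel"
  shows "integrable lborel (\<lambda>x. f (c - x)) \<longleftrightarrow> integrable lborel f"
proof -
  have "integrable lborel f \<longleftrightarrow> integrable (distr lborel borel (\<lambda>x. c - x)) f"
    by (simp add: lborel_distr_reflect)
  also have "\<dots> \<longleftrightarrow> integrable lborel (\<lambda>x. f (c - x))"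
    by (subst integrable_distr_eq) simp_all
  finally show ?thesis by simp
qed

lemma moll_measurable [measurable]: "moll r \<in> borel_measurable borel"
  unfolding moll_def by measurable

lemma conv_measurable:
  assumes [measurable]: "f \<in> borel_measurable borel" "k \<in> borel_measurable borel"
  shows "conv f k \<in> borel_measurable borel"
  unfolding conv_def by measurable

lemma conv_moll_minus:
  fixes f :: "'a::euclidean_space \<Rightarrow> real"
  assumes f: "integrable lborel f" and r: "0 < r"
  shows "conv f (moll r) x - f x = (LINT y|lborel. moll r y * (f (x - y) - f x))"
proof -
  have [measurable]: "f \<in> borel_measurable borel" using f by (auto dest: borel_measurable_integrable)
  obtain c where c: "\<And>x::'a. norm (moll r x) \<le> c" using moll_bounded[OF r] by blast
  have "conv f (moll r) x = (LINT y|lborel. f (x - y) * moll r (x - (x - y)))"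
    unfolding conv_def real_scaleR_def by (rule lborel_integral_reflect[symmetric]) measurable
  also have "\<dots> = (LINT y|lborel. moll r y * f (x - y))"
    by (simp add: mult.commute)
  finally have 1: "conv f (moll r) x = (LINT y|lborel. moll r y * f (x - y))" .
  have "integrable lborel (\<lambda>y. f (x - y))" using f by (simp add: lborel_integrable_reflect)
  from integrable_scaleR_bounded[OF this moll_measurable c]
  have 2: "integrable lborel (\<lambda>y. moll r y * f (x - y))" by (simp add: mult.commute)
  have 3: "integrable lborel (\<lambda>y::'a. moll r y * f x)"
    using integrable_moll[OF r] by (rule integrable_mult_left)
  have "(LINT y|lborel. moll r y * f (x - y) - moll r y * f x) =
      (LINT y|lborel. moll r y * f (x - y)) - (LINT y|lborel. moll r (y::'a) * f x)"
    by (rule Bochner_Integration.integral_diff[OF 2 3])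
  then show ?thesis
    using 1 by (simp add: right_diff_distrib integral_moll[OF r])
qed

text \<open>As \<open>moll r\<close> has integral 1, the error at \<open>x\<close> is an average of
  differences \<open>f (x - y) - f x\<close>. Tonelli turns its L1 norm into an average of
  \<open>shift_dist f (- y)\<close> over the ball of radius \<open>r\<close>. Working with
  nonnegative integrals yields integrability of the mollification as well.\<close>

lemma L1_dist_conv_moll_le:
  fixes f :: "'a::euclidean_space \<Rightarrow> real"
  assumes f: "integrable lborel f" and r: "0 < r" and e: "0 \<le> e" "\<And>y. norm y < r \<Longrightarrow> shift_dist f y \<le> e"
  shows "(LINT x|lborel. \<bar>conv f (moll r) x - f x\<bar>) \<le> e"
    and "integrable lborel (conv f (moll r))"
proof -
  have [measurable]: "f \<in> borel_measurable borel" using f by (auto dest: borel_measurable_integrable)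
  have [measurable]: "conv f (moll r) \<in> borel_measurable borel" by (rule conv_measurable) measurable
  have "(\<integral>\<^sup>+x. ennreal \<bar>conv f (moll r) x - f x\<bar> \<partial>lborel)
      \<le> (\<integral>\<^sup>+x. (\<integral>\<^sup>+y. ennreal (moll r y * \<bar>f (x - y) - f x\<bar>) \<partial>lborel) \<partial>lborel)"
  proof (rule nn_integral_mono)
    fix x
    \<comment> \<open>Without integrability on the right the Bochner integral is 0 by convention,
      and the estimate holds in that case too.\<close>
    have "ennreal \<bar>conv f (moll r) x - f x\<bar> \<le> (\<integral>\<^sup>+y. norm (moll r y * (f (x - y) - f x)) \<partial>lborel)"
      using integral_norm_bound_ennreal[of lborel "\<lambda>y. moll r y * (f (x - y) - f x)"]
      by (cases "integrable lborel (\<lambda>y. moll r y * (f (x - y) - f x))")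
         (simp_all add: conv_moll_minus[OF f r] not_integrable_integral_eq)
    then show "ennreal \<bar>conv f (moll r) x - f x\<bar> \<le> (\<integral>\<^sup>+y. ennreal (moll r y * \<bar>f (x - y) - f x\<bar>) \<partial>lborel)"
      by (simp add: abs_mult abs_of_nonneg[OF moll_nonneg[OF r]])
  qed
  also have "\<dots> = (\<integral>\<^sup>+y. (\<integral>\<^sup>+x. ennreal (moll r y * \<bar>f (x - y) - f x\<bar>) \<partial>lborel) \<partial>lborel)"
    by (rule lborel_pair.Fubini') measurable
  also have "\<dots> \<le> (\<integral>\<^sup>+y. ennreal (moll r (y::'a) * e) \<partial>lborel)"
  proof (rule nn_integral_mono)
    fix y :: 'a
    show "(\<integral>\<^sup>+x. ennreal (moll r y * \<bar>f (x - y) - f x\<bar>) \<partial>lborel) \<le> ennreal (moll r y * e)"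
    proof (cases "norm y < r")
      case True
      have "integrable lborel (\<lambda>x. f (-y + x))" by (rule integrable_translate[OF f])
      then have "integrable lborel (\<lambda>x. moll r y * \<bar>f (-y + x) - f x\<bar>)" using f by simp
      then have "(\<integral>\<^sup>+x. ennreal (moll r y * \<bar>f (-y + x) - f x\<bar>) \<partial>lborel)
          = ennreal (LINT x|lborel. moll r y * \<bar>f (-y + x) - f x\<bar>)"
        by (rule nn_integral_eq_integral) (simp add: moll_nonneg[OF r])
      also have "\<dots> = ennreal (moll r y * shift_dist f (-y))" by (simp add: shift_dist_def)
      also have "\<dots> \<le> ennreal (moll r y * e)"
        using e(2)[of "-y"] True by (intro ennreal_leI mult_left_mono moll_nonneg[OF r]) auto
      finally show ?thesis by simp
    next
      case False
      then show ?thesis by (simp add: moll_eq_0[OF r])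
    qed
  qed
  also have "\<dots> = ennreal (LINT y|lborel. moll r (y::'a) * e)"
    by (rule nn_integral_eq_integral) (simp_all add: integrable_moll[OF r] moll_nonneg[OF r] e)
  also have "\<dots> = ennreal e" by (simp add: integral_moll[OF r])
  finally have le: "(\<integral>\<^sup>+x. ennreal \<bar>conv f (moll r) x - f x\<bar> \<partial>lborel) \<le> ennreal e" .
  then show "(LINT x|lborel. \<bar>conv f (moll r) x - f x\<bar>) \<le> e"
    using e(1) by (intro integral_real_bounded)
  have "integrable lborel (\<lambda>x. conv f (moll r) x - f x)"
    using le by (intro integrableI_bounded) (auto intro: le_less_trans)
  then have "integrable lborel (\<lambda>x. (conv f (moll r) x - f x) + f x)"
    by (intro Bochner_Integration.integrable_add f)
  then show "integrable lborel (conv f (moll r))" by simp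
qed

lemma L1_conv_moll:
  fixes f :: "'a::euclidean_space \<Rightarrow> real"
  assumes f: "integrable lborel f" and e: "0 < e"
  shows "\<exists>d>0. \<forall>r. 0 < r \<longrightarrow> r \<le> d \<longrightarrow>
    integrable lborel (conv f (moll r)) \<and> (LINT x|lborel. \<bar>conv f (moll r) x - f x\<bar>) \<le> e"
proof -
  have "\<forall>\<^sub>F y in at 0. shift_dist f y < e"
    using order_tendstoD(2)[OF shift_dist_tendsto_0[OF f] e] .
  then obtain d where d: "d > 0" "\<And>y. y \<noteq> 0 \<Longrightarrow> norm y < d \<Longrightarrow> shift_dist f y < e"
    by (auto simp: eventually_at)
  have "shift_dist f y \<le> e" if "norm y < r" "r \<le> d" for y r
    using d(2)[of y] that e by (cases "y = 0") (auto simp: shift_dist_def)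
  note * = this
  show ?thesis
  proof (intro exI[of _ d] conjI allI impI)
    show "0 < d" by (rule d)
    fix r assume r: "0 < r" "r \<le> d"
    show "(LINT x|lborel. \<bar>conv f (moll r) x - f x\<bar>) \<le> e"
      by (rule L1_dist_conv_moll_le(1)[OF f r(1) less_imp_le[OF e] *[OF _ r(2)]])
    show "integrable lborel (conv f (moll r))"
      by (rule L1_dist_conv_moll_le(2)[OF f r(1) less_imp_le[OF e] *[OF _ r(2)]])
  qed
qed

text \<open>With a bounded kernel the integrand on the product space is dominated by a multiple of
  \<open>f x * g y\<close>, so Fubini applies. The effect is to move a convolution from one factor
  of a pairing to the other.\<close>

lemma integral_conv_swap:
  fixes f g k :: "'a::euclidean_space \<Rightarrow> real"
  assumes f: "integrable lborel f" and g: "integrable lborel g"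
    and k: "k \<in> borel_measurable borel" "\<And>x. \<bar>k x\<bar> \<le> c"
  shows "(LINT x|lborel. f x * (LINT y|lborel. g y * k (x - y))) =
         (LINT y|lborel. g y * (LINT x|lborel. f x * k (x - y)))"
    and "integrable lborel (\<lambda>x. f x * (LINT y|lborel. g y * k (x - y)))"
proof -
  note [measurable] = k(1)
  have [measurable]: "f \<in> borel_measurable borel" "g \<in> borel_measurable borel"
    using f g by (auto dest: borel_measurable_integrable)
  have "integrable (lborel \<Otimes>\<^sub>M lborel) (\<lambda>(x, y). f x * g y * c)"
    by (rule lborel_pair.Fubini_integrable) (use f g in \<open>auto simp: abs_mult\<close>)
  then have I: "integrable (lborel \<Otimes>\<^sub>M lborel) (\<lambda>(x, y). f x * (g y * k (x - y)))"
  proof (rule Bochner_Integration.integrable_bound)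
    show "AE p in lborel \<Otimes>\<^sub>M lborel. norm (case p of (x, y) \<Rightarrow> f x * (g y * k (x - y)))
        \<le> norm (case p of (x, y) \<Rightarrow> f x * g y * c)"
      using k(2) by (intro AE_I2) (auto simp: abs_mult mult.assoc intro!: mult_left_mono order_trans[OF k(2)])
  qed measurable
  have "(LINT x|lborel. f x * (LINT y|lborel. g y * k (x - y))) =
      (LINT x|lborel. (LINT y|lborel. f x * (g y * k (x - y))))"
    by simp
  also have "\<dots> = (LINT y|lborel. (LINT x|lborel. f x * (g y * k (x - y))))"
    by (rule lborel_pair.Fubini_integral[OF I, symmetric])
  also have "\<dots> = (LINT y|lborel. (LINT x|lborel. g y * (f x * k (x - y))))"
    by (simp add: mult.left_commute)
  finally show "(LINT x|lborel. f x * (LINT y|lborel. g y * k (x - y))) =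
         (LINT y|lborel. g y * (LINT x|lborel. f x * k (x - y)))" by simp
  show "integrable lborel (\<lambda>x. f x * (LINT y|lborel. g y * k (x - y)))"
    using lborel_pair.integrable_fst[OF I] by simp
qed

subsection \<open>Test fields and the truncation inequality\<close>

text \<open>Unlike members of \<open>C1c \<Omega>\<close>, these fields are controlled on the whole
  space, so that integrals over the domain become integrals against \<open>lborel\<close> and
  convolutions make sense.\<close>

definition test_field :: "'a::euclidean_space set \<Rightarrow> ('a \<Rightarrow> 'b::euclidean_space) \<Rightarrow> bool" where
  "test_field \<Omega> z \<longleftrightarrow> C1 z \<and> (\<exists>K. compact K \<and> K \<subseteq> \<Omega> \<and> (\<forall>x. x \<notin> K \<longrightarrow> z x = 0))"

text \<open>Equivalent to \<open>polar \<phi> x (z x) \<le> 1\<close> on \<open>\<Omega>\<close>, but free of the supremum.\<close>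

definition admissible :: "('a::euclidean_space \<Rightarrow> 'a \<Rightarrow> real) \<Rightarrow> 'a set \<Rightarrow> ('a \<Rightarrow> 'a) \<Rightarrow> bool" where
  "admissible \<phi> \<Omega> z \<longleftrightarrow> (\<forall>x\<in>\<Omega>. \<forall>\<xi>. z x \<bullet> \<xi> \<le> \<phi> x \<xi>)"

definition tv_le :: "('a::euclidean_space \<Rightarrow> 'a \<Rightarrow> real) \<Rightarrow> 'a set \<Rightarrow> ('a \<Rightarrow> real) \<Rightarrow> real \<Rightarrow> bool" where
  "tv_le \<phi> \<Omega> f T \<longleftrightarrow> (\<forall>z. test_field \<Omega> z \<and> admissible \<phi> \<Omega> z \<longrightarrow>
     (LINT x|lborel. f x * divergence z x) \<le> T)"

text \<open>Homogeneity reduces the claim to unit vectors, where compactness gives uniform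
  continuity. The additive error \<open>e * m\<close> becomes relative because
  \<open>\<phi> x\<close> is at least \<open>m\<close> on the unit sphere.\<close>

lemma metric_integrand_uniform:
  fixes \<Omega> :: "'a::euclidean_space set"
  assumes \<phi>: "metric_integrand \<Omega> \<phi>" and "bounded \<Omega>" and e: "0 < e"
  obtains d where "0 < d"
    "\<And>x y \<xi>. x \<in> \<Omega> \<Longrightarrow> y \<in> \<Omega> \<Longrightarrow> dist x y \<le> d \<Longrightarrow> \<phi> y \<xi> \<le> (1 + e) * \<phi> x \<xi>"
proof -
  let ?f = "\<lambda>(x, \<xi>). \<phi> x \<xi>"
  obtain m where m: "0 < m" "\<And>x \<xi>. x \<in> closure \<Omega> \<Longrightarrow> m * norm \<xi> \<le> \<phi> x \<xi>"
    using \<phi> unfolding metric_integrand_def by blast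
  have hom: "\<phi> x (t *\<^sub>R \<xi>) = \<bar>t\<bar> * \<phi> x \<xi>" if "x \<in> closure \<Omega>" for x t \<xi>
    using \<phi> that unfolding metric_integrand_def by blast
  have "continuous_on (closure \<Omega> \<times> sphere 0 1) ?f"
    using \<phi> unfolding metric_integrand_def by (auto elim: continuous_on_subset)
  moreover have "compact (closure \<Omega> \<times> sphere (0::'a) 1)"
    using \<open>bounded \<Omega>\<close> by (intro compact_Times) (auto simp: compact_closure)
  ultimately have "uniformly_continuous_on (closure \<Omega> \<times> sphere 0 1) ?f"
    by (rule compact_uniformly_continuous)
  moreover have "0 < e * m" using e m by simp
  ultimately obtain d where d: "0 < d" "\<And>p q. p \<in> closure \<Omega> \<times> sphere 0 1 \<Longrightarrow>
      q \<in> closure \<Omega> \<times> sphere 0 1 \<Longrightarrow> dist q p < d \<Longrightarrow> dist (?f q) (?f p) < e * m"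
    unfolding uniformly_continuous_on_def by metis
  show ?thesis
  proof
    show "0 < d / 2" using d by simp
    fix x y \<xi> assume xy: "x \<in> \<Omega>" "y \<in> \<Omega>" "dist x y \<le> d / 2"
    then have cl: "x \<in> closure \<Omega>" "y \<in> closure \<Omega>" using closure_subset by blast+
    show "\<phi> y \<xi> \<le> (1 + e) * \<phi> x \<xi>"
    proof (cases "\<xi> = 0")
      case True
      then show ?thesis using hom[OF cl(1), of 0 0] hom[OF cl(2), of 0 0] by simp
    next
      case False
      define \<nu> where "\<nu> = \<xi> /\<^sub>R norm \<xi>"
      have \<nu>: "norm \<nu> = 1" "\<xi> = norm \<xi> *\<^sub>R \<nu>" using False by (auto simp: \<nu>_def)
      have "dist (y, \<nu>) (x, \<nu>) < d" using xy(3) d(1) by (simp add: dist_Pair_Pair dist_commute)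
      then have "dist (\<phi> y \<nu>) (\<phi> x \<nu>) < e * m"
        using d(2)[of "(x, \<nu>)" "(y, \<nu>)"] cl \<nu> by simp
      moreover have "e * m \<le> e * \<phi> x \<nu>" using m(2)[OF cl(1), of \<nu>] \<nu>(1) e by simp
      ultimately have "\<phi> y \<nu> \<le> (1 + e) * \<phi> x \<nu>" by (simp add: dist_real_def algebra_simps)
      then have "norm \<xi> * \<phi> y \<nu> \<le> norm \<xi> * ((1 + e) * \<phi> x \<nu>)" by (intro mult_left_mono) auto
      then show ?thesis
        using hom[OF cl(1), of "norm \<xi>" \<nu>] hom[OF cl(2), of "norm \<xi>" \<nu>] \<nu>(2) by (simp add: algebra_simps)
    qed
  qed
qed

section \<open>Mollified vector fields\<close>

definition moll_field :: "real \<Rightarrow> ('a::euclidean_space \<Rightarrow> 'a) \<Rightarrow> 'a \<Rightarrow> 'a" where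
  "moll_field r z x = (\<Sum>b\<in>Basis. conv (\<lambda>y. z y \<bullet> b) (moll r) x *\<^sub>R b)"

context
  fixes z :: "'a::euclidean_space \<Rightarrow> 'a" and K :: "'a set" and r :: real
  assumes z: "continuous_on UNIV z" and K: "compact K" "\<And>x. x \<notin> K \<Longrightarrow> z x = 0" and r: "0 < r"
begin

lemma integrable_inner_compact_support: "integrable lborel (\<lambda>y. z y \<bullet> \<xi>)"
proof -
  have "bounded ((\<lambda>y. z y \<bullet> \<xi>) ` K)"
    by (intro compact_imp_bounded compact_continuous_image K continuous_intros continuous_on_subset[OF z]) simp
  then obtain c where c: "\<And>y. y \<in> K \<Longrightarrow> \<bar>z y \<bullet> \<xi>\<bar> \<le> c" by (auto simp: bounded_iff)
  have "\<bar>z y \<bullet> \<xi>\<bar> \<le> \<bar>c\<bar>" for y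
    using c[of y] K(2)[of y] by (cases "y \<in> K") (auto intro: order_trans[OF _ abs_ge_self])
  then show ?thesis
    using K by (intro integrable_lborel_compact_support borel_measurable_continuous_onI continuous_intros z) auto
qed

text \<open>Coordinates are recombined so that the pairing with an arbitrary \<xi>, not only a basis
  vector, is an average of \<open>z y \<bullet> \<xi>\<close>. Linear inequalities for
  \<open>z\<close> can then be averaged.\<close>

lemma moll_field_inner: "moll_field r z x \<bullet> \<xi> = (LINT y|lborel. (z y \<bullet> \<xi>) * moll r (x - y))"
proof -
  obtain c where c: "\<And>x::'a. norm (moll r x) \<le> c" using moll_bounded[OF r] by blast
  have i: "integrable lborel (\<lambda>y. (z y \<bullet> b) *\<^sub>R moll r (x - y))" for b
    by (rule integrable_scaleR_bounded[OF integrable_inner_compact_support _ c]) measurable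
  have "z y \<bullet> \<xi> = (\<Sum>b\<in>Basis. (z y \<bullet> b) * (\<xi> \<bullet> b))" for y
    by (rule euclidean_inner)
  then have "(LINT y|lborel. (z y \<bullet> \<xi>) * moll r (x - y)) =
      (LINT y|lborel. (\<Sum>b\<in>Basis. (\<xi> \<bullet> b) * ((z y \<bullet> b) *\<^sub>R moll r (x - y))))"
    by (simp only: sum_distrib_right) (simp add: mult_ac)
  also have "\<dots> = (\<Sum>b\<in>Basis. (\<xi> \<bullet> b) * (LINT y|lborel. (z y \<bullet> b) *\<^sub>R moll r (x - y)))"
    using i by (subst Bochner_Integration.integral_sum) auto
  also have "\<dots> = moll_field r z x \<bullet> \<xi>"
    by (simp add: moll_field_def conv_def inner_sum_left inner_commute[of \<xi>] mult.commute)
  finally show ?thesis by simp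
qed

lemma moll_field_eq_0:
  assumes "\<And>y. y \<in> K \<Longrightarrow> r \<le> dist x y"
  shows "moll_field r z x = 0"
proof -
  have "(z y \<bullet> \<xi>) * moll r (x - y) = 0" for y \<xi>
    using assms[of y] K(2)[of y] moll_eq_0[OF r, of "x - y"] by (cases "y \<in> K") (auto simp: dist_norm)
  then have "moll_field r z x \<bullet> \<xi> = 0" for \<xi>
    by (simp only: moll_field_inner) simp
  then show ?thesis using inner_eq_zero_iff by blast
qed

lemma
  shows C1_moll_field: "C1 (moll_field r z)"
    and divergence_moll_field: "divergence (moll_field r z) x =
      (\<Sum>b\<in>Basis. LINT y|lborel. (z y \<bullet> b) * frechet_derivative (moll r) (at (x - y)) b)"
proof -
  obtain c where c: "\<And>x::'a. norm (moll r x) \<le> c" using moll_bounded[OF r] by blast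
  obtain C where C: "\<And>(x::'a) h. norm (frechet_derivative (moll r) (at x) h) \<le> C * norm h"
    using moll'_bounded[OF r] by blast
  let ?c = "\<lambda>b. conv (\<lambda>y. z y \<bullet> b) (moll r)"
  have c1: "C1 (?c b)" for b
    by (rule C1_conv[OF integrable_inner_compact_support C1_moll[OF r] c C])
  have eq: "moll_field r z = (\<lambda>x. \<Sum>b\<in>Basis. ?c b x *\<^sub>R b)"
    by (auto simp: moll_field_def)
  have D: "(moll_field r z has_derivative (\<lambda>h. \<Sum>b\<in>Basis. frechet_derivative (?c b) (at x) h *\<^sub>R b)) (at x)" for x
    unfolding eq by (intro has_derivative_sum has_derivative_scaleR_left C1_has_derivative c1)
  show "C1 (moll_field r z)"
    by (rule C1_I[OF D]) (intro continuous_intros C1_continuous_derivative c1)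
  have "frechet_derivative (moll_field r z) (at x) = (\<lambda>h. \<Sum>b\<in>Basis. frechet_derivative (?c b) (at x) h *\<^sub>R b)"
    by (rule frechet_derivative_at[OF D, symmetric])
  then have "divergence (moll_field r z) x = (\<Sum>b\<in>Basis. frechet_derivative (?c b) (at x) b)"
    unfolding divergence_def
    by (intro sum.cong refl) (simp add: inner_sum_left inner_Basis if_distrib cong: if_cong)
  then show "divergence (moll_field r z) x =
      (\<Sum>b\<in>Basis. LINT y|lborel. (z y \<bullet> b) * frechet_derivative (moll r) (at (x - y)) b)"
    by (simp add: frechet_derivative_conv[OF integrable_inner_compact_support C1_moll[OF r] c C])
qed

text \<open>The mollifier is even, so its derivatives are odd and convolution with them is
  skew-adjoint, whence the sign. Testing \<open>u\<close> with the mollified field thus amounts to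
  testing the gradient of the mollified \<open>u\<close> with \<open>z\<close> itself.\<close>

lemma integral_divergence_moll_field:
  assumes u: "integrable lborel u"
  shows "(LINT x|lborel. u x * divergence (moll_field r z) x) =
    - (LINT y|lborel. frechet_derivative (conv u (moll r)) (at y) (z y))"
proof -
  obtain c where c: "\<And>x::'a. norm (moll r x) \<le> c" using moll_bounded[OF r] by blast
  obtain C where C: "\<And>(x::'a) h. norm (frechet_derivative (moll r) (at x) h) \<le> C * norm h"
    using moll'_bounded[OF r] by blast
  let ?D = "\<lambda>x::'a. frechet_derivative (moll r) (at x)"
  let ?F = "\<lambda>y. frechet_derivative (conv u (moll r)) (at y)"
  have Dm: "(\<lambda>x. ?D x b) \<in> borel_measurable borel" for b
    by (rule C1_derivative_measurable[OF C1_moll[OF r]])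
  have Db: "\<bar>?D x b\<bar> \<le> C * norm b" for x b using C[of x b] by simp
  note swap = integral_conv_swap[OF u integrable_inner_compact_support Dm Db]
  have F: "?F y b = - (LINT x|lborel. u x * ?D (x - y) b)" for y b
  proof -
    have "?F y b = (LINT x|lborel. u x * ?D (- (x - y)) b)"
      by (simp add: frechet_derivative_conv[OF u C1_moll[OF r] c C])
    then show ?thesis by (simp only: moll'_minus[OF r] mult_minus_right) simp
  qed
  have C1c: "C1 (conv u (moll r))" by (rule C1_conv[OF u C1_moll[OF r] c C])
  have iF: "integrable lborel (\<lambda>y. (z y \<bullet> b) * ?F y b)" for b
    using integral_conv_swap(2)[OF integrable_inner_compact_support u Dm Db]
    by (simp add: frechet_derivative_conv[OF u C1_moll[OF r] c C])
  have "(LINT x|lborel. u x * divergence (moll_field r z) x) =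
      (\<Sum>b\<in>Basis. LINT x|lborel. u x * (LINT y|lborel. (z y \<bullet> b) * ?D (x - y) b))"
    using swap(2) by (simp add: divergence_moll_field sum_distrib_left)
  also have "\<dots> = (\<Sum>b\<in>Basis. - (LINT y|lborel. (z y \<bullet> b) * ?F y b))"
    by (simp add: swap(1) F)
  also have "\<dots> = - (LINT y|lborel. (\<Sum>b\<in>Basis. (z y \<bullet> b) * ?F y b))"
    using iF by (simp add: sum_negf)
  also have "(\<lambda>y. \<Sum>b\<in>Basis. (z y \<bullet> b) * ?F y b) = (\<lambda>y. ?F y (z y))"
    by (rule ext) (rule linear_eq_sum_Basis[OF C1_linear_derivative[OF C1c], unfolded real_scaleR_def, symmetric])
  finally show ?thesis .
qed

end

text \<open>Since \<open>max 0 t\<close> is half of \<open>t + \<bar>t\<bar>\<close>, replacing the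
  absolute value of \<open>t = s - k\<close> by \<open>sqrt (t\<^sup>2 + \<delta>\<^sup>2)\<close>
  gives a smooth version of the positive part.\<close>

definition soft_pos :: "real \<Rightarrow> real \<Rightarrow> real \<Rightarrow> real" where
  "soft_pos \<delta> k s = (s - k + sqrt ((s - k)\<^sup>2 + \<delta>\<^sup>2)) / 2"

definition soft_pos' :: "real \<Rightarrow> real \<Rightarrow> real \<Rightarrow> real" where
  "soft_pos' \<delta> k s = (1 + (s - k) / sqrt ((s - k)\<^sup>2 + \<delta>\<^sup>2)) / 2"

text \<open>The derivative lies between 0 and 1, so it can be the weight in a convex combination of
  two fields. The last estimate has different arguments \<open>s\<close> and \<open>t\<close>
  because smoothing and mollification are undone together.\<close>

lemma
  assumes "0 < \<delta>"
  shows soft_pos_deriv: "(soft_pos \<delta> k has_real_derivative soft_pos' \<delta> k s) (at s)"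
    and continuous_soft_pos': "continuous_on UNIV (soft_pos' \<delta> k)"
    and soft_pos'_range: "0 \<le> soft_pos' \<delta> k s" "soft_pos' \<delta> k s \<le> 1"
    and soft_pos_approx: "\<bar>soft_pos \<delta> k s - max 0 (t - k)\<bar> \<le> \<bar>s - t\<bar> + \<delta>"
proof -
  have pos: "0 < (s - k)\<^sup>2 + \<delta>\<^sup>2" for s using assms by (simp add: sum_power2_gt_zero_iff)
  show "(soft_pos \<delta> k has_real_derivative soft_pos' \<delta> k s) (at s)"
    unfolding soft_pos_def[abs_def] soft_pos'_def
    using pos[of s] by (auto intro!: derivative_eq_intros simp: divide_simps)
  show "continuous_on UNIV (soft_pos' \<delta> k)"
    unfolding soft_pos'_def[abs_def]
    using assms by (intro continuous_intros) auto
  have le: "\<bar>s - k\<bar> \<le> sqrt ((s - k)\<^sup>2 + \<delta>\<^sup>2)"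
    by (rule real_le_rsqrt) simp
  have "\<bar>(s - k) / sqrt ((s - k)\<^sup>2 + \<delta>\<^sup>2)\<bar> \<le> 1"
    using le pos[of s] by (simp add: abs_divide)
  then have "- 1 \<le> (s - k) / sqrt ((s - k)\<^sup>2 + \<delta>\<^sup>2)" "(s - k) / sqrt ((s - k)\<^sup>2 + \<delta>\<^sup>2) \<le> 1"
    by linarith+
  then show "0 \<le> soft_pos' \<delta> k s" "soft_pos' \<delta> k s \<le> 1"
    unfolding soft_pos'_def by simp_all
  have "sqrt ((s - k)\<^sup>2 + \<delta>\<^sup>2) \<le> \<bar>s - k\<bar> + \<delta>"
    using sqrt_sum_squares_le_sum_abs[of "s - k" \<delta>] assms by simp
  then have "\<bar>soft_pos \<delta> k s - max 0 (s - k)\<bar> \<le> \<delta>"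
    using le assms by (cases "k \<le> s") (simp_all add: soft_pos_def abs_le_iff)
  moreover have "\<bar>max 0 (s - k) - max 0 (t - k)\<bar> \<le> \<bar>s - t\<bar>"
    by (auto simp: max_def)
  ultimately show "\<bar>soft_pos \<delta> k s - max 0 (t - k)\<bar> \<le> \<bar>s - t\<bar> + \<delta>"
    by linarith
qed


section \<open>Splitting an admissible field along a level set\<close>

lemma integral_bounded_mult_le:
  fixes f g :: "'a::euclidean_space \<Rightarrow> real"
  assumes "integrable lborel (\<lambda>x. f x * w x)" "integrable lborel (\<lambda>x. g x * w x)" "integrable lborel h"
    and "\<And>x. \<bar>f x * w x - g x * w x\<bar> \<le> C * h x"
  shows "(LINT x|lborel. f x * w x) \<le> (LINT x|lborel. g x * w x) + C * (LINT x|lborel. h x)"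
proof -
  have "(LINT x|lborel. f x * w x) \<le> (LINT x|lborel. g x * w x + C * h x)"
    using assms(1-3) by (intro integral_mono) (auto intro: order_trans[OF _ add_left_mono[OF assms(4)]])
  then show ?thesis using assms(1-3) by simp
qed

lemma test_field_C1: "test_field \<Omega> z \<Longrightarrow> C1 z"
  by (simp add: test_field_def)

text \<open>The divergence is bounded and vanishes off a compact set, so a constant may be added to
  the integrable majorant. This covers \<open>max 0 (u x - k)\<close> for negative \<open>k\<close>,
  which need not be integrable on the whole space.\<close>

lemma integrable_test_divergence:
  fixes f :: "'a::euclidean_space \<Rightarrow> real"
  assumes f: "f \<in> borel_measurable borel" "integrable lborel g" "\<And>x. \<bar>f x\<bar> \<le> \<bar>g x\<bar> + c"
    and z: "test_field \<Omega> z"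
  shows "integrable lborel (\<lambda>x. f x * divergence z x)"
proof -
  obtain K where K': "C1 z" "compact K" "\<And>x. x \<notin> K \<Longrightarrow> z x = 0"
    using z unfolding test_field_def by blast
  obtain C where K: "0 < C" "\<And>x. \<bar>divergence z x\<bar> \<le> C"
    using divergence_bounded[OF K'] by blast
  have iK: "integrable lborel (indicator K :: 'a \<Rightarrow> real)"
    using fmeasurable_compact[OF K'(2)] by (intro integrable_real_indicator) (auto simp: fmeasurable_def)
  show ?thesis
  proof (rule Bochner_Integration.integrable_bound)
    show "integrable lborel (\<lambda>x. (\<bar>g x\<bar> + c * indicator K x) * C)" using f(2) iK by simp
    show "(\<lambda>x. f x * divergence z x) \<in> borel_measurable lborel"
      using f(1) divergence_measurable[OF test_field_C1[OF z]] by measurable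
    show "AE x in lborel. norm (f x * divergence z x) \<le> norm ((\<bar>g x\<bar> + c * indicator K x) * C)"
    proof (rule AE_I2)
      fix x
      show "norm (f x * divergence z x) \<le> norm ((\<bar>g x\<bar> + c * indicator K x) * C)"
      proof (cases "x \<in> K")
        case True
        have "\<bar>f x\<bar> * \<bar>divergence z x\<bar> \<le> (\<bar>g x\<bar> + c) * C"
          by (rule mult_mono[OF f(3) K(2) order_trans[OF abs_ge_zero f(3)] abs_ge_zero])
        then have "\<bar>f x * divergence z x\<bar> \<le> (\<bar>g x\<bar> + c * indicator K x) * C"
          using True by (simp add: abs_mult)
        then show ?thesis unfolding real_norm_def by (rule order_trans[OF _ abs_ge_self])
      qed (simp add: divergence_eq_0[OF compact_imp_closed[OF K'(2)] K'(3)])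
    qed
  qed
qed

text \<open>For \<open>y\<close> within distance \<open>r\<close> of \<open>x\<close>, admissibility
  at \<open>y\<close> gives \<open>z y \<bullet> \<xi> \<le> (1 + e) * \<phi> x \<xi>\<close>, with
  a right-hand side free of \<open>y\<close>. Averaging keeps this inequality, division by
  \<open>1 + e\<close> restores admissibility, and the support grows only by
  \<open>r\<close>.\<close>

lemma admissible_moll_field:
  fixes \<Omega> :: "'a::euclidean_space set"
  assumes \<phi>: "\<And>x \<xi>. x \<in> \<Omega> \<Longrightarrow> 0 \<le> \<phi> x \<xi>"
    and d: "0 \<le> e" "\<And>x y \<xi>. x \<in> \<Omega> \<Longrightarrow> y \<in> \<Omega> \<Longrightarrow> dist x y \<le> r \<Longrightarrow> \<phi> y \<xi> \<le> (1 + e) * \<phi> x \<xi>"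
    and z: "continuous_on UNIV z" "compact K" "K \<subseteq> \<Omega>" "\<And>x. x \<notin> K \<Longrightarrow> z x = 0" "admissible \<phi> \<Omega> z"
    and r: "0 < r" "(\<Union>x\<in>K. cball x r) \<subseteq> \<Omega>"
  shows "test_field \<Omega> (\<lambda>x. (1 / (1 + e)) *\<^sub>R moll_field r z x)"
    and "admissible \<phi> \<Omega> (\<lambda>x. (1 / (1 + e)) *\<^sub>R moll_field r z x)"
proof -
  have "compact {x + y |x y. x \<in> K \<and> y \<in> cball 0 r}"
    by (intro compact_sums z) simp
  moreover have "{x + y |x y. x \<in> K \<and> y \<in> cball 0 r} = (\<Union>x\<in>K. cball x r)"
  proof (intro set_eqI iffI)
    fix p assume "p \<in> (\<Union>x\<in>K. cball x r)"
    then obtain x where "x \<in> K" "dist x p \<le> r" by auto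
    then show "p \<in> {x + y |x y. x \<in> K \<and> y \<in> cball 0 r}"
      by (intro CollectI exI[of _ x] exI[of _ "p - x"]) (auto simp: dist_norm norm_minus_commute)
  next
    fix p assume "p \<in> {x + y |x y. x \<in> K \<and> y \<in> cball 0 r}"
    then obtain x y where "x \<in> K" "norm y \<le> r" "p = x + y" by auto
    then show "p \<in> (\<Union>x\<in>K. cball x r)"
      by (intro UN_I[of x]) (auto simp: dist_norm)
  qed
  ultimately have cpt: "compact (\<Union>x\<in>K. cball x r)" by simp
  have zero: "moll_field r z x = 0" if "x \<notin> (\<Union>x\<in>K. cball x r)" for x
  proof (rule moll_field_eq_0[OF z(1,2,4) r(1)])
    show "r \<le> dist x y" if "y \<in> K" for y
      using that \<open>x \<notin> (\<Union>x\<in>K. cball x r)\<close> by (force simp: dist_commute)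
  qed
  show "test_field \<Omega> (\<lambda>x. (1 / (1 + e)) *\<^sub>R moll_field r z x)"
    unfolding test_field_def
    using cpt r zero by (intro conjI C1_scaleR C1_const C1_moll_field[OF z(1,2,4) r(1)] exI[of _ "\<Union>x\<in>K. cball x r"]) auto
  show "admissible \<phi> \<Omega> (\<lambda>x. (1 / (1 + e)) *\<^sub>R moll_field r z x)"
    unfolding admissible_def
  proof (intro ballI allI)
    fix x \<xi> assume x: "x \<in> \<Omega>"
    obtain c where c: "\<And>x::'a. norm (moll r x) \<le> c" using moll_bounded[OF r(1)] by blast
    have 1: "integrable lborel (\<lambda>y. (z y \<bullet> \<xi>) *\<^sub>R moll r (x - y))"
      by (rule integrable_scaleR_bounded[OF integrable_inner_compact_support[OF z(1,2,4) r(1)] _ c]) measurable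
    have 2: "integrable lborel (\<lambda>y. ((1 + e) * \<phi> x \<xi>) * moll r (x - y))"
      by (intro integrable_mult_right) (simp add: lborel_integrable_reflect integrable_moll[OF r(1)])
    have "moll_field r z x \<bullet> \<xi> = (LINT y|lborel. (z y \<bullet> \<xi>) * moll r (x - y))"
      by (rule moll_field_inner[OF z(1,2,4) r(1)])
    also have "\<dots> \<le> (LINT y|lborel. ((1 + e) * \<phi> x \<xi>) * moll r (x - y))"
    proof (rule integral_mono)
      show "(z y \<bullet> \<xi>) * moll r (x - y) \<le> ((1 + e) * \<phi> x \<xi>) * moll r (x - y)" for y
      proof (cases "y \<in> K \<and> dist x y \<le> r")
        case True
        then have "z y \<bullet> \<xi> \<le> \<phi> y \<xi>" using z(3,5) by (auto simp: admissible_def)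
        also have "\<dots> \<le> (1 + e) * \<phi> x \<xi>" using True z(3) x by (intro d) auto
        finally show ?thesis by (intro mult_right_mono moll_nonneg r)
      next
        case False
        then have "(z y \<bullet> \<xi>) * moll r (x - y) = 0"
          using z(4)[of y] moll_eq_0[OF r(1), of "x - y"] by (auto simp: dist_norm)
        moreover have "0 \<le> ((1 + e) * \<phi> x \<xi>) * moll r (x - y)"
          using d(1) by (intro mult_nonneg_nonneg moll_nonneg \<phi> x r) auto
        ultimately show ?thesis by (simp only:)
      qed
    qed (use 1 2 in simp_all)
    also have "\<dots> = (1 + e) * \<phi> x \<xi>"
      using lborel_integral_reflect[OF moll_measurable, of r x] by (simp add: integral_moll[OF r(1)])
    finally show "((1 / (1 + e)) *\<^sub>R moll_field r z x) \<bullet> \<xi> \<le> \<phi> x \<xi>"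
      using d(1) by (simp add: pos_divide_le_eq mult.commute)
  qed
qed

text \<open>
  With \<open>v\<close> the mollification of \<open>u\<close>, the field equal to \<open>a\<close> where \<open>v < k\<close> and to \<open>b\<close> where
  \<open>v > k\<close> is admissible and detects both truncations of \<open>v\<close>. Only its mollification has to be
  differentiable, and transferring the mollifier from \<open>u\<close> to the field costs a factor close to
  \<open>1\<close> because \<open>\<phi>\<close> is uniformly continuous.
\<close>

lemma truncation_inequality:
  fixes \<Omega> :: "'a::euclidean_space set"
  assumes \<Omega>: "open \<Omega>" "bounded \<Omega>" and \<phi>: "metric_integrand \<Omega> \<phi>"
    and u: "integrable lborel u" "tv_le \<phi> \<Omega> u T"
    and a: "test_field \<Omega> a" "admissible \<phi> \<Omega> a"
    and b: "test_field \<Omega> b" "admissible \<phi> \<Omega> b"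
  shows "(LINT x|lborel. u x * divergence a x)
    + (LINT x|lborel. max 0 (u x - k) * (divergence b x - divergence a x)) \<le> T"
proof -
  have um: "u \<in> borel_measurable borel" using u(1) by (auto dest: borel_measurable_integrable)
  have \<phi>0: "0 \<le> \<phi> x \<xi>" if "x \<in> \<Omega>" for x \<xi>
    using \<phi> that closure_subset unfolding metric_integrand_def by blast
  define c where "c x = b x + (- 1) *\<^sub>R a x" for x
  have a1: "C1 a" and b1: "C1 b" using a b by (auto simp: test_field_def)
  have c1: "C1 c" unfolding c_def by (intro C1_add C1_scaleR C1_const a1 b1)
  have divc: "divergence c x = divergence b x - divergence a x" for x
    unfolding c_def
    using divergence_add[OF b1 C1_scaleR[OF C1_const[of "-1"] a1]] divergence_cmult[OF a1, of "-1" x] by simp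
  obtain Ka where Ka: "compact Ka" "Ka \<subseteq> \<Omega>" "\<And>x. x \<notin> Ka \<Longrightarrow> a x = 0"
    using a unfolding test_field_def by blast
  obtain Kb where Kb: "compact Kb" "Kb \<subseteq> \<Omega>" "\<And>x. x \<notin> Kb \<Longrightarrow> b x = 0"
    using b unfolding test_field_def by blast
  define K where "K = Ka \<union> Kb"
  have K: "compact K" "K \<subseteq> \<Omega>" and aK: "\<And>x. x \<notin> K \<Longrightarrow> a x = 0" and cK: "\<And>x. x \<notin> K \<Longrightarrow> c x = 0"
    using Ka Kb by (auto simp: K_def c_def)
  have ct: "test_field \<Omega> c" unfolding test_field_def using c1 K cK by blast
  obtain A where A: "0 < A" "\<And>x. \<bar>divergence a x\<bar> \<le> A"
    using divergence_bounded[OF a1 K(1) aK] by blast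
  obtain C where C: "0 < C" "\<And>x. \<bar>divergence c x\<bar> \<le> C"
    using divergence_bounded[OF c1 K(1) cK] by blast
  have c0: "divergence c x = 0" if "x \<notin> K" for x
    by (rule divergence_eq_0[OF compact_imp_closed[OF K(1)] cK that])
  have iK: "integrable lborel (indicator K :: 'a \<Rightarrow> real)"
    using fmeasurable_compact[OF K(1)] by (intro integrable_real_indicator) (auto simp: fmeasurable_def)
  \<comment> \<open>The zero field shows that \<open>T\<close> is nonnegative, which makes the
    choice of \<open>e1\<close> below legitimate.\<close>
  have T0: "0 \<le> T"
  proof -
    have "test_field \<Omega> (\<lambda>x. 0 :: 'a)" "admissible \<phi> \<Omega> (\<lambda>x. 0)"
      using \<phi>0 by (auto simp: test_field_def admissible_def C1_const intro!: exI[of _ "{}"])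
    moreover have "divergence (\<lambda>x. 0 :: 'a) x = 0" for x :: 'a
      by (rule divergence_eq_0[of "{}"]) auto
    ultimately show ?thesis using u(2) unfolding tv_le_def by force
  qed
  let ?L = "(LINT x|lborel. u x * divergence a x)
    + (LINT x|lborel. max 0 (u x - k) * divergence c x)"
  have "?L \<le> T + e" if "0 < e" for e
  proof -
    \<comment> \<open>The relative error \<open>e1\<close> costs at most \<open>e / 2\<close>; the
      summand 1 keeps the denominator positive when \<open>T\<close> is 0.\<close>
    define e1 where "e1 = e / (2 * (T + 1))"
    have e1: "0 < e1" "e1 * T \<le> e / 2" using \<open>0 < e\<close> T0 by (auto simp: e1_def field_simps)
    define M where "M = measure lborel K"
    have M0: "0 \<le> M" by (simp add: M_def)
    have Q: "0 < A + C * (1 + M)" using A(1) C(1) M0 by (intro add_pos_nonneg mult_nonneg_nonneg) auto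
    \<comment> \<open>One parameter bounds both the L1 error of the mollification and the smoothing
      of the positive part. Its value solves for a total error of \<open>e / 2\<close>, where
      \<open>A\<close> and \<open>C\<close> bound the divergences of \<open>a\<close> and
      \<open>c\<close>.\<close>
    define \<delta> where "\<delta> = e / (2 * (A + C * (1 + M)))"
    have \<delta>: "0 < \<delta>" "A * \<delta> + C * (\<delta> + \<delta> * M) = e / 2"
    proof -
      show "0 < \<delta>" unfolding \<delta>_def using \<open>0 < e\<close> Q by simp
      have "A * \<delta> + C * (\<delta> + \<delta> * M) = (A + C * (1 + M)) * \<delta>" by (simp add: algebra_simps)
      moreover have "q * (e / (2 * q)) = e / 2" if "0 < q" for q using that by simp
      from this[OF Q] have "(A + C * (1 + M)) * \<delta> = e / 2" unfolding \<delta>_def .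
      ultimately show "A * \<delta> + C * (\<delta> + \<delta> * M) = e / 2" by simp
    qed
    obtain d1 where d1: "0 < d1"
      "\<And>x y \<xi>. x \<in> \<Omega> \<Longrightarrow> y \<in> \<Omega> \<Longrightarrow> dist x y \<le> d1 \<Longrightarrow> \<phi> y \<xi> \<le> (1 + e1) * \<phi> x \<xi>"
      using metric_integrand_uniform[OF \<phi> \<Omega>(2) e1(1)] by metis
    obtain d2 where d2: "0 < d2" "\<And>r. 0 < r \<Longrightarrow> r \<le> d2 \<Longrightarrow> integrable lborel (conv u (moll r)) \<and>
        (LINT x|lborel. \<bar>conv u (moll r) x - u x\<bar>) \<le> \<delta>"
      using L1_conv_moll[OF u(1) \<delta>(1)] by blast
    obtain d3 where d3: "0 < d3" "(\<Union>x\<in>K. cball x d3) \<subseteq> \<Omega>"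
      using compact_subset_open_imp_cball_epsilon_subset[OF K(1) \<Omega>(1) K(2)] by blast
    \<comment> \<open>The three radii control the oscillation of \<phi>, the L1 error for
      \<open>u\<close>, and the growth of the support inside \<Omega>.\<close>
    define r where "r = min d1 (min d2 d3)"
    have r: "0 < r" "r \<le> d1" "r \<le> d2" "r \<le> d3" using d1(1) d2(1) d3(1) by (auto simp: r_def)
    have rK: "(\<Union>x\<in>K. cball x r) \<subseteq> \<Omega>" using d3(2) r(4) by fastforce
    define v where "v = conv u (moll r)"
    have v: "integrable lborel v" "(LINT x|lborel. \<bar>v x - u x\<bar>) \<le> \<delta>" using d2(2)[OF r(1,3)] by (auto simp: v_def)
    have vm: "v \<in> borel_measurable borel" using v(1) by (auto dest: borel_measurable_integrable)
    obtain B where B: "\<And>x::'a. norm (moll r x) \<le> B" using moll_bounded[OF r(1)] by blast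
    obtain B' where B': "\<And>(x::'a) h. norm (frechet_derivative (moll r) (at x) h) \<le> B' * norm h"
      using moll'_bounded[OF r(1)] by blast
    have v1: "C1 v" unfolding v_def by (rule C1_conv[OF u(1) C1_moll[OF r(1)] B B'])
    define S where "S x = soft_pos \<delta> k (v x)" for x
    define S' where "S' x = soft_pos' \<delta> k (v x)" for x
    note sp = C1_compose_real[OF v1 soft_pos_deriv[OF \<delta>(1)] continuous_soft_pos'[OF \<delta>(1)], of k]
    have S1: "C1 S" unfolding S_def by (rule sp)
    have DS: "frechet_derivative S (at x) = (\<lambda>h. S' x * frechet_derivative v (at x) h)" for x
      unfolding S_def S'_def by (rule sp)
    have S'c: "continuous_on UNIV S'"
      unfolding S'_def using continuous_on_compose2[OF continuous_soft_pos'[OF \<delta>(1)] C1_continuous[OF v1]] by simp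
    have S'r: "0 \<le> S' x" "S' x \<le> 1" for x
      unfolding S'_def by (rule soft_pos'_range[OF \<delta>(1)])+
    \<comment> \<open>This is the convex combination of \<open>a\<close> and \<open>b\<close> with
      weights \<open>1 - S' x\<close> and \<open>S' x\<close>: a continuous transition from
      \<open>a\<close> to \<open>b\<close> across the level \<open>k\<close> of
      \<open>v\<close>.\<close>
    define z where "z x = a x + S' x *\<^sub>R c x" for x
    have zc: "continuous_on UNIV z"
      unfolding z_def by (intro continuous_intros S'c C1_continuous a1 c1)
    have zK: "z x = 0" if "x \<notin> K" for x using that by (simp add: z_def aK cK)
    have za: "admissible \<phi> \<Omega> z"
      unfolding admissible_def
    proof (intro ballI allI)
      fix x \<xi> assume x: "x \<in> \<Omega>"
      have "z x \<bullet> \<xi> = (1 - S' x) * (a x \<bullet> \<xi>) + S' x * (b x \<bullet> \<xi>)"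
        by (simp add: z_def c_def inner_add_left inner_diff_left algebra_simps)
      also have "\<dots> \<le> (1 - S' x) * \<phi> x \<xi> + S' x * \<phi> x \<xi>"
        using a(2) b(2) x S'r[of x] unfolding admissible_def by (intro add_mono mult_left_mono) auto
      finally show "z x \<bullet> \<xi> \<le> \<phi> x \<xi>" by (simp add: algebra_simps)
    qed
    have \<phi>r: "\<phi> y \<xi> \<le> (1 + e1) * \<phi> x \<xi>" if "x \<in> \<Omega>" "y \<in> \<Omega>" "dist x y \<le> r" for x y \<xi>
      using d1(2)[OF that(1,2)] that(3) r(2) by simp
    note w = admissible_moll_field[OF \<phi>0 less_imp_le[OF e1(1)] \<phi>r zc K(1,2) zK za r(1) rK]
    have w1: "C1 (moll_field r z)" by (rule C1_moll_field[OF zc K(1) zK r(1)])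
    have "(LINT x|lborel. u x * divergence (\<lambda>x. (1 / (1 + e1)) *\<^sub>R moll_field r z x) x) \<le> T"
      using u(2) w unfolding tv_le_def by blast
    then have "(LINT x|lborel. (1 / (1 + e1)) * (u x * divergence (moll_field r z) x)) \<le> T"
      by (simp only: divergence_cmult[OF w1]) (simp add: mult.left_commute)
    then have "(1 / (1 + e1)) * (LINT x|lborel. u x * divergence (moll_field r z) x) \<le> T"
      by (simp only: integral_mult_right_zero)
    then have le: "(LINT x|lborel. u x * divergence (moll_field r z) x) \<le> (1 + e1) * T"
      using e1(1) by (simp add: pos_divide_le_eq mult.commute)
    have iba: "(LINT x|lborel. v x * divergence a x) = - (LINT x|lborel. frechet_derivative v (at x) (a x))"
      and ia: "integrable lborel (\<lambda>x. frechet_derivative v (at x) (a x))"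
      using integral_by_parts[OF v1 a1 K(1) aK] by auto
    have ibc: "(LINT x|lborel. S x * divergence c x) = - (LINT x|lborel. S' x * frechet_derivative v (at x) (c x))"
      and ic: "integrable lborel (\<lambda>x. S' x * frechet_derivative v (at x) (c x))"
      using integral_by_parts[OF S1 c1 K(1) cK] unfolding DS by auto
    have Dz: "frechet_derivative v (at x) (z x) = frechet_derivative v (at x) (a x) + S' x * frechet_derivative v (at x) (c x)" for x
      using linear_add[OF C1_linear_derivative[OF v1]] linear_cmul[OF C1_linear_derivative[OF v1]] by (simp add: z_def)
    \<comment> \<open>The mollifier passes to \<open>u\<close>. Since \<open>S' x\<close> times the
      derivative of \<open>v\<close> is the derivative of \<open>S\<close>, integration by parts in
      the two pieces yields the pairings of \<open>v\<close> with \<open>a\<close> and of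
      \<open>S\<close> with \<open>c\<close>.\<close>
    have "(LINT x|lborel. u x * divergence (moll_field r z) x)
        = - (LINT x|lborel. frechet_derivative v (at x) (z x))"
      unfolding v_def by (rule integral_divergence_moll_field[OF zc K(1) zK r(1) u(1)])
    also have "\<dots> = - ((LINT x|lborel. frechet_derivative v (at x) (a x)) + (LINT x|lborel. S' x * frechet_derivative v (at x) (c x)))"
      using ia ic by (simp add: Dz)
    also have "\<dots> = (LINT x|lborel. v x * divergence a x) + (LINT x|lborel. S x * divergence c x)"
      by (simp add: iba ibc)
    finally have main: "(LINT x|lborel. v x * divergence a x) + (LINT x|lborel. S x * divergence c x) \<le> (1 + e1) * T"
      using le by simp
    have uv: "integrable lborel (\<lambda>x. \<bar>v x - u x\<bar>)" using u(1) v(1) by simp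
    have "(LINT x|lborel. u x * divergence a x) \<le> (LINT x|lborel. v x * divergence a x) + A * (LINT x|lborel. \<bar>v x - u x\<bar>)"
    proof (rule integral_bounded_mult_le[OF _ _ uv])
      show "integrable lborel (\<lambda>x. u x * divergence a x)"
        by (rule integrable_test_divergence[OF um u(1) _ a(1), of 0]) simp
      show "integrable lborel (\<lambda>x. v x * divergence a x)"
        by (rule integrable_test_divergence[OF vm v(1) _ a(1), of 0]) simp
      show "\<bar>u x * divergence a x - v x * divergence a x\<bar> \<le> A * \<bar>v x - u x\<bar>" for x
        using mult_right_mono[OF A(2)[of x] abs_ge_zero[of "v x - u x"]]
        by (simp add: left_diff_distrib[symmetric] abs_mult abs_minus_commute mult.commute)
    qed
    also have "\<dots> \<le> (LINT x|lborel. v x * divergence a x) + A * \<delta>"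
      using v(2) A(1) by simp
    finally have e_a: "(LINT x|lborel. u x * divergence a x) \<le> (LINT x|lborel. v x * divergence a x) + A * \<delta>" .
    have uvK: "integrable lborel (\<lambda>x. \<bar>v x - u x\<bar> + \<delta> * indicator K x)" using uv iK by simp
    have "(LINT x|lborel. max 0 (u x - k) * divergence c x) \<le> (LINT x|lborel. S x * divergence c x)
        + C * (LINT x|lborel. \<bar>v x - u x\<bar> + \<delta> * indicator K x)"
    proof (rule integral_bounded_mult_le[OF _ _ uvK])
      show "integrable lborel (\<lambda>x. max 0 (u x - k) * divergence c x)"
        by (rule integrable_test_divergence[OF _ u(1) _ ct, of _ "\<bar>k\<bar>"]) (use um in auto)
      show "integrable lborel (\<lambda>x. S x * divergence c x)"
        by (rule integral_by_parts[OF S1 c1 K(1) cK])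
      show "\<bar>max 0 (u x - k) * divergence c x - S x * divergence c x\<bar> \<le> C * (\<bar>v x - u x\<bar> + \<delta> * indicator K x)" for x
      proof (cases "x \<in> K")
        case True
        have "\<bar>max 0 (u x - k) - S x\<bar> * \<bar>divergence c x\<bar> \<le> (\<bar>v x - u x\<bar> + \<delta>) * C"
          using soft_pos_approx[OF \<delta>(1), of k "v x" "u x"] \<delta>(1)
          by (intro mult_mono C) (auto simp: S_def abs_minus_commute)
        then show ?thesis using True
          by (simp only: left_diff_distrib[symmetric] abs_mult) (simp add: mult.commute)
      next
        case False
        then show ?thesis using C(1) by (simp add: c0)
      qed
    qed
    also have "(LINT x|lborel. \<bar>v x - u x\<bar> + \<delta> * indicator K x) = (LINT x|lborel. \<bar>v x - u x\<bar>) + \<delta> * M"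
      using uv iK by (simp add: M_def)
    also have "(LINT x|lborel. S x * divergence c x) + C * ((LINT x|lborel. \<bar>v x - u x\<bar>) + \<delta> * M)
        \<le> (LINT x|lborel. S x * divergence c x) + C * (\<delta> + \<delta> * M)"
      using v(2) C(1) by simp
    finally have e_c: "(LINT x|lborel. max 0 (u x - k) * divergence c x) \<le> (LINT x|lborel. S x * divergence c x) + C * (\<delta> + \<delta> * M)"
      .
    show ?thesis
      using main e_a e_c \<delta>(2) e1(2) by (simp add: algebra_simps)
  qed
  then have "?L \<le> T" by (rule field_le_epsilon)
  then show ?thesis by (simp add: divc)
qed

subsection \<open>A Caccioppoli inequality\<close>

lemma frechet_derivative_apply_bounded:
  fixes \<eta> :: "'a::euclidean_space \<Rightarrow> real"
  assumes \<eta>: "C1 \<eta>" "closed K" "\<And>x. x \<notin> K \<Longrightarrow> \<eta> x = 0"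
    and L: "0 \<le> L" "\<And>x h. \<bar>frechet_derivative \<eta> (at x) h\<bar> \<le> L * norm h"
    and z: "\<And>x. x \<in> K \<Longrightarrow> norm (z x) \<le> M"
  shows "\<bar>frechet_derivative \<eta> (at x) (z x)\<bar> \<le> L * M * indicator K x"
proof (cases "x \<in> K")
  case True
  have "\<bar>frechet_derivative \<eta> (at x) (z x)\<bar> \<le> L * norm (z x)" by (rule L)
  also have "\<dots> \<le> L * M" by (intro mult_left_mono z True L)
  finally show ?thesis using True by simp
qed (simp add: frechet_derivative_eq_0[OF \<eta>(2,3)])

text \<open>Homogeneity with \<open>t = -1\<close> makes \<phi> even, so the negative of an
  admissible field is admissible.\<close>

lemma tv_le_uminus:
  assumes \<phi>: "metric_integrand \<Omega> \<phi>" and f: "tv_le \<phi> \<Omega> f T"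
  shows "tv_le \<phi> \<Omega> (\<lambda>x. - f x) T"
  unfolding tv_le_def
proof (intro allI impI)
  fix z assume z: "test_field \<Omega> z \<and> admissible \<phi> \<Omega> z"
  define z' where "z' x = (-1) *\<^sub>R z x" for x
  have z1: "C1 z" using z by (simp add: test_field_def)
  have "test_field \<Omega> z'"
    using z C1_scaleR[OF C1_const[of "-1"] z1] unfolding test_field_def z'_def by auto
  moreover have "admissible \<phi> \<Omega> z'"
    unfolding admissible_def
  proof (intro ballI allI)
    fix x \<xi> assume x: "x \<in> \<Omega>"
    have "z x \<bullet> (- \<xi>) \<le> \<phi> x (- \<xi>)" using z x unfolding admissible_def by blast
    also have "\<dots> = \<phi> x ((-1) *\<^sub>R \<xi>)" by simp
    also have "\<dots> = \<bar>-1\<bar> * \<phi> x \<xi>" using \<phi> x closure_subset[of \<Omega>] unfolding metric_integrand_def by blast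
    finally show "z' x \<bullet> \<xi> \<le> \<phi> x \<xi>" by (simp add: z'_def)
  qed
  ultimately have "(LINT x|lborel. f x * divergence z' x) \<le> T"
    using f unfolding tv_le_def by blast
  moreover have "divergence z' x = - divergence z x" for x
    unfolding z'_def using divergence_cmult[OF z1, of "-1" x] by simp
  ultimately show "(LINT x|lborel. - f x * divergence z x) \<le> T" by simp
qed

text \<open>For an admissible \<open>z\<close>, the truncation inequality is applied to
  \<open>z\<close> and to the interpolation of \<open>z\<close> and \<open>y\<close> with weights
  \<open>1 - \<eta>\<close> and \<eta>. The part with \<open>\<eta> * divergence z\<close> joins
  \<open>u\<close> to form the competitor, the part with \<open>\<eta> * divergence y\<close> is the
  quantity to be bounded, and the derivatives of \<eta> leave an error of order
  \<open>(M + m) * L\<close>. The cutoff also means that \<open>y\<close> may have unbounded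
  support.\<close>

lemma caccioppoli:
  fixes \<Omega> :: "'a::euclidean_space set"
  assumes \<Omega>: "open \<Omega>" "bounded \<Omega>" and \<phi>: "metric_integrand \<Omega> \<phi>"
    and m: "0 < m" "\<And>x \<xi>. x \<in> \<Omega> \<Longrightarrow> m * norm \<xi> \<le> \<phi> x \<xi>"
    and M: "0 < M" "\<And>x \<xi>. x \<in> \<Omega> \<Longrightarrow> \<phi> x \<xi> \<le> M * norm \<xi>"
    and u: "integrable lborel u" "tv_le \<phi> \<Omega> u T"
    and K: "compact K" "K \<subseteq> \<Omega>"
    and minimal: "\<And>v S T'. integrable lborel v \<Longrightarrow> (\<And>x. x \<notin> K \<Longrightarrow> v x = 0) \<Longrightarrow>
      tv_le \<phi> \<Omega> v S \<Longrightarrow> tv_le \<phi> \<Omega> (\<lambda>x. u x + v x) T' \<Longrightarrow> T \<le> T'"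
    and \<eta>: "C1 \<eta>" "\<And>x. x \<notin> K \<Longrightarrow> \<eta> x = 0" "\<And>x. 0 \<le> \<eta> x" "\<And>x. \<eta> x \<le> 1"
    and L: "0 \<le> L" "\<And>x h. \<bar>frechet_derivative \<eta> (at x) h\<bar> \<le> L * norm h"
    and y: "C1 y" "\<And>x. norm (y x) \<le> m"
    and k: "0 \<le> k"
  shows "(LINT x|lborel. (\<eta> x * max 0 (u x - k)) * divergence y x)
    \<le> (M + m) * L * (LINT x|lborel. indicator K x * max 0 (u x - k))"
proof -
  have um[measurable]: "u \<in> borel_measurable borel" using u(1) by (auto dest: borel_measurable_integrable)
  have [measurable]: "\<eta> \<in> borel_measurable borel" by (rule C1_measurable[OF \<eta>(1)])
  have [measurable]: "K \<in> sets borel" by (rule borel_closed[OF compact_imp_closed[OF K(1)]])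
  define p where "p x = max 0 (u x - k)" for x
  have pm[measurable]: "p \<in> borel_measurable borel" unfolding p_def by measurable
  \<comment> \<open>Nonnegative levels are what makes the truncation integrable on the whole
    space.\<close>
  have pu: "\<bar>p x\<bar> \<le> \<bar>u x\<bar> + 0" for x using k by (auto simp: p_def)
  have p0: "0 \<le> p x" for x by (simp add: p_def)
  have pi: "integrable lborel p"
    by (rule Bochner_Integration.integrable_bound[OF u(1)]) (use pu in auto)
  have \<eta>b: "\<bar>\<eta> x\<bar> \<le> 1" for x using \<eta>(3,4)[of x] by simp
  have \<eta>p: "\<bar>\<eta> x * p x\<bar> \<le> \<bar>u x\<bar> + 0" for x
    using mult_mono[OF \<eta>b pu, of x x] by (simp add: abs_mult)
  have \<eta>pi: "integrable lborel (\<lambda>x. \<eta> x * p x)"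
    by (rule Bochner_Integration.integrable_bound[OF u(1)]) (use \<eta>p in auto)
  have clK: "closed K" by (rule compact_imp_closed[OF K(1)])
  have iKp: "integrable lborel (\<lambda>x. indicator K x * p x)"
    by (rule Bochner_Integration.integrable_bound[OF pi]) (auto simp: indicator_def)
  have idy: "integrable lborel (\<lambda>x. p x * (\<eta> x * divergence y x))"
  proof -
    have "bounded ((\<lambda>x. \<eta> x * divergence y x) ` K)"
      by (intro compact_imp_bounded compact_continuous_image K continuous_intros
          C1_continuous[OF \<eta>(1)] continuous_on_subset[OF continuous_on_divergence[OF y(1)]]) simp
    then obtain c where c: "\<And>x. x \<in> K \<Longrightarrow> \<bar>\<eta> x * divergence y x\<bar> \<le> c" by (auto simp: bounded_iff)
    have "norm (\<eta> x * divergence y x) \<le> \<bar>c\<bar>" for x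
      using c[of x] \<eta>(2)[of x] by (cases "x \<in> K") (auto intro: order_trans[OF _ abs_ge_self])
    from integrable_scaleR_bounded[OF pi _ this] divergence_measurable[OF y(1)]
    show ?thesis by simp
  qed
  have iD: "integrable lborel (\<lambda>x. p x * frechet_derivative \<eta> (at x) (z x))"
    if "C1 z" "\<And>x. x \<in> K \<Longrightarrow> norm (z x) \<le> B" "0 \<le> B" for z B
  proof -
    have "norm (frechet_derivative \<eta> (at x) (z x)) \<le> L * B" for x
    proof -
      have "\<bar>frechet_derivative \<eta> (at x) (z x)\<bar> \<le> L * B * indicator K x"
        by (rule frechet_derivative_apply_bounded[OF \<eta>(1) clK \<eta>(2) L that(2)])
      also have "\<dots> \<le> L * B" using that(3) L(1) by (simp add: indicator_def)
      finally show ?thesis by simp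
    qed
    from integrable_scaleR_bounded[OF pi _ this]
      borel_measurable_continuous_onI[OF continuous_on_C1_derivative_apply[OF \<eta>(1) C1_continuous[OF that(1)]]]
    show ?thesis by simp
  qed
  define I where "I = (LINT x|lborel. indicator K x * p x)"
  \<comment> \<open>\<open>X\<close> is the gain of the competitor: its variation will be at most
    \<open>T - X\<close>, and minimality then forces \<open>X \<le> 0\<close>.\<close>
  define X where "X = (LINT x|lborel. p x * (\<eta> x * divergence y x)) - (M + m) * L * I"
  have w: "(LINT x|lborel. (u x - \<eta> x * p x) * divergence z x) \<le> T - X"
    if z: "test_field \<Omega> z" "admissible \<phi> \<Omega> z" for z
  proof -
    obtain Kz where Kz: "C1 z" "compact Kz" "Kz \<subseteq> \<Omega>" "\<And>x. x \<notin> Kz \<Longrightarrow> z x = 0"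
      using z(1) unfolding test_field_def by blast
    define \<zeta> where "\<zeta> x = 1 + (-1) *\<^sub>R \<eta> x" for x
    have \<zeta>1: "C1 \<zeta>" unfolding \<zeta>_def by (intro C1_add C1_scaleR C1_const \<eta>)
    have "(\<zeta> has_derivative (\<lambda>h. - frechet_derivative \<eta> (at x) h)) (at x)" for x
    proof -
      have "((\<lambda>x. 1 + (-1) *\<^sub>R \<eta> x) has_derivative (\<lambda>h. 0 + (-1) *\<^sub>R frechet_derivative \<eta> (at x) h)) (at x)"
        by (intro has_derivative_add has_derivative_const has_derivative_scaleR_right C1_has_derivative \<eta>)
      then show ?thesis by (simp add: \<zeta>_def[abs_def])
    qed
    then have D\<zeta>: "frechet_derivative \<zeta> (at x) = (\<lambda>h. - frechet_derivative \<eta> (at x) h)" for x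
      by (rule frechet_derivative_at[symmetric])
    define b where "b x = \<zeta> x *\<^sub>R z x + \<eta> x *\<^sub>R y x" for x
    have b1: "C1 b" unfolding b_def by (intro C1_add C1_scaleR \<zeta>1 \<eta> Kz y)
    have bt: "test_field \<Omega> b"
      unfolding test_field_def
      using b1 K Kz by (intro conjI exI[of _ "K \<union> Kz"]) (auto simp: b_def \<eta>(2))
    have ba: "admissible \<phi> \<Omega> b"
      unfolding admissible_def
    proof (intro ballI allI)
      fix x \<xi> assume x: "x \<in> \<Omega>"
      have "y x \<bullet> \<xi> \<le> norm (y x) * norm \<xi>" by (rule norm_cauchy_schwarz)
      also have "\<dots> \<le> m * norm \<xi>" by (intro mult_right_mono y) simp
      also have "\<dots> \<le> \<phi> x \<xi>" by (rule m(2)[OF x])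
      finally have yx: "y x \<bullet> \<xi> \<le> \<phi> x \<xi>" .
      have "b x \<bullet> \<xi> = (1 - \<eta> x) * (z x \<bullet> \<xi>) + \<eta> x * (y x \<bullet> \<xi>)"
        by (simp add: b_def \<zeta>_def inner_add_left inner_diff_left algebra_simps)
      also have "\<dots> \<le> (1 - \<eta> x) * \<phi> x \<xi> + \<eta> x * \<phi> x \<xi>"
        using yx z(2) x \<eta>(3,4)[of x] unfolding admissible_def by (intro add_mono mult_left_mono) auto
      finally show "b x \<bullet> \<xi> \<le> \<phi> x \<xi>" by (simp add: algebra_simps)
    qed
    \<comment> \<open>Testing admissibility with \<xi> equal to \<open>z x\<close> itself bounds its
      length by the upper growth constant.\<close>
    have zM: "norm (z x) \<le> M" if "x \<in> K" for x
    proof -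
      have "x \<in> \<Omega>" using that K by blast
      then have "z x \<bullet> z x \<le> M * norm (z x)"
        using z(2) M(2)[of x "z x"] unfolding admissible_def by (meson order_trans)
      then have "norm (z x) * norm (z x) \<le> M * norm (z x)" by (simp add: power2_norm_eq_inner[symmetric] power2_eq_square)
      then show ?thesis using M(1) by (cases "norm (z x) = 0") auto
    qed
    have divb: "divergence b x - divergence z x =
        \<eta> x * divergence y x + frechet_derivative \<eta> (at x) (y x) - frechet_derivative \<eta> (at x) (z x) - \<eta> x * divergence z x" for x
      unfolding b_def
      by (simp add: divergence_add divergence_scaleR C1_scaleR \<zeta>1 Kz(1) \<eta>(1) y(1) D\<zeta>)
         (simp add: \<zeta>_def algebra_simps)
    have i1: "integrable lborel (\<lambda>x. u x * divergence z x)"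
      by (rule integrable_test_divergence[OF um u(1) _ z(1), of 0]) simp
    have i2: "integrable lborel (\<lambda>x. (\<eta> x * p x) * divergence z x)"
      by (rule integrable_test_divergence[OF _ u(1) \<eta>p z(1)]) measurable
    note i3 = iD[OF y(1,2) less_imp_le[OF m(1)]] iD[OF Kz(1) zM less_imp_le[OF M(1)]]
    have "(LINT x|lborel. p x * (\<eta> x * divergence y x)) - (LINT x|lborel. (M + m) * L * (indicator K x * p x))
        = (LINT x|lborel. p x * (\<eta> x * divergence y x) - (M + m) * L * (indicator K x * p x))"
      using idy iKp by simp
    also have "\<dots> \<le> (LINT x|lborel. p x * (\<eta> x * divergence y x) + p x * frechet_derivative \<eta> (at x) (y x)
        - p x * frechet_derivative \<eta> (at x) (z x))"
    proof (rule integral_mono)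
      fix x
      have "\<bar>frechet_derivative \<eta> (at x) (y x)\<bar> \<le> L * m * indicator K x"
        by (rule frechet_derivative_apply_bounded[OF \<eta>(1) clK \<eta>(2) L]) (use y(2) in auto)
      moreover have "\<bar>frechet_derivative \<eta> (at x) (z x)\<bar> \<le> L * M * indicator K x"
        by (rule frechet_derivative_apply_bounded[OF \<eta>(1) clK \<eta>(2) L zM])
      ultimately have "- ((M + m) * L * indicator K x)
          \<le> frechet_derivative \<eta> (at x) (y x) - frechet_derivative \<eta> (at x) (z x)"
        by (simp add: algebra_simps)
      from mult_left_mono[OF this p0[of x]]
      show "p x * (\<eta> x * divergence y x) - (M + m) * L * (indicator K x * p x)
        \<le> p x * (\<eta> x * divergence y x) + p x * frechet_derivative \<eta> (at x) (y x)
          - p x * frechet_derivative \<eta> (at x) (z x)"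
        by (simp add: algebra_simps)
    qed (use idy iKp i3 in auto)
    finally have 1: "X \<le> (LINT x|lborel. p x * (\<eta> x * divergence y x) + p x * frechet_derivative \<eta> (at x) (y x)
        - p x * frechet_derivative \<eta> (at x) (z x))"
      by (simp add: X_def I_def)
    have "(LINT x|lborel. u x * divergence z x) + (LINT x|lborel. p x * (divergence b x - divergence z x)) \<le> T"
      unfolding p_def by (rule truncation_inequality[OF \<Omega> \<phi> u z bt ba])
    also have "(LINT x|lborel. p x * (divergence b x - divergence z x)) =
        (LINT x|lborel. (p x * (\<eta> x * divergence y x) + p x * frechet_derivative \<eta> (at x) (y x)
        - p x * frechet_derivative \<eta> (at x) (z x)) - (\<eta> x * p x) * divergence z x)"
      unfolding divb by (simp add: algebra_simps)
    also have "\<dots> = (LINT x|lborel. p x * (\<eta> x * divergence y x) + p x * frechet_derivative \<eta> (at x) (y x)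
        - p x * frechet_derivative \<eta> (at x) (z x)) - (LINT x|lborel. (\<eta> x * p x) * divergence z x)"
      using idy i2 i3 by (intro Bochner_Integration.integral_diff) auto
    finally show ?thesis
      using 1 i1 i2 by (simp add: left_diff_distrib)
  qed
  have tw: "tv_le \<phi> \<Omega> (\<lambda>x. u x + - (\<eta> x * p x)) (T - X)"
    using w unfolding tv_le_def by simp
  \<comment> \<open>Minimality concerns only perturbations of finite variation. Finiteness follows
    by writing the perturbation as the competitor minus \<open>u\<close>, whose bounds add.\<close>
  have tv: "tv_le \<phi> \<Omega> (\<lambda>x. - (\<eta> x * p x)) (T - X + T)"
    unfolding tv_le_def
  proof (intro allI impI)
    fix z assume z: "test_field \<Omega> z \<and> admissible \<phi> \<Omega> z"
    have "(LINT x|lborel. - u x * divergence z x) \<le> T"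
      using tv_le_uminus[OF \<phi> u(2)] z unfolding tv_le_def by blast
    then have "- (LINT x|lborel. u x * divergence z x) \<le> T" by simp
    moreover have "(LINT x|lborel. (u x - \<eta> x * p x) * divergence z x) \<le> T - X" using w z by blast
    moreover have i1: "integrable lborel (\<lambda>x. u x * divergence z x)"
      by (rule integrable_test_divergence[OF um u(1) _ conjunct1[OF z], of 0]) simp
    moreover have i2: "integrable lborel (\<lambda>x. (\<eta> x * p x) * divergence z x)"
      by (rule integrable_test_divergence[OF _ u(1) \<eta>p conjunct1[OF z]]) measurable
    ultimately show "(LINT x|lborel. - (\<eta> x * p x) * divergence z x) \<le> T - X + T"
      by (simp add: left_diff_distrib)
  qed
  have "T \<le> T - X"
    by (rule minimal[OF _ _ tv tw]) (use \<eta>pi \<eta>(2) in auto)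
  then have "(LINT x|lborel. p x * (\<eta> x * divergence y x)) \<le> (M + m) * L * I" by (simp add: X_def)
  then show ?thesis by (simp add: p_def I_def mult_ac)
qed

subsection \<open>Integrals are controlled by the variation and the measure of the support\<close>

text \<open>A regularisation of \<open>1 / norm x\<close> that majorises the length of
  \<open>newton \<delta> x\<close> and whose integral against a bump is bounded independently of
  \<delta>.\<close>

definition inv_norm :: "real \<Rightarrow> 'a::euclidean_space \<Rightarrow> real" where
  "inv_norm \<delta> x = inverse (sqrt (\<delta>\<^sup>2 + x \<bullet> x))"

text \<open>
  In the plane, \<open>x /\<^sub>R (\<delta>\<^sup>2 + \<bar>x\<bar>\<^sup>2)\<close> regularises \<open>2 \<pi>\<close> times the gradient of the Newton potential:
  its divergence is an approximate identity.
\<close>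

definition newton :: "real \<Rightarrow> 'a::euclidean_space \<Rightarrow> 'a" where
  "newton \<delta> x = inverse (\<delta>\<^sup>2 + x \<bullet> x) *\<^sub>R x"

definition newton' :: "real \<Rightarrow> 'a::euclidean_space \<Rightarrow> 'a \<Rightarrow> 'a" where
  "newton' \<delta> x h = inverse (\<delta>\<^sup>2 + x \<bullet> x) *\<^sub>R h - (2 * (x \<bullet> h) * (inverse (\<delta>\<^sup>2 + x \<bullet> x))\<^sup>2) *\<^sub>R x"

lemma C1_ident: "C1 (\<lambda>x. x)"
  by (rule C1_I[OF has_derivative_ident]) (rule continuous_on_const)

lemma divergence_ident: "divergence (\<lambda>x. x) (x::'a::euclidean_space) = DIM('a)"
  by (simp add: divergence_def)

context
  fixes \<delta> :: real
  assumes \<delta>: "0 < \<delta>"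
begin

lemma pos_add_inner: "0 < \<delta>\<^sup>2 + x \<bullet> x"
  using \<delta> by (intro add_pos_nonneg) auto

lemma inv_norm_deriv:
  "(inv_norm \<delta> has_derivative (\<lambda>h. - (x \<bullet> h) * (inv_norm \<delta> x)^3)) (at x)"
proof -
  let ?q = "\<delta>\<^sup>2 + x \<bullet> x"
  have "((\<lambda>x::'a. \<delta>\<^sup>2 + x \<bullet> x) has_derivative (\<lambda>h. 2 * (x \<bullet> h))) (at x)"
    by (auto intro!: derivative_eq_intros simp: inner_commute)
  moreover have "((\<lambda>t. inverse (sqrt t)) has_real_derivative (- ((inverse (sqrt ?q))^3 / 2))) (at ?q)"
    using pos_add_inner[of x]
    by (auto intro!: derivative_eq_intros simp: divide_simps power3_eq_cube)
  ultimately have "((\<lambda>x::'a. inverse (sqrt (\<delta>\<^sup>2 + x \<bullet> x))) has_derivative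
      (\<lambda>h. (- ((inverse (sqrt ?q))^3 / 2)) * (2 * (x \<bullet> h)))) (at x)"
    unfolding has_field_derivative_def by (rule has_derivative_compose)
  then show ?thesis
    by (simp add: inv_norm_def[abs_def] mult_ac)
qed

lemma continuous_on_inv_norm: "continuous_on UNIV (inv_norm \<delta> :: 'a::euclidean_space \<Rightarrow> real)"
  by (intro continuous_at_imp_continuous_on ballI has_derivative_continuous[OF inv_norm_deriv])

lemma C1_inv_norm: "C1 (inv_norm \<delta> :: 'a::euclidean_space \<Rightarrow> real)"
  by (rule C1_I[OF inv_norm_deriv]) (intro continuous_intros continuous_on_inv_norm)

lemma inv_norm_pos: "0 < inv_norm \<delta> x"
  using pos_add_inner[of x] by (simp add: inv_norm_def)

lemma norm_inv_norm_le: "norm x * inv_norm \<delta> x \<le> 1"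
proof -
  have "norm x \<le> sqrt (\<delta>\<^sup>2 + x \<bullet> x)"
    by (rule real_le_rsqrt) (simp add: power2_norm_eq_inner)
  then show ?thesis
    using pos_add_inner[of x] by (simp add: inv_norm_def divide_inverse[symmetric])
qed

lemma norm_newton: "norm (newton \<delta> x) = norm x * (inv_norm \<delta> x)\<^sup>2"
  using pos_add_inner[of x] by (simp add: newton_def inv_norm_def power_inverse mult.commute)

lemma norm_newton_le_inv_norm: "norm (newton \<delta> x) \<le> inv_norm \<delta> x"
  using mult_right_mono[OF norm_inv_norm_le less_imp_le[OF inv_norm_pos], of x x]
  by (simp add: norm_newton power2_eq_square mult.assoc)

lemma norm_newton_le: "norm x * norm (newton \<delta> x) \<le> 1"
proof -
  have "(norm x * inv_norm \<delta> x)\<^sup>2 \<le> 1"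
    using norm_inv_norm_le[of x] inv_norm_pos[of x] by (intro power_le_one) auto
  then show ?thesis by (simp add: norm_newton power2_eq_square mult_ac)
qed

lemma newton_deriv: "(newton \<delta> has_derivative newton' \<delta> x) (at x)"
proof -
  let ?q = "\<lambda>x::'a. \<delta>\<^sup>2 + x \<bullet> x"
  have "((\<lambda>x::'a. ?q x) has_derivative (\<lambda>h. 2 * (x \<bullet> h))) (at x)"
    by (auto intro!: derivative_eq_intros simp: inner_commute)
  moreover have "((\<lambda>t. inverse t) has_real_derivative (- ((inverse (?q x))\<^sup>2))) (at (?q x))"
    using pos_add_inner[of x] by (auto intro!: derivative_eq_intros simp: power2_eq_square)
  ultimately have "((\<lambda>x. inverse (?q x)) has_derivative (\<lambda>h. - ((inverse (?q x))\<^sup>2) * (2 * (x \<bullet> h)))) (at x)"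
    unfolding has_field_derivative_def by (rule has_derivative_compose)
  from has_derivative_scaleR[OF this has_derivative_ident]
  show ?thesis by (simp add: newton_def[abs_def] newton'_def[abs_def] mult_ac)
qed

lemma continuous_on_newton': "continuous_on UNIV (\<lambda>x. newton' \<delta> x h)"
proof -
  have "\<delta>\<^sup>2 + x \<bullet> x \<noteq> 0" for x :: 'a using pos_add_inner[of x] by simp
  then show ?thesis
    unfolding newton'_def by (intro continuous_intros) auto
qed

lemma C1_newton: "C1 (newton \<delta> :: 'a::euclidean_space \<Rightarrow> 'a)"
  by (rule C1_I[OF newton_deriv continuous_on_newton'])

lemma frechet_derivative_newton: "frechet_derivative (newton \<delta>) (at x) = newton' \<delta> x"
  by (rule frechet_derivative_at[OF newton_deriv, symmetric])

lemma norm_newton'_le: "norm (newton' \<delta> x h) \<le> 3 / \<delta>\<^sup>2 * norm h"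
proof -
  define q where "q = inverse (\<delta>\<^sup>2 + x \<bullet> x)"
  have q: "0 < q" "q \<le> 1 / \<delta>\<^sup>2" "(norm x)\<^sup>2 * q \<le> 1"
    using pos_add_inner[of x] \<delta> by (auto simp: q_def power2_norm_eq_inner divide_simps)
  have "norm (newton' \<delta> x h) \<le> norm (q *\<^sub>R h) + norm ((2 * (x \<bullet> h) * q\<^sup>2) *\<^sub>R x)"
    unfolding newton'_def q_def[symmetric] by (rule norm_triangle_ineq4)
  also have "\<dots> = q * norm h + 2 * \<bar>x \<bullet> h\<bar> * q\<^sup>2 * norm x"
    using q(1) by (simp add: abs_mult)
  also have "\<dots> \<le> q * norm h + 2 * (norm x * norm h) * q\<^sup>2 * norm x"
    by (intro add_left_mono mult_right_mono mult_left_mono Cauchy_Schwarz_ineq2) auto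
  also have "\<dots> = q * norm h + 2 * ((norm x)\<^sup>2 * q) * (q * norm h)"
    by (simp add: power2_eq_square mult_ac)
  also have "\<dots> \<le> q * norm h + 2 * 1 * (q * norm h)"
    using q by (intro add_left_mono mult_right_mono mult_left_mono) auto
  also have "\<dots> = 3 * (q * norm h)" by simp
  also have "\<dots> \<le> 3 * (1 / \<delta>\<^sup>2 * norm h)"
    by (intro mult_left_mono mult_right_mono q) auto
  finally show ?thesis by simp
qed

lemma norm_newton_bounded: "norm (newton \<delta> x) \<le> 1 / \<delta>"
proof -
  have "\<delta> \<le> sqrt (\<delta>\<^sup>2 + x \<bullet> x)" using \<delta> by (intro real_le_rsqrt) auto
  then have "inv_norm \<delta> x \<le> inverse \<delta>" unfolding inv_norm_def using \<delta> by (intro le_imp_inverse_le) auto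
  then show ?thesis using norm_newton_le_inv_norm[of x] by (simp add: inverse_eq_divide)
qed

text \<open>Test the divergence theorem with \<open>bump r x / \<surd>(\<delta>\<^sup>2 + \<bar>x\<bar>\<^sup>2)\<close> times the identity.\<close>

lemma integral_bump_inv_norm:
  assumes dim: "DIM('a::euclidean_space) = 2" and r: "0 < r"
  shows "integrable lborel (\<lambda>x::'a. bump r x * inv_norm \<delta> x)"
    and "(LINT x|lborel. bump r (x::'a) * inv_norm \<delta> x) \<le> 16 * r"
proof -
  let ?z = "\<lambda>x::'a. bump r x *\<^sub>R x"
  have z: "C1 ?z" by (rule C1_scaleR[OF C1_bump C1_ident])
  have zK: "?z x = 0" if "x \<notin> cball 0 r" for x using that bump_eq_0[OF r, of x] by simp
  have div: "divergence ?z x = 2 * bump r x + bump' r x x" for x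
    using divergence_scaleR[OF C1_bump C1_ident, of r x]
    by (simp add: divergence_ident dim frechet_derivative_bump)
  have D: "frechet_derivative (inv_norm \<delta>) (at x) (?z x) = - (bump r x * (x \<bullet> x) * (inv_norm \<delta> x)^3)" for x :: 'a
    unfolding frechet_derivative_at[OF inv_norm_deriv, symmetric] by simp
  note ibp = integral_by_parts[OF C1_inv_norm z compact_cball[of 0 r] zK]
  have meas: "(\<lambda>x::'a. bump r x * inv_norm \<delta> x) \<in> borel_measurable borel"
    using C1_measurable[OF C1_inv_norm] by measurable
  have inv_le: "inv_norm \<delta> x \<le> 1 / \<delta>" for x :: 'a
  proof -
    have "\<delta> \<le> sqrt (\<delta>\<^sup>2 + x \<bullet> x)" using \<delta> by (intro real_le_rsqrt) auto
    then show ?thesis unfolding inv_norm_def inverse_eq_divide[symmetric] using \<delta> by (intro le_imp_inverse_le) auto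
  qed
  show int: "integrable lborel (\<lambda>x::'a. bump r x * inv_norm \<delta> x)"
  proof (rule integrable_lborel_compact_support[OF meas compact_cball[of 0 r]])
    show "bump r x * inv_norm \<delta> x = 0" if "x \<notin> cball 0 r" for x :: 'a
      using that bump_eq_0[OF r, of x] by simp
    show "\<bar>bump r x * inv_norm \<delta> x\<bar> \<le> 1 * (1 / \<delta>)" for x :: 'a
      unfolding abs_mult using inv_le[of x] inv_norm_pos[of x] bump_le_1[of r x] bump_nonneg[of r x]
      by (intro mult_mono) auto
  qed
  have icb: "integrable lborel (\<lambda>x. 4 / r * indicator (cball (0::'a) r) x)"
    by (intro integrable_mult_right integrable_real_indicator)
        (simp_all add: emeasure_lborel_cball_finite[unfolded infinity_ennreal_def])
  \<comment> \<open>In the plane the identity has divergence 2. Differentiating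
    \<open>inv_norm \<delta>\<close> along the field removes at most one copy of the integrand, so
    at least one copy remains; the derivative of the bump costs at most \<open>4 / r\<close> on the
    ball.\<close>
  have "(LINT x|lborel. bump r (x::'a) * inv_norm \<delta> x)
      \<le> (LINT x|lborel. inv_norm \<delta> x * divergence ?z x + frechet_derivative (inv_norm \<delta>) (at x) (?z x)
        + 4 / r * indicator (cball (0::'a) r) x)"
  proof (rule integral_mono[OF int])
    fix x :: 'a
    have s: "(x \<bullet> x) * (inv_norm \<delta> x)\<^sup>2 \<le> 1"
    proof -
      have "(norm x * inv_norm \<delta> x)\<^sup>2 \<le> 1"
        using norm_inv_norm_le[of x] inv_norm_pos[of x] by (intro power_le_one) auto
      then show ?thesis by (simp add: power_mult_distrib power2_norm_eq_inner)
    qed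
    have "(bump r x * inv_norm \<delta> x) * ((x \<bullet> x) * (inv_norm \<delta> x)\<^sup>2) \<le> (bump r x * inv_norm \<delta> x) * 1"
      using inv_norm_pos[of x] bump_nonneg[of r x] by (intro mult_left_mono s) auto
    then have 1: "bump r x * (x \<bullet> x) * (inv_norm \<delta> x)^3 \<le> bump r x * inv_norm \<delta> x"
      by (simp add: power3_eq_cube power2_eq_square mult_ac)
    have 2: "- (inv_norm \<delta> x * bump' r x x) \<le> 4 / r * indicator (cball (0::'a) r) x"
    proof (cases "x \<in> cball 0 r")
      case True
      have "- (inv_norm \<delta> x * bump' r x x) = inv_norm \<delta> x * (- bump' r x x)" by simp
      also have "\<dots> \<le> inv_norm \<delta> x * \<bar>bump' r x x\<bar>"
        by (rule mult_left_mono[OF abs_ge_minus_self less_imp_le[OF inv_norm_pos]])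
      also have "\<dots> \<le> inv_norm \<delta> x * (4 / r * norm x)"
        using inv_norm_pos[of x] by (intro mult_left_mono bump'_bound r) auto
      also have "\<dots> = 4 / r * (norm x * inv_norm \<delta> x)" by simp
      also have "\<dots> \<le> 4 / r * 1" using r by (intro mult_left_mono norm_inv_norm_le) auto
      finally show ?thesis using True by simp
    next
      case False
      have "bump' r x = (\<lambda>h. 0)"
        unfolding frechet_derivative_bump[symmetric]
        by (rule frechet_derivative_eq_0[OF closed_cball _ False]) (simp add: bump_eq_0[OF r])
      then show ?thesis using False by simp
    qed
    show "bump r x * inv_norm \<delta> x \<le> inv_norm \<delta> x * divergence ?z x
        + frechet_derivative (inv_norm \<delta>) (at x) (?z x) + 4 / r * indicator (cball (0::'a) r) x"
      using 1 2 unfolding div D by (simp add: algebra_simps)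
  qed (use ibp(2,3) icb in auto)
  also have "\<dots> = 4 / r * measure lborel (cball (0::'a) r)"
    using ibp icb by simp
  also have "measure lborel (cball (0::'a) r) = pi * r\<^sup>2"
    using content_cball[of r "0::'a"] r by (simp add: dim unit_ball_vol_2)
  also have "4 / r * (pi * r\<^sup>2) = 4 * pi * r" using r by (simp add: power2_eq_square)
  also have "\<dots> \<le> 16 * r" using pi_less_4 r by simp
  finally show "(LINT x|lborel. bump r (x::'a) * inv_norm \<delta> x) \<le> 16 * r" .
qed

text \<open>A soft splitting of the kernel at radius \<open>r\<close> into an integrable near part
  and a bounded far part. Inside the ball \<open>1 - bump r x\<close> is at most
  \<open>2 * norm x / r\<close>, and \<open>norm x\<close> times the length of the kernel is at most
  1.\<close>

lemma norm_newton_le_bump: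
  assumes r: "0 < r"
  shows "norm (newton \<delta> x) \<le> bump r x * inv_norm \<delta> x + 2 / r"
proof (cases "r \<le> norm x")
  case True
  have "r * norm (newton \<delta> x) \<le> norm x * norm (newton \<delta> x)"
    using True by (intro mult_right_mono) auto
  also have "\<dots> \<le> 1" by (rule norm_newton_le)
  finally have "norm (newton \<delta> x) \<le> 1 / r" using r by (simp add: pos_le_divide_eq mult.commute)
  also have "\<dots> \<le> 2 / r" using r by (intro divide_right_mono) auto
  finally have "norm (newton \<delta> x) \<le> 2 / r" .
  moreover have "0 \<le> bump r x * inv_norm \<delta> x"
    by (intro mult_nonneg_nonneg bump_nonneg less_imp_le[OF inv_norm_pos])
  ultimately show ?thesis by linarith
next
  case False
  define t where "t = norm x / r"
  have t: "0 \<le> t" "t \<le> 1" using False r by (auto simp: t_def)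
  have b: "bump r x = (1 - t\<^sup>2)\<^sup>2"
  proof -
    have "(norm x)\<^sup>2 / r\<^sup>2 = t\<^sup>2" by (simp add: t_def power_divide)
    then show ?thesis using power_le_one[OF t, of 2] by (simp add: bump_def)
  qed
  have "1 - bump r x \<le> 2 * t\<^sup>2"
    unfolding b by (simp add: power2_diff)
  also have "\<dots> \<le> 2 * t" using t mult_left_le[of t t] by (simp add: power2_eq_square)
  finally have "(1 - bump r x) * norm (newton \<delta> x) \<le> 2 * t * norm (newton \<delta> x)"
    by (intro mult_right_mono) auto
  also have "\<dots> = 2 / r * (norm x * norm (newton \<delta> x))" by (simp add: t_def)
  also have "\<dots> \<le> 2 / r * 1" using r by (intro mult_left_mono norm_newton_le) auto
  finally have "norm (newton \<delta> x) \<le> bump r x * norm (newton \<delta> x) + 2 / r" by (simp add: algebra_simps)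
  also have "\<dots> \<le> bump r x * inv_norm \<delta> x + 2 / r"
    by (intro add_right_mono mult_left_mono norm_newton_le_inv_norm bump_nonneg)
  finally show ?thesis .
qed

text \<open>With \<open>q\<close> the inverse of \<open>\<delta>\<^sup>2 + x \<bullet> x\<close>,
  the divergence is \<open>DIM('a) * q - 2 * q\<^sup>2 * (x \<bullet> x)\<close>. In dimension two
  the leading terms cancel away from the origin, and a positive kernel remains.\<close>

lemma divergence_newton:
  assumes dim: "DIM('a::euclidean_space) = 2"
  shows "divergence (newton \<delta>) (x::'a) = 2 * \<delta>\<^sup>2 * (inverse (\<delta>\<^sup>2 + x \<bullet> x))\<^sup>2"
proof -
  define q where "q = inverse (\<delta>\<^sup>2 + x \<bullet> x)"
  have *: "newton' \<delta> x b \<bullet> b = q - 2 * q\<^sup>2 * ((x \<bullet> b) * (x \<bullet> b))" if "b \<in> Basis" for b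
    using that by (simp add: newton'_def q_def[symmetric] inner_diff_left)
  have "divergence (newton \<delta>) x = (\<Sum>b\<in>Basis. q - 2 * q\<^sup>2 * ((x \<bullet> b) * (x \<bullet> b)))"
    unfolding divergence_def frechet_derivative_newton by (intro sum.cong refl *)
  also have "\<dots> = 2 * q - 2 * q\<^sup>2 * (\<Sum>b\<in>Basis. (x \<bullet> b) * (x \<bullet> b))"
    by (simp only: sum_subtractf sum_distrib_left[symmetric] sum_constant dim of_nat_numeral)
  also have "(\<Sum>b\<in>Basis. (x \<bullet> b) * (x \<bullet> b)) = x \<bullet> x"
    by (rule euclidean_inner[symmetric])
  also have "2 * q - 2 * q\<^sup>2 * (x \<bullet> x) = 2 * q\<^sup>2 * ((\<delta>\<^sup>2 + x \<bullet> x) - x \<bullet> x)"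
  proof -
    have "q\<^sup>2 * (\<delta>\<^sup>2 + x \<bullet> x) = q" using pos_add_inner[of x] by (simp add: q_def power2_eq_square)
    then show ?thesis by (simp only: right_diff_distrib mult.assoc)
  qed
  finally show ?thesis by (simp add: q_def)
qed

text \<open>On the ball of radius \<delta> the divergence is at least
  \<open>1 / (2 * \<delta>\<^sup>2)\<close>, while planar scaling bounds
  \<open>moll \<delta>\<close> by a constant over \<open>\<delta>\<^sup>2\<close>. Outside this ball
  the mollifier vanishes and the divergence is nonnegative.\<close>

lemma divergence_newton_ge:
  assumes dim: "DIM('a::euclidean_space) = 2"
  shows "(LINT x|lborel. bump 1 (x::'a)) / 2 * moll \<delta> x \<le> divergence (newton \<delta>) (x::'a)"
proof -
  have "(LINT x|lborel. bump 1 (x::'a)) / 2 * moll \<delta> x = bump \<delta> x / (2 * \<delta>\<^sup>2)"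
    using integral_bump_scale[OF \<delta>, where 'a='a] integral_bump_pos[of 1, where 'a='a]
    by (simp add: moll_def dim divide_simps)
  also have "\<dots> \<le> 2 * \<delta>\<^sup>2 * (inverse (\<delta>\<^sup>2 + x \<bullet> x))\<^sup>2"
  proof (cases "norm x < \<delta>")
    case True
    then have "x \<bullet> x \<le> \<delta>\<^sup>2" using power_mono[of "norm x" \<delta> 2] by (simp add: power2_norm_eq_inner)
    then have "inverse (2 * \<delta>\<^sup>2) \<le> inverse (\<delta>\<^sup>2 + x \<bullet> x)"
      using pos_add_inner[of x] by (intro le_imp_inverse_le) auto
    then have "2 * \<delta>\<^sup>2 * (inverse (2 * \<delta>\<^sup>2))\<^sup>2 \<le> 2 * \<delta>\<^sup>2 * (inverse (\<delta>\<^sup>2 + x \<bullet> x))\<^sup>2"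
      using \<delta> by (intro mult_left_mono power_mono) auto
    moreover have "2 * \<delta>\<^sup>2 * (inverse (2 * \<delta>\<^sup>2))\<^sup>2 = 1 / (2 * \<delta>\<^sup>2)"
      using \<delta> by (simp add: power2_eq_square field_simps)
    moreover have "bump \<delta> x / (2 * \<delta>\<^sup>2) \<le> 1 / (2 * \<delta>\<^sup>2)"
      by (intro divide_right_mono bump_le_1) simp
    ultimately show ?thesis by linarith
  next
    case False
    then show ?thesis using bump_eq_0[OF \<delta>, of x] by simp
  qed
  also have "\<dots> = divergence (newton \<delta>) x" by (rule divergence_newton[OF dim, symmetric])
  finally show ?thesis .
qed

end


text \<open>The kernel is split at the radius \<open>r\<close> whose square is the measure of
  \<open>A\<close>. The near part contributes at most \<open>16 * r\<close> wherever
  \<open>A\<close> lies, and the far part at most \<open>2 / r\<close> times the measure, which is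
  \<open>2 * r\<close>.\<close>

lemma norm_conv_newton_le:
  fixes A :: "'a::euclidean_space set"
  assumes dim: "DIM('a) = 2" and \<delta>: "0 < \<delta>"
    and A: "A \<in> sets borel" "emeasure lborel A < \<infinity>" "0 < measure lborel A"
  shows "norm (conv (indicator A) (newton \<delta>) x) \<le> 18 * sqrt (measure lborel A)"
proof -
  define r where "r = sqrt (measure lborel A)"
  have r: "0 < r" "r * r = measure lborel A" using A(3) by (auto simp: r_def)
  have iA: "integrable lborel (indicator A :: 'a \<Rightarrow> real)"
    using A by (intro integrable_real_indicator) auto
  note bi = integral_bump_inv_norm[OF \<delta> dim r(1)]
  let ?b = "\<lambda>y. bump r (x - y) * inv_norm \<delta> (x - y)"
  have bm: "(\<lambda>x::'a. bump r x * inv_norm \<delta> x) \<in> borel_measurable borel"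
    using C1_measurable[OF C1_inv_norm[OF \<delta>]] by measurable
  have ib: "integrable lborel ?b"
    using lborel_integrable_reflect[OF bm, of x] bi(1) by simp
  have "norm (conv (indicator A) (newton \<delta>) x)
      \<le> (LINT y|lborel. norm (indicator A y *\<^sub>R newton \<delta> (x - y)))"
    unfolding conv_def by (rule integral_norm_bound)
  also have "\<dots> \<le> (LINT y|lborel. ?b y + 2 / r * indicator A y)"
  proof (rule integral_mono)
    show "integrable lborel (\<lambda>y. norm (indicator A y *\<^sub>R newton \<delta> (x - y)))"
      by (intro Bochner_Integration.integrable_norm integrable_scaleR_bounded[OF iA _ norm_newton_bounded[OF \<delta>]]
          measurable_compose[OF _ C1_measurable[OF C1_newton[OF \<delta>]]]) measurable
    show "integrable lborel (\<lambda>y. ?b y + 2 / r * indicator A y)" using ib iA by simp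
    show "norm (indicator A y *\<^sub>R newton \<delta> (x - y)) \<le> ?b y + 2 / r * indicator A y" for y
      using norm_newton_le_bump[OF \<delta> r(1), of "x - y"] bump_nonneg[of r "x - y"] inv_norm_pos[OF \<delta>, of "x - y"]
      by (cases "y \<in> A") auto
  qed
  also have "\<dots> = (LINT y|lborel. ?b y) + 2 / r * measure lborel A" using ib iA by simp
  also have "(LINT y|lborel. ?b y) = (LINT y|lborel. bump r (y::'a) * inv_norm \<delta> y)"
    by (rule lborel_integral_reflect[OF bm])
  also have "\<dots> \<le> 16 * r" by (rule bi)
  also have "2 / r * measure lborel A = 2 * r" using r by (simp flip: r(2))
  finally show ?thesis by (simp add: r_def)
qed

text \<open>
  Convolving \<open>newton \<delta>\<close> with the indicator of the support gives a test field whose divergence is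
  bounded below by a mollified indicator and whose norm is of the order of the square root of the
  measure.
\<close>

lemma integral_le_sqrt_measure_mult_variation:
  assumes dim: "DIM('a::euclidean_space) = 2"
  shows "\<exists>C>0. \<forall>(g :: 'a \<Rightarrow> real) T. integrable lborel g \<longrightarrow> (\<forall>x. 0 \<le> g x) \<longrightarrow>
    emeasure lborel {x. 0 < g x} < \<infinity> \<longrightarrow>
    (\<forall>y. C1 y \<and> (\<forall>x. norm (y x) \<le> 1) \<longrightarrow> (LINT x|lborel. g x * divergence y x) \<le> T) \<longrightarrow>
    (LINT x|lborel. g x) \<le> C * sqrt (measure lborel {x. 0 < g x}) * T"
proof -
  define I where "I = (LINT x|lborel. bump 1 (x::'a))"
  have I: "0 < I" unfolding I_def by (rule integral_bump_pos) simp
  show ?thesis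
  \<comment> \<open>The constant is \<open>2 / I\<close> times 18: the 18 normalises the test field,
    and \<open>2 / I\<close> inverts the lower bound for its divergence.\<close>
  proof (intro exI[of _ "36 / I"] conjI allI impI)
    show "0 < 36 / I" using I by simp
    fix g :: "'a \<Rightarrow> real" and T
    assume g: "integrable lborel g" and g_nonneg: "\<forall>x. 0 \<le> g x" and fin: "emeasure lborel {x. 0 < g x} < \<infinity>"
      and T: "\<forall>y. C1 y \<and> (\<forall>x. norm (y x) \<le> 1) \<longrightarrow> (LINT x|lborel. g x * divergence y x) \<le> T"
    note g = g g_nonneg[rule_format]
    note T = T[rule_format, OF conjI, OF _ allI]
    have gm[measurable]: "g \<in> borel_measurable borel" using g by (auto dest: borel_measurable_integrable)
    define A where "A = {x. 0 < g x}"
    have A[measurable]: "A \<in> sets borel" unfolding A_def by measurable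
    have finA: "emeasure lborel A < \<infinity>" using fin by (simp add: A_def)
    have iA: "integrable lborel (indicator A :: 'a \<Rightarrow> real)"
      using finA by (intro integrable_real_indicator) auto
    have gA: "indicator A x * g x = g x" for x
      using g(2)[of x] by (auto simp: A_def indicator_def)
    have g0: "g x = 0" if "x \<notin> A" for x
      using g(2)[of x] that by (simp add: A_def)
    define a where "a = measure lborel A"
    show "(LINT x|lborel. g x) \<le> 36 / I * sqrt (measure lborel {x. 0 < g x}) * T"
    proof (cases "a = 0")
      \<comment> \<open>A null support is treated apart, since the splitting radius of the kernel
        must be positive.\<close>
      case True
      then have "emeasure lborel A = 0" using finA by (auto simp: a_def measure_def enn2real_eq_0_iff)
      then have "AE x in lborel. x \<notin> A" by (intro AE_not_in null_setsI) auto
      then have "AE x in lborel. g x = 0" by eventually_elim (rule g0)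
      then have "(LINT x|lborel. g x) = (LINT x|(lborel :: 'a measure). 0)"
        by (intro integral_cong_AE) auto
      then show ?thesis using True by (simp add: a_def A_def)
    next
      case False
      then have a: "0 < a" by (simp add: a_def zero_less_measure_iff measure_nonneg less_le)
      define N where "N = 18 * sqrt a"
      have N: "0 < N" using a by (simp add: N_def)
      have "(LINT x|lborel. g x) \<le> 36 / I * sqrt a * T + e" if e: "0 < e" for e
      proof -
        obtain \<delta> where \<delta>: "0 < \<delta>" "integrable lborel (conv g (moll \<delta>))"
          "(LINT x|lborel. \<bar>conv g (moll \<delta>) x - g x\<bar>) \<le> e"
          using L1_conv_moll[OF g(1) e] by blast
        define y where "y = conv (indicator A :: 'a \<Rightarrow> real) (newton \<delta>)"
        have nb: "norm (frechet_derivative (newton \<delta>) (at x) h) \<le> 3 / \<delta>\<^sup>2 * norm h" for x h :: 'a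
          unfolding frechet_derivative_newton[OF \<delta>(1)] by (rule norm_newton'_le[OF \<delta>(1)])
        have y1: "C1 y"
          unfolding y_def by (rule C1_conv[OF iA C1_newton[OF \<delta>(1)] norm_newton_bounded[OF \<delta>(1)] nb])
        have Dy: "frechet_derivative y (at x) = (\<lambda>h. LINT w|lborel. indicator A w *\<^sub>R newton' \<delta> (x - w) h)" for x
          unfolding y_def frechet_derivative_conv[OF iA C1_newton[OF \<delta>(1)] norm_newton_bounded[OF \<delta>(1)] nb]
          by (simp add: frechet_derivative_newton[OF \<delta>(1)])
        have yN: "norm (y x) \<le> N" for x
          unfolding y_def N_def a_def
          by (rule norm_conv_newton_le[OF dim \<delta>(1) A finA]) (use a in \<open>simp add: a_def\<close>)
        have nm: "(\<lambda>x. newton' \<delta> x b) \<in> borel_measurable borel" for b :: 'a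
          by (intro borel_measurable_continuous_onI continuous_on_newton'[OF \<delta>(1)])
        have iN: "integrable lborel (\<lambda>w. indicator A w *\<^sub>R newton' \<delta> (x - w) b)" for x b :: 'a
          by (rule integrable_scaleR_bounded[OF iA measurable_compose[OF _ nm] norm_newton'_le[OF \<delta>(1)]]) simp
        have divy: "divergence y x = (LINT w|lborel. indicator A w * divergence (newton \<delta>) (x - w))"
          and idiv: "integrable lborel (\<lambda>w. indicator A w * divergence (newton \<delta>) (x - w))" for x
        proof -
          have eq: "indicator A w * divergence (newton \<delta>) (x - w) =
              (\<Sum>b\<in>Basis. (indicator A w *\<^sub>R newton' \<delta> (x - w) b) \<bullet> b)" for w
            by (simp add: divergence_def frechet_derivative_newton[OF \<delta>(1)] sum_distrib_left)
          show "integrable lborel (\<lambda>w. indicator A w * divergence (newton \<delta>) (x - w))"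
            unfolding eq by (intro Bochner_Integration.integrable_sum integrable_inner_left iN)
          have "divergence y x = (\<Sum>b\<in>Basis. (LINT w|lborel. (indicator A w *\<^sub>R newton' \<delta> (x - w) b) \<bullet> b))"
            unfolding divergence_def Dy by (intro sum.cong refl integral_inner_left[symmetric] iN)
          also have "\<dots> = (LINT w|lborel. (\<Sum>b\<in>Basis. (indicator A w *\<^sub>R newton' \<delta> (x - w) b) \<bullet> b))"
            by (intro Bochner_Integration.integral_sum[symmetric] integrable_inner_left iN)
          finally show "divergence y x = (LINT w|lborel. indicator A w * divergence (newton \<delta>) (x - w))"
            unfolding eq .
        qed
        obtain c where c: "\<And>x::'a. norm (moll \<delta> x) \<le> c" using moll_bounded[OF \<delta>(1)] by blast
        have c': "\<bar>moll \<delta> x\<bar> \<le> c" for x :: 'a using c[of x] by simp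
        let ?J = "\<lambda>x. LINT w|lborel. indicator A w * moll \<delta> (x - w)"
        have iJ: "integrable lborel (\<lambda>w. indicator A w * moll \<delta> (x - w))" for x
          using integrable_scaleR_bounded[OF iA measurable_compose[OF _ moll_measurable] c, of "\<lambda>w. x - w"] by simp
        have J_le: "I / 2 * ?J x \<le> divergence y x" for x
        proof -
          have "I / 2 * ?J x = (LINT w|lborel. I / 2 * (indicator A w * moll \<delta> (x - w)))" by simp
          also have "\<dots> \<le> (LINT w|lborel. indicator A w * divergence (newton \<delta>) (x - w))"
          proof (rule integral_mono[OF integrable_mult_right[OF iJ] idiv])
            show "I / 2 * (indicator A w * moll \<delta> (x - w)) \<le> indicator A w * divergence (newton \<delta>) (x - w)" for w
              using divergence_newton_ge[OF \<delta>(1) dim, of "x - w"] by (cases "w \<in> A") (simp_all add: I_def)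
          qed
          finally show ?thesis by (simp only: divy)
        qed
        note sw = integral_conv_swap[OF g(1) iA moll_measurable c']
        \<comment> \<open>The field \<open>y\<close> need not have compact support, so a global
          bound on its divergence is used to make the pairing with \<open>g\<close>
          integrable.\<close>
        have dyb: "\<bar>divergence y x\<bar> \<le> DIM('a) * (3 / \<delta>\<^sup>2 * a)" for x
        proof -
          have "norm (frechet_derivative y (at x) b) \<le> 3 / \<delta>\<^sup>2 * a" if "b \<in> Basis" for b
          proof -
            have "norm (frechet_derivative y (at x) b) \<le> (LINT w|lborel. norm (indicator A w *\<^sub>R newton' \<delta> (x - w) b))"
              unfolding Dy by (rule integral_norm_bound)
            also have "\<dots> \<le> (LINT w|lborel. 3 / \<delta>\<^sup>2 * indicator A w)"
            proof (rule integral_mono[OF integrable_norm[OF iN]])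
              show "norm (indicator A w *\<^sub>R newton' \<delta> (x - w) b) \<le> 3 / \<delta>\<^sup>2 * indicator A w" for w
                using norm_newton'_le[OF \<delta>(1), of "x - w" b] that by (cases "w \<in> A") auto
            qed (use iA in simp)
            also have "\<dots> = 3 / \<delta>\<^sup>2 * a" using iA by (simp add: a_def)
            finally show ?thesis .
          qed
          then have "\<bar>frechet_derivative y (at x) b \<bullet> b\<bar> \<le> 3 / \<delta>\<^sup>2 * a" if "b \<in> Basis" for b
            using Basis_le_norm[OF that] that order_trans by blast
          then have "(\<Sum>b\<in>Basis. \<bar>frechet_derivative y (at x) b \<bullet> b\<bar>) \<le> (\<Sum>b\<in>(Basis::'a set). 3 / \<delta>\<^sup>2 * a)"
            by (rule sum_mono)
          then show ?thesis
            unfolding divergence_def by (intro order_trans[OF sum_abs]) simp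
        qed
        have igd: "integrable lborel (\<lambda>x. g x * divergence y x)"
        proof -
          have "norm (divergence y x) \<le> DIM('a) * (3 / \<delta>\<^sup>2 * a)" for x using dyb by simp
          from integrable_scaleR_bounded[OF g(1) divergence_measurable[OF y1] this] show ?thesis by simp
        qed
        have "I / 2 * (LINT x|lborel. g x * ?J x) = (LINT x|lborel. I / 2 * (g x * ?J x))" by simp
        also have "\<dots> \<le> (LINT x|lborel. g x * divergence y x)"
        proof (rule integral_mono[OF integrable_mult_right[OF sw(2)] igd])
          show "I / 2 * (g x * ?J x) \<le> g x * divergence y x" for x
            using mult_left_mono[OF J_le g(2), of x x] by (simp only: mult.left_commute)
        qed
        also have "(LINT x|lborel. g x * divergence y x) = N * (LINT x|lborel. g x * divergence (\<lambda>x. (1 / N) *\<^sub>R y x) x)"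
          using N by (simp add: divergence_cmult[OF y1])
        also have "\<dots> \<le> N * T"
          using N yN by (intro mult_left_mono T C1_scaleR C1_const y1) (auto simp: divide_simps)
        finally have 1: "I / 2 * (LINT x|lborel. g x * ?J x) \<le> N * T" .
        have sym: "moll \<delta> (x - w) = moll \<delta> (w - x)" for x w :: 'a
          using moll_minus[OF \<delta>(1), of "w - x"] by simp
        \<comment> \<open>The even mollifier moves from the indicator to \<open>g\<close>. What
          remains is the integral over \<open>A\<close> of the mollified \<open>g\<close>, which
          misses the integral of \<open>g\<close> by at most \<open>e\<close>.\<close>
        have "(LINT x|lborel. g x * ?J x) = (LINT w|lborel. indicator A w * (LINT x|lborel. g x * moll \<delta> (x - w)))"
          by (rule sw(1))
        also have "\<dots> = (LINT w|lborel. indicator A w * conv g (moll \<delta>) w)"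
          unfolding conv_def by (simp add: sym)
        finally have 2: "(LINT x|lborel. g x * ?J x) = (LINT w|lborel. indicator A w * conv g (moll \<delta>) w)" .
        have ic: "integrable lborel (\<lambda>w. indicator A w * conv g (moll \<delta>) w)"
          by (rule Bochner_Integration.integrable_bound[OF \<delta>(2)])
             (use \<delta>(2) in \<open>auto simp: indicator_def dest: borel_measurable_integrable\<close>)
        have "(LINT x|lborel. g x) \<le> (LINT x|lborel. indicator A x * conv g (moll \<delta>) x + \<bar>conv g (moll \<delta>) x - g x\<bar>)"
        proof (rule integral_mono[OF g(1)])
          show "g x \<le> indicator A x * conv g (moll \<delta>) x + \<bar>conv g (moll \<delta>) x - g x\<bar>" for x
            using gA[of x] by (cases "x \<in> A") auto
        qed (use ic \<delta>(2) g(1) in simp)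
        also have "\<dots> = (LINT x|lborel. g x * ?J x) + (LINT x|lborel. \<bar>conv g (moll \<delta>) x - g x\<bar>)"
          using ic \<delta>(2) g(1) by (simp add: 2)
        also have "\<dots> \<le> 2 / I * (N * T) + e"
          using 1 I \<delta>(3) by (intro add_mono) (auto simp: field_simps)
        finally show ?thesis by (simp add: N_def)
      qed
      then show ?thesis unfolding a_def A_def by (rule field_le_epsilon)
    qed
  qed
qed

subsection \<open>De Giorgi iteration\<close>

text \<open>The decay \<open>a j \<le> a 0 * (1 / b\<^sup>2) ^ j\<close> reproduces itself: its
  square root contributes \<open>(1 / b) ^ j\<close>, which cancels the growing factor
  \<open>b ^ j\<close>, and the smallness of \<open>a 0\<close> relative to \<open>d\<close> makes
  the remaining factor \<open>C * sqrt (a 0 / d)\<close> at most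
  \<open>1 / b\<^sup>2\<close>.\<close>

lemma de_giorgi_sequence_tendsto_0:
  fixes a :: "nat \<Rightarrow> real"
  assumes a: "\<And>j. 0 \<le> a j" and b: "1 < b" and C: "0 \<le> C" and d: "0 < d" "(C * b\<^sup>2)\<^sup>2 * a 0 \<le> d"
    and step: "\<And>j. a (Suc j) \<le> C * b ^ j * sqrt (a j / d) * a j"
  shows "a \<longlonglongrightarrow> 0"
proof -
  have b0: "0 < b" using b by simp
  have C1: "C * sqrt (a 0 / d) \<le> 1 / b\<^sup>2"
  proof -
    have "(C * b\<^sup>2)\<^sup>2 * (a 0 / d) \<le> 1" using d by (simp add: divide_simps)
    then have "sqrt ((C * b\<^sup>2)\<^sup>2 * (a 0 / d)) \<le> 1" by simp
    moreover have "sqrt ((C * b\<^sup>2)\<^sup>2 * (a 0 / d)) = C * b\<^sup>2 * sqrt (a 0 / d)"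
    proof -
      have "\<bar>C * b\<^sup>2\<bar> = C * b\<^sup>2" using C by simp
      then show ?thesis by (simp only: real_sqrt_mult real_sqrt_abs)
    qed
    ultimately have "C * b\<^sup>2 * sqrt (a 0 / d) \<le> 1" by (simp only:)
    then show ?thesis using b0 by (simp add: field_simps)
  qed
  have le: "a j \<le> a 0 * (1 / b\<^sup>2) ^ j" for j
  proof (induction j)
    case (Suc j)
    have "a j / d \<le> a 0 / d * ((1 / b) ^ j)\<^sup>2"
      using divide_right_mono[OF Suc.IH, of d] d by (simp add: power_mult[symmetric] power_divide mult.commute)
    then have "sqrt (a j / d) \<le> sqrt (a 0 / d * ((1 / b) ^ j)\<^sup>2)" by simp
    also have "\<dots> = sqrt (a 0 / d) * \<bar>(1 / b) ^ j\<bar>" by (simp only: real_sqrt_mult real_sqrt_abs)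
    also have "\<bar>(1 / b) ^ j\<bar> = (1 / b) ^ j" using b0 by simp
    finally have s: "sqrt (a j / d) \<le> sqrt (a 0 / d) * (1 / b) ^ j" .
    have "a (Suc j) \<le> C * b ^ j * sqrt (a j / d) * a j" by (rule step)
    also have "\<dots> \<le> C * b ^ j * (sqrt (a 0 / d) * (1 / b) ^ j) * a j"
      using s C b0 a by (intro mult_right_mono mult_left_mono) auto
    also have "\<dots> = (C * sqrt (a 0 / d)) * a j" using b0 by (simp add: power_divide)
    also have "\<dots> \<le> (1 / b\<^sup>2) * a j" by (rule mult_right_mono[OF C1 a])
    also have "\<dots> \<le> (1 / b\<^sup>2) * (a 0 * (1 / b\<^sup>2) ^ j)" by (rule mult_left_mono[OF Suc.IH]) simp
    finally show ?case by simp
  qed simp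
  have "1 < b\<^sup>2" using b by (simp add: one_less_power)
  then have "(\<lambda>j. a 0 * (1 / b\<^sup>2) ^ j) \<longlonglongrightarrow> a 0 * 0"
    by (intro tendsto_intros LIMSEQ_power_zero) (simp add: divide_less_eq)
  then have lim: "(\<lambda>j. a 0 * (1 / b\<^sup>2) ^ j) \<longlonglongrightarrow> 0" by simp
  show ?thesis
    by (rule tendsto_sandwich[OF _ _ tendsto_const lim]) (simp_all add: a le)
qed

text \<open>Radii \<open>R (1 + 2\<^sup>-\<^sup>j)\<close> decrease to \<open>R\<close> while the levels \<open>d (1 - 2\<^sup>-\<^sup>j)\<close> increase to the bound \<open>d\<close>.\<close>

lemma de_giorgi_local_bound:
  fixes u :: "'a::euclidean_space \<Rightarrow> real"
  assumes dim: "DIM('a) = 2" and u: "integrable lborel u" and R: "0 < R" and B: "0 \<le> B"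
    and cac: "\<And>k s y. 0 \<le> k \<Longrightarrow> R \<le> s \<Longrightarrow> s \<le> 2 * R \<Longrightarrow> C1 y \<Longrightarrow> (\<And>x. norm (y x) \<le> 1) \<Longrightarrow>
      (LINT x|lborel. (bump s (x - x0) * max 0 (u x - k)) * divergence y x)
        \<le> B * (LINT x|lborel. indicator (cball x0 s) x * max 0 (u x - k))"
  shows "\<exists>d. AE x in lborel. x \<in> cball x0 R \<longrightarrow> u x \<le> d"
proof -
  have um[measurable]: "u \<in> borel_measurable borel" using u by (auto dest: borel_measurable_integrable)
  obtain C0 where C0: "0 < C0" and sob: "\<forall>(g :: 'a \<Rightarrow> real) T. integrable lborel g \<longrightarrow> (\<forall>x. 0 \<le> g x) \<longrightarrow>
      emeasure lborel {x. 0 < g x} < \<infinity> \<longrightarrow>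
      (\<forall>y. C1 y \<and> (\<forall>x. norm (y x) \<le> 1) \<longrightarrow> (LINT x|lborel. g x * divergence y x) \<le> T) \<longrightarrow>
      (LINT x|lborel. g x) \<le> C0 * sqrt (measure lborel {x. 0 < g x}) * T"
    using integral_le_sqrt_measure_mult_variation[OF dim] by (elim exE conjE)
  \<comment> \<open>The 32 is 16, from the lower bound on the cutoff, times 2, from the factor
    \<open>2 ^ Suc j\<close> in the estimate of the support.\<close>
  define C where "C = 32 * C0 * B"
  have C: "0 \<le> C" using C0 B by (simp add: C_def)
  define N where "N = (LINT x|lborel. \<bar>u x\<bar>)"
  have N: "0 \<le> N" by (simp add: N_def)
  \<comment> \<open>This is the smallness condition of the abstract recursion with base 8, as
    \<open>a 0 \<le> N\<close>; the summand 1 keeps \<open>d\<close> positive.\<close>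
  define d where "d = (C * 8\<^sup>2)\<^sup>2 * N + 1"
  have d: "0 < d" using N by (simp add: d_def add_nonneg_pos)
  define \<rho> where "\<rho> j = R * (1 + 1 / 2 ^ j)" for j :: nat
  define k where "k j = d * (1 - 1 / 2 ^ j)" for j :: nat
  have half: "0 < 1 / (2::real) ^ j" "1 / (2::real) ^ j \<le> 1" for j :: nat
    by (simp_all add: divide_simps)
  have \<rho>: "R \<le> \<rho> j" "\<rho> j \<le> 2 * R" "0 < \<rho> j" for j
  proof -
    have "R * 1 \<le> R * (1 + 1 / 2 ^ j)" "R * (1 + 1 / 2 ^ j) \<le> R * 2"
      using R half[of j] by (intro mult_left_mono; simp)+
    then show "R \<le> \<rho> j" "\<rho> j \<le> 2 * R" by (simp_all add: \<rho>_def)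
    then show "0 < \<rho> j" using R by linarith
  qed
  have k0: "0 \<le> k j" for j unfolding k_def using d half[of j] by (intro mult_nonneg_nonneg) auto
  have kd: "k j \<le> d" for j unfolding k_def using d half[of j] by (intro mult_left_le) auto
  have kS: "k (Suc j) - k j = d / 2 ^ Suc j" for j
    by (simp add: k_def field_simps)
  have \<rho>S: "\<rho> j - \<rho> (Suc j) = R / 2 ^ Suc j" for j
    by (simp add: \<rho>_def field_simps)
  have \<rho>S_le: "\<rho> (Suc j) \<le> \<rho> j" for j
  proof -
    have "0 \<le> R / 2 ^ Suc j" using R by simp
    then show ?thesis using \<rho>S[of j] by linarith
  qed
  define p where "p j x = max 0 (u x - k j)" for j x
  have pm[measurable]: "p j \<in> borel_measurable borel" for j unfolding p_def by measurable
  have p0: "0 \<le> p j x" for j x by (simp add: p_def)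
  have pu: "p j x \<le> \<bar>u x\<bar>" for j x using k0[of j] by (simp add: p_def)
  have bnd: "integrable lborel (\<lambda>x. w x * p j x)"
    if "w \<in> borel_measurable borel" "\<And>x. 0 \<le> w x" "\<And>x. w x \<le> 1" for w :: "'a \<Rightarrow> real" and j
  proof (rule Bochner_Integration.integrable_bound[OF u])
    show "(\<lambda>x. w x * p j x) \<in> borel_measurable lborel" using that(1) by measurable
    show "AE x in lborel. norm (w x * p j x) \<le> norm (u x)"
      using mult_mono[OF that(3) pu _ p0] that(2) p0 by (intro AE_I2) (simp add: abs_mult)
  qed
  have iK: "integrable lborel (\<lambda>x. indicator (cball x0 s) x * p j x)" for s j
    by (rule bnd) (auto simp: indicator_def)
  define a where "a j = (LINT x|lborel. indicator (cball x0 (\<rho> j)) x * p j x)" for j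
  have a0: "0 \<le> a j" for j unfolding a_def by (intro Bochner_Integration.integral_nonneg) (simp add: p0)
  have aN: "a 0 \<le> N"
    unfolding a_def N_def
  proof (rule integral_mono[OF iK])
    show "integrable lborel (\<lambda>x. \<bar>u x\<bar>)" using u by simp
    show "indicator (cball x0 (\<rho> 0)) x * p 0 x \<le> \<bar>u x\<bar>" for x
      using pu[of 0 x] by (auto simp: indicator_def)
  qed
  have step: "a (Suc j) \<le> C * 8 ^ j * sqrt (a j / d) * a j" for j
  proof -
    define g where "g x = bump (\<rho> j) (x - x0) * p (Suc j) x" for x
    have g0: "0 \<le> g x" for x by (simp add: g_def bump_nonneg p0)
    have gi: "integrable lborel g"
      unfolding g_def by (rule bnd) (auto simp: bump_nonneg bump_le_1)
    have gm[measurable]: "g \<in> borel_measurable borel" using gi by (auto dest: borel_measurable_integrable)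
    define A where "A = {x. 0 < g x}"
    have Am[measurable]: "A \<in> sets borel" unfolding A_def by measurable
    have AK: "x \<in> cball x0 (\<rho> j) \<and> k (Suc j) < u x" if "x \<in> A" for x
    proof -
      have "0 < g x" using that by (simp add: A_def)
      then have nz: "bump (\<rho> j) (x - x0) \<noteq> 0" "p (Suc j) x \<noteq> 0" by (auto simp: g_def)
      have "norm (x - x0) < \<rho> j" using nz(1) bump_eq_0[OF \<rho>(3), of j "x - x0"] by (meson not_le)
      moreover have "k (Suc j) < u x" using nz(2) by (auto simp: p_def max_def split: if_splits)
      ultimately show ?thesis by (simp add: dist_norm norm_minus_commute)
    qed
    have Afin: "emeasure lborel A < \<infinity>"
      using AK by (intro le_less_trans[OF emeasure_mono emeasure_lborel_cball_finite[of x0 "\<rho> j"]]) auto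
    have iA: "integrable lborel (indicator A :: 'a \<Rightarrow> real)"
      using Afin by (intro integrable_real_indicator) auto
    have aSj: "(LINT x|lborel. indicator (cball x0 (\<rho> j)) x * p (Suc j) x) \<le> a j"
      unfolding a_def
    proof (rule integral_mono[OF iK iK])
      have "0 \<le> d / 2 ^ Suc j" using d by simp
      then have "k j \<le> k (Suc j)" using kS[of j] by linarith
      then have "p (Suc j) x \<le> p j x" for x unfolding p_def by (intro max.mono) auto
      then show "indicator (cball x0 (\<rho> j)) x * p (Suc j) x \<le> indicator (cball x0 (\<rho> j)) x * p j x" for x
        by (intro mult_left_mono) auto
    qed
    have "(LINT x|lborel. g x) \<le> C0 * sqrt (measure lborel {x. 0 < g x}) * (B * a j)"
    proof (rule sob[rule_format, OF gi g0])
      show "emeasure lborel {x. 0 < g x} < \<infinity>" using Afin by (simp add: A_def)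
      fix y :: "'a \<Rightarrow> 'a" assume "C1 y \<and> (\<forall>x. norm (y x) \<le> 1)"
      then have y: "C1 y" "\<And>x. norm (y x) \<le> 1" by auto
      have "(LINT x|lborel. g x * divergence y x) \<le> B * (LINT x|lborel. indicator (cball x0 (\<rho> j)) x * p (Suc j) x)"
        unfolding g_def p_def by (rule cac[OF k0 \<rho>(1,2) y])
      also have "\<dots> \<le> B * a j" by (rule mult_left_mono[OF aSj B])
      finally show "(LINT x|lborel. g x * divergence y x) \<le> B * a j" .
    qed
    then have g_le: "(LINT x|lborel. g x) \<le> C0 * sqrt (measure lborel A) * (B * a j)" by (simp add: A_def)
    \<comment> \<open>Chebyshev's inequality: on \<open>A\<close> the function \<open>u\<close>
      exceeds the next level \<open>k (Suc j)\<close>, hence exceeds \<open>k j\<close> by at least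
      \<open>d / 2 ^ Suc j\<close>.\<close>
    have "d / 2 ^ Suc j * measure lborel A = (LINT x|lborel. d / 2 ^ Suc j * indicator A x)"
      using iA by simp
    also have "\<dots> \<le> a j"
      unfolding a_def
    proof (rule integral_mono[OF _ iK])
      show "integrable lborel (\<lambda>x. d / 2 ^ Suc j * indicator A x)" using iA by simp
      show "d / 2 ^ Suc j * indicator A x \<le> indicator (cball x0 (\<rho> j)) x * p j x" for x
      proof (cases "x \<in> A")
        case True
        then show ?thesis using AK[OF True] kS[of j] by (auto simp: p_def)
      next
        case False
        then show ?thesis using p0[of j x] by (simp add: indicator_def)
      qed
    qed
    finally have "measure lborel A \<le> 2 ^ Suc j * (a j / d)" using d by (simp add: field_simps)
    \<comment> \<open>The power of 2 is enlarged to a power of 4 so that its square root is again a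
      power of 2.\<close>
    also have "\<dots> \<le> 4 ^ Suc j * (a j / d)"
      using a0 d by (intro mult_right_mono power_mono) auto
    finally have "sqrt (measure lborel A) \<le> sqrt (4 ^ Suc j * (a j / d))" by simp
    also have "\<dots> = 2 ^ Suc j * sqrt (a j / d)"
    proof -
      have "(2 * 2 :: real) ^ Suc j = (2 ^ Suc j)\<^sup>2" by (simp only: power2_eq_square power_mult_distrib)
      then have "(4::real) ^ Suc j = (2 ^ Suc j)\<^sup>2" by simp
      then show ?thesis by (simp only: real_sqrt_mult real_sqrt_abs) simp
    qed
    finally have sA: "sqrt (measure lborel A) \<le> 2 ^ Suc j * sqrt (a j / d)" .
    \<comment> \<open>The gap between consecutive radii is at least the fraction
      \<open>1 / (4 * 2 ^ j)\<close> of \<open>\<rho> j\<close>, because \<open>\<rho> j\<close> is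
      at most \<open>2 * R\<close>. On the inner ball the bump is at least the square of this
      fraction.\<close>
    have low: "1 / (16 * 4 ^ j) \<le> bump (\<rho> j) (x - x0)" if "x \<in> cball x0 (\<rho> (Suc j))" for x
    proof -
      define t where "t = \<rho> (Suc j) / \<rho> j"
      have t: "0 \<le> t" "t \<le> 1" using \<rho>(3)[of j] \<rho>(3)[of "Suc j"] \<rho>S_le[of j] by (auto simp: t_def)
      have "R / 2 ^ Suc j / (2 * R) \<le> R / 2 ^ Suc j / \<rho> j"
        using \<rho>[of j] R by (intro divide_left_mono) auto
      also have "\<dots> = (\<rho> j - \<rho> (Suc j)) / \<rho> j" by (simp only: \<rho>S)
      also have "\<dots> = 1 - t" using \<rho>(3)[of j] by (simp add: t_def diff_divide_distrib)
      also have "\<dots> \<le> 1 - t\<^sup>2" using t mult_left_le[of t t] by (simp add: power2_eq_square)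
      finally have "1 / (4 * 2 ^ j) \<le> 1 - t\<^sup>2" using R by simp
      then have "(1 / (4 * 2 ^ j))\<^sup>2 \<le> (1 - t\<^sup>2)\<^sup>2" by (intro power_mono) auto
      also have "\<dots> = (1 - (\<rho> (Suc j))\<^sup>2 / (\<rho> j)\<^sup>2)\<^sup>2" by (simp add: t_def power_divide)
      also have "\<dots> \<le> bump (\<rho> j) (x - x0)"
        using that by (intro bump_ge \<rho> \<rho>S_le) (simp add: dist_norm norm_minus_commute)
      also have "(1 / (4 * 2 ^ j))\<^sup>2 = 1 / (16 * (4::real) ^ j)"
      proof -
        have "((2::real) ^ j)\<^sup>2 = (2 * 2) ^ j" by (simp only: power2_eq_square power_mult_distrib)
        then show ?thesis by (simp add: power_divide power_mult_distrib)
      qed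
      finally show ?thesis .
    qed
    have "a (Suc j) \<le> (LINT x|lborel. 16 * 4 ^ j * g x)"
      unfolding a_def
    proof (rule integral_mono[OF iK])
      show "integrable lborel (\<lambda>x. 16 * 4 ^ j * g x)" using gi by simp
      show "indicator (cball x0 (\<rho> (Suc j))) x * p (Suc j) x \<le> 16 * 4 ^ j * g x" for x
      proof (cases "x \<in> cball x0 (\<rho> (Suc j))")
        case True
        have "1 \<le> 16 * 4 ^ j * bump (\<rho> j) (x - x0)" using low[OF True] by (simp add: divide_simps mult_ac)
        from mult_right_mono[OF this p0[of "Suc j" x]] show ?thesis using True by (simp add: g_def mult.assoc)
      next
        case False
        then show ?thesis using g0[of x] by simp
      qed
    qed
    also have "\<dots> = 16 * 4 ^ j * (LINT x|lborel. g x)" by simp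
    also have "\<dots> \<le> 16 * 4 ^ j * (C0 * sqrt (measure lborel A) * (B * a j))"
      by (rule mult_left_mono[OF g_le]) simp
    also have "\<dots> \<le> 16 * 4 ^ j * (C0 * (2 ^ Suc j * sqrt (a j / d)) * (B * a j))"
      using C0 B a0 sA by (intro mult_left_mono mult_right_mono) auto
    also have "\<dots> = C * (4 ^ j * 2 ^ j) * sqrt (a j / d) * a j" by (simp add: C_def)
    \<comment> \<open>The base 8 combines the decay of the cutoff on the inner ball with the loss in
      the measure of the support.\<close>
    also have "(4::real) ^ j * 2 ^ j = 8 ^ j" by (simp flip: power_mult_distrib)
    finally show ?thesis .
  qed
  have "(C * 8\<^sup>2)\<^sup>2 * a 0 \<le> d"
    using mult_left_mono[OF aN zero_le_power2, of "C * 8\<^sup>2"] unfolding d_def by linarith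
  from de_giorgi_sequence_tendsto_0[OF a0 _ C d this step] have lim: "a \<longlonglongrightarrow> 0" by simp
  \<comment> \<open>The truncation at the limiting level on the limiting ball lies below every
    function of the iteration, so its integral is 0.\<close>
  define q where "q x = indicator (cball x0 R) x * max 0 (u x - d)" for x
  have qi: "integrable lborel q"
  proof (rule Bochner_Integration.integrable_bound[OF u])
    show "AE x in lborel. norm (q x) \<le> norm (u x)"
      using d by (intro AE_I2) (auto simp: q_def indicator_def)
    have "(\<lambda>x. max 0 (u x - d)) \<in> borel_measurable borel" by measurable
    then have "q \<in> borel_measurable borel"
      unfolding q_def[abs_def] by (intro borel_measurable_times borel_measurable_indicator) simp_all
    then show "q \<in> borel_measurable lborel" by simp
  qed
  have "(LINT x|lborel. q x) \<le> a j" for j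
    unfolding a_def
  proof (rule integral_mono[OF qi iK])
    show "q x \<le> indicator (cball x0 (\<rho> j)) x * p j x" for x
      using kd[of j] \<rho>(1)[of j] by (auto simp: q_def p_def indicator_def)
  qed
  then have "(LINT x|lborel. q x) \<le> 0"
    using LIMSEQ_le_const[OF lim] by blast
  moreover have q0: "0 \<le> q x" for x by (simp add: q_def)
  ultimately have "(LINT x|lborel. q x) = 0"
    by (intro antisym Bochner_Integration.integral_nonneg)
  then have "AE x in lborel. q x = 0"
    using integral_nonneg_eq_0_iff_AE[OF qi] q0 by simp
  then have "AE x in lborel. x \<in> cball x0 R \<longrightarrow> u x \<le> d"
    by eventually_elim (auto simp: q_def max_def split: if_splits)
  then show ?thesis by blast
qed

text \<open>A field of length at most 1 is multiplied by \<open>m\<close> to become admissible, and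
  division by \<open>m\<close> afterwards gives the constant. Every cutoff of radius between
  \<open>R\<close> and \<open>2 * R\<close> has slope at most \<open>4 / R\<close>, so one constant
  serves the whole iteration.\<close>

lemma minimizer_local_bound:
  fixes \<Omega> :: "'a::euclidean_space set"
  assumes dim: "DIM('a) = 2"
    and \<Omega>: "open \<Omega>" "bounded \<Omega>" and \<phi>: "metric_integrand \<Omega> \<phi>"
    and u: "integrable lborel u" "tv_le \<phi> \<Omega> u T"
    and minimal: "\<And>K v S T'. compact K \<Longrightarrow> K \<subseteq> \<Omega> \<Longrightarrow> integrable lborel v \<Longrightarrow> (\<And>x. x \<notin> K \<Longrightarrow> v x = 0) \<Longrightarrow>
      tv_le \<phi> \<Omega> v S \<Longrightarrow> tv_le \<phi> \<Omega> (\<lambda>x. u x + v x) T' \<Longrightarrow> T \<le> T'"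
    and R: "0 < R" "cball x0 (2 * R) \<subseteq> \<Omega>"
  shows "\<exists>d. AE x in lborel. x \<in> cball x0 R \<longrightarrow> u x \<le> d"
proof -
  obtain m M where m: "0 < m" "\<And>x \<xi>. x \<in> \<Omega> \<Longrightarrow> m * norm \<xi> \<le> \<phi> x \<xi>"
    and M: "0 < M" "\<And>x \<xi>. x \<in> \<Omega> \<Longrightarrow> \<phi> x \<xi> \<le> M * norm \<xi>"
    using \<phi> closure_subset[of \<Omega>] unfolding metric_integrand_def by blast
  show ?thesis
  proof (rule de_giorgi_local_bound[OF dim u(1) R(1)])
    show "0 \<le> (M + m) * (4 / R) / m" using m M R by simp
    fix k s :: real and y :: "'a \<Rightarrow> 'a" assume k: "0 \<le> k" and s: "R \<le> s" "s \<le> 2 * R" and y: "C1 y" "\<And>x. norm (y x) \<le> 1"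
    define \<eta> where "\<eta> x = bump s (x - x0)" for x :: 'a
    have s0: "0 < s" using R s by simp
    have D: "(\<eta> has_derivative bump' s (x - x0)) (at x)" for x
      unfolding \<eta>_def[abs_def]
      by (rule has_derivative_compose[of "\<lambda>x. x - x0" "\<lambda>h. h", OF _ has_derivative_bump])
         (auto intro!: derivative_eq_intros)
    have D': "frechet_derivative \<eta> (at x) = bump' s (x - x0)" for x
      by (rule frechet_derivative_at[OF D, symmetric])
    have c: "continuous_on UNIV (\<lambda>x. bump' s (x - x0) h)" for h
      using continuous_on_compose2[OF continuous_on_bump' continuous_on_diff[OF continuous_on_id continuous_on_const]]
      by simp
    have \<eta>1: "C1 \<eta>" by (rule C1_I[OF D c])
    have \<eta>K: "\<eta> x = 0" if "x \<notin> cball x0 s" for x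
      unfolding \<eta>_def using that by (intro bump_eq_0 s0) (simp add: dist_norm norm_minus_commute)
    have L: "\<bar>frechet_derivative \<eta> (at x) h\<bar> \<le> 4 / R * norm h" for x h
    proof -
      have "\<bar>frechet_derivative \<eta> (at x) h\<bar> \<le> 4 / s * norm h" unfolding D' by (rule bump'_bound[OF s0])
      also have "\<dots> \<le> 4 / R * norm h" using R s by (intro mult_right_mono divide_left_mono) auto
      finally show ?thesis .
    qed
    have Ks: "cball x0 s \<subseteq> \<Omega>" using R(2) s by (meson order_trans subset_cball)
    have my: "C1 (\<lambda>x. m *\<^sub>R y x)" "norm (m *\<^sub>R y x) \<le> m" for x
      using y m by (auto intro: C1_scaleR C1_const simp: mult_left_le)
    have "(LINT x|lborel. (\<eta> x * max 0 (u x - k)) * divergence (\<lambda>x. m *\<^sub>R y x) x)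
      \<le> (M + m) * (4 / R) * (LINT x|lborel. indicator (cball x0 s) x * max 0 (u x - k))"
    proof (rule caccioppoli[OF \<Omega> \<phi> m M u compact_cball Ks minimal[OF compact_cball Ks] \<eta>1 \<eta>K _ _ _ L my k])
      show "0 \<le> \<eta> x" "\<eta> x \<le> 1" for x by (simp_all add: \<eta>_def bump_nonneg bump_le_1)
      show "0 \<le> 4 / R" using R by simp
    qed
    also have "(LINT x|lborel. (\<eta> x * max 0 (u x - k)) * divergence (\<lambda>x. m *\<^sub>R y x) x)
        = m * (LINT x|lborel. (\<eta> x * max 0 (u x - k)) * divergence y x)"
      by (simp add: divergence_cmult[OF y(1)] mult.left_commute)
    finally have "m * (LINT x|lborel. (\<eta> x * max 0 (u x - k)) * divergence y x) / m
        \<le> (M + m) * (4 / R) * (LINT x|lborel. indicator (cball x0 s) x * max 0 (u x - k)) / m"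
      by (rule divide_right_mono) (use m in simp)
    then show "(LINT x|lborel. (bump s (x - x0) * max 0 (u x - k)) * divergence y x)
        \<le> (M + m) * (4 / R) / m * (LINT x|lborel. indicator (cball x0 s) x * max 0 (u x - k))"
      using m(1) by (simp add: \<eta>_def)
  qed
qed

subsection \<open>Transfer to the Lebesgue formulation\<close>

text \<open>The lower growth bound makes the set under the supremum bounded, so the real supremum is
  an upper bound. Homogeneity rescales any nonzero \<xi> to
  \<open>\<phi> x \<xi> = 1\<close>.\<close>

lemma polar_le_1_iff:
  fixes \<Omega> :: "'a::euclidean_space set"
  assumes \<phi>: "metric_integrand \<Omega> \<phi>" and x: "x \<in> \<Omega>"
  shows "polar \<phi> x \<zeta> \<le> 1 \<longleftrightarrow> (\<forall>\<xi>. \<zeta> \<bullet> \<xi> \<le> \<phi> x \<xi>)"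
proof -
  have cl: "x \<in> closure \<Omega>" using x closure_subset by blast
  obtain m where m: "0 < m" "\<And>\<xi>. m * norm \<xi> \<le> \<phi> x \<xi>"
    using \<phi> cl unfolding metric_integrand_def by blast
  have hom: "\<phi> x (t *\<^sub>R \<xi>) = \<bar>t\<bar> * \<phi> x \<xi>" for t \<xi>
    using \<phi> cl unfolding metric_integrand_def by blast
  let ?S = "{\<zeta> \<bullet> \<xi> | \<xi>. \<phi> x \<xi> \<le> 1}"
  have "\<phi> x 0 = 0" using hom[of 0 0] by simp
  then have ne: "?S \<noteq> {}" by (auto intro!: exI[of _ 0])
  have bdd: "bdd_above ?S"
  proof (rule bdd_aboveI)
    fix s assume "s \<in> ?S"
    then obtain \<xi> where \<xi>: "s = \<zeta> \<bullet> \<xi>" "\<phi> x \<xi> \<le> 1" by blast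
    then have "m * norm \<xi> \<le> 1" using m(2)[of \<xi>] by linarith
    then have "norm \<xi> \<le> 1 / m" using m(1) by (simp add: pos_le_divide_eq mult.commute)
    then have "norm \<zeta> * norm \<xi> \<le> norm \<zeta> * (1 / m)" by (rule mult_left_mono) simp
    then show "s \<le> norm \<zeta> * (1 / m)" using \<xi>(1) norm_cauchy_schwarz[of \<zeta> \<xi>] by linarith
  qed
  show ?thesis
  proof
    assume le: "polar \<phi> x \<zeta> \<le> 1"
    show "\<forall>\<xi>. \<zeta> \<bullet> \<xi> \<le> \<phi> x \<xi>"
    proof
      fix \<xi>
      show "\<zeta> \<bullet> \<xi> \<le> \<phi> x \<xi>"
      proof (cases "\<xi> = 0")
        case True
        then show ?thesis using \<open>\<phi> x 0 = 0\<close> by simp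
      next
        case False
        then have pos: "0 < \<phi> x \<xi>" using m(1) m(2)[of \<xi>] by (auto intro: less_le_trans[of _ "m * norm \<xi>"])
        have "\<phi> x ((1 / \<phi> x \<xi>) *\<^sub>R \<xi>) \<le> 1" using pos by (simp add: hom)
        then have "\<zeta> \<bullet> ((1 / \<phi> x \<xi>) *\<^sub>R \<xi>) \<in> ?S" by blast
        then have "\<zeta> \<bullet> ((1 / \<phi> x \<xi>) *\<^sub>R \<xi>) \<le> Sup ?S" by (rule cSup_upper[OF _ bdd])
        then have "\<zeta> \<bullet> ((1 / \<phi> x \<xi>) *\<^sub>R \<xi>) \<le> 1" using le unfolding polar_def by (rule order_trans)
        then show ?thesis using pos by (simp add: pos_divide_le_eq)
      qed
    qed
  next
    assume *: "\<forall>\<xi>. \<zeta> \<bullet> \<xi> \<le> \<phi> x \<xi>"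
    show "polar \<phi> x \<zeta> \<le> 1"
      unfolding polar_def
    proof (rule cSup_least[OF ne])
      fix s assume "s \<in> ?S"
      then obtain \<xi> where "s = \<zeta> \<bullet> \<xi>" "\<phi> x \<xi> \<le> 1" by blast
      then show "s \<le> 1" using *[rule_format, of \<xi>] by linarith
    qed
  qed
qed

lemma test_field_in_C1c: "test_field \<Omega> z \<Longrightarrow> z \<in> C1c \<Omega>"
  unfolding test_field_def C1c_def C1_def
  by (auto intro: continuous_on_subset)

text \<open>Members of \<open>C1c \<Omega>\<close> are unconstrained outside \<Omega>. The extension
  by 0 is continuously differentiable because \<Omega> and the complement of \<open>K\<close> are
  open and cover the space.\<close>

lemma C1c_extend_zero:
  fixes z :: "'a::euclidean_space \<Rightarrow> 'b::euclidean_space"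
  assumes \<Omega>: "open \<Omega>" and z: "z \<in> C1c \<Omega>"
  shows "test_field \<Omega> (\<lambda>x. if x \<in> \<Omega> then z x else 0)"
    and "\<And>x. x \<in> \<Omega> \<Longrightarrow> frechet_derivative (\<lambda>x. if x \<in> \<Omega> then z x else 0) (at x) = frechet_derivative z (at x)"
proof -
  let ?w = "\<lambda>x. if x \<in> \<Omega> then z x else 0"
  let ?D = "\<lambda>x. if x \<in> \<Omega> then frechet_derivative z (at x) else (\<lambda>h. 0)"
  obtain K where K: "compact K" "K \<subseteq> \<Omega>" "\<And>x. x \<in> \<Omega> - K \<Longrightarrow> z x = 0"
    using z unfolding C1c_def by blast
  have oK: "open (- K)" by (rule open_Compl[OF compact_imp_closed[OF K(1)]])
  have wK: "?w x = 0" if "x \<notin> K" for x using K(3)[of x] that by auto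
  have D: "(?w has_derivative ?D x) (at x)" for x
  proof (cases "x \<in> \<Omega>")
    case True
    have "(z has_derivative frechet_derivative z (at x)) (at x)"
      using z True by (auto simp: C1c_def frechet_derivative_works[symmetric])
    then have "(?w has_derivative frechet_derivative z (at x)) (at x)"
      by (rule has_derivative_transform_within_open[OF _ \<Omega> True]) simp
    then show ?thesis using True by simp
  next
    case False
    then have xK: "x \<in> - K" using K(2) by blast
    have "(?w has_derivative (\<lambda>h. 0)) (at x)"
      by (rule has_derivative_transform_within_open[OF has_derivative_const oK xK, of 0]) (rule wK[symmetric], simp)
    then show ?thesis using False by simp
  qed
  have Dw: "frechet_derivative ?w (at x) = ?D x" for x
    by (rule frechet_derivative_at[OF D, symmetric])
  show "\<And>x. x \<in> \<Omega> \<Longrightarrow> frechet_derivative ?w (at x) = frechet_derivative z (at x)"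
    by (simp only: Dw if_True)
  have "continuous_on UNIV (\<lambda>x. ?D x h)" for h
  proof -
    have "continuous_on \<Omega> (\<lambda>x. frechet_derivative z (at x) h)" using z by (simp add: C1c_def)
    then have 1: "continuous_on \<Omega> (\<lambda>x. ?D x h)" by (rule continuous_on_eq) simp
    have "?D x h = 0" if "x \<in> - K" for x
    proof -
      have "frechet_derivative ?w (at x) = (\<lambda>h. 0)"
        by (rule frechet_derivative_eq_0[OF compact_imp_closed[OF K(1)] wK]) (use that in simp_all)
      then show ?thesis by (simp only: Dw)
    qed
    then have 2: "continuous_on (- K) (\<lambda>x. ?D x h)"
      by (intro continuous_on_eq[OF continuous_on_const[of _ 0]]) simp
    have "\<Omega> \<union> - K = UNIV" using K(2) by blast
    then show ?thesis using continuous_on_open_Un[OF \<Omega> oK 1 2] by simp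
  qed
  then have "C1 ?w" by (rule C1_I[OF D])
  then show "test_field \<Omega> ?w"
    unfolding test_field_def using K(1,2) wK by blast
qed

text \<open>For fixed \<xi> the set where the inequality fails is open, by continuity of
  \<open>z\<close> and \<phi>, and it is a null set. An open null set is empty.\<close>

lemma admissible_if_AE:
  fixes \<Omega> :: "'a::euclidean_space set"
  assumes \<Omega>: "open \<Omega>" and \<phi>: "metric_integrand \<Omega> \<phi>" and z: "z \<in> C1c \<Omega>"
    and ae: "AE x in lebesgue_on \<Omega>. polar \<phi> x (z x) \<le> 1"
  shows "admissible \<phi> \<Omega> z"
  unfolding admissible_def
proof (intro ballI allI)
  fix x \<xi> assume x: "x \<in> \<Omega>"
  have \<Omega>m: "\<Omega> \<in> sets lebesgue" using \<Omega> by simp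
  let ?f = "\<lambda>x. z x \<bullet> \<xi> - \<phi> x \<xi>"
  have "continuous_on \<Omega> z"
    using z by (auto simp: C1c_def intro!: continuous_at_imp_continuous_on differentiable_imp_continuous_within)
  moreover have "continuous_on \<Omega> (\<lambda>x. \<phi> x \<xi>)"
  proof -
    have "continuous_on (closure \<Omega> \<times> UNIV) (\<lambda>(x, \<xi>). \<phi> x \<xi>)"
      using \<phi> by (simp add: metric_integrand_def)
    moreover have "continuous_on \<Omega> (\<lambda>x. (x, \<xi>))" by (intro continuous_intros)
    moreover have "(\<lambda>x. (x, \<xi>)) ` \<Omega> \<subseteq> closure \<Omega> \<times> UNIV" using closure_subset[of \<Omega>] by auto
    ultimately show ?thesis using continuous_on_compose2 by fastforce
  qed
  ultimately have cf: "continuous_on \<Omega> ?f" by (intro continuous_intros)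
  have "open (?f -` {0<..} \<inter> \<Omega>)"
    using continuous_on_open_vimage[OF \<Omega>, THEN iffD1, OF cf] by simp
  then have "closed (- (?f -` {0<..} \<inter> \<Omega>))" by (rule closed_Compl)
  moreover have "AE x \<in> \<Omega> in lebesgue. x \<in> - (?f -` {0<..} \<inter> \<Omega>)"
  proof -
    have "AE x in lebesgue. x \<in> \<Omega> \<longrightarrow> polar \<phi> x (z x) \<le> 1"
      using ae \<Omega>m by (simp add: AE_restrict_space_iff)
    then show ?thesis
    proof eventually_elim
      case (elim x)
      have "?f x \<le> 0" if "x \<in> \<Omega>" using elim that polar_le_1_iff[OF \<phi> that, of "z x"] by simp
      then show ?case by auto
    qed
  qed
  ultimately have "x \<in> - (?f -` {0<..} \<inter> \<Omega>)"
    by (rule mem_closed_if_AE_lebesgue_open[OF \<Omega>]) (rule x)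
  then show "z x \<bullet> \<xi> \<le> \<phi> x \<xi>" using x by auto
qed

text \<open>Values of the Borel representative \<open>g\<close> off \<Omega> do not enter, since
  test fields have divergence 0 there. Every test field lies in \<open>C1c \<Omega>\<close>;
  conversely a member of \<open>C1c \<Omega>\<close> is replaced by its extension by zero.\<close>

lemma total_variation_le_iff:
  fixes \<Omega> :: "'a::euclidean_space set"
  assumes \<Omega>: "open \<Omega>" and \<phi>: "metric_integrand \<Omega> \<phi>"
    and f: "f \<in> borel_measurable (lebesgue_on \<Omega>)" and g: "g \<in> borel_measurable borel"
    and ae: "AE x in lebesgue_on \<Omega>. f x = g x"
  shows "total_variation \<phi> \<Omega> f \<le> ereal T \<longleftrightarrow> tv_le \<phi> \<Omega> g T"
proof -
  have \<Omega>m: "\<Omega> \<in> sets lebesgue" using \<Omega> by simp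
  have int: "(LINT x|lebesgue_on \<Omega>. f x * divergence z x) = (LINT x|lborel. g x * divergence w x)"
    if w: "test_field \<Omega> w" and eq: "\<And>x. x \<in> \<Omega> \<Longrightarrow> divergence z x = divergence w x" for z w
  proof -
    obtain K where K: "compact K" "K \<subseteq> \<Omega>" "\<And>x. x \<notin> K \<Longrightarrow> w x = 0"
      using w unfolding test_field_def by blast
    have w1: "C1 w" using w by (simp add: test_field_def)
    note [measurable] = divergence_measurable[OF w1] g
    have w0: "divergence w x = 0" if "x \<notin> \<Omega>" for x
      using that K(2) by (intro divergence_eq_0[OF compact_imp_closed[OF K(1)] K(3)]) auto
    have gm: "(\<lambda>x. g x * divergence w x) \<in> borel_measurable lborel" by measurable
    have gl: "(\<lambda>x. g x * divergence w x) \<in> borel_measurable lebesgue" by (rule measurable_completion[OF gm])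
    have "(LINT x|lebesgue_on \<Omega>. f x * divergence z x) = (LINT x|lebesgue_on \<Omega>. f x * divergence w x)"
      by (intro Bochner_Integration.integral_cong refl) (simp add: eq)
    also have "\<dots> = (LINT x|lebesgue_on \<Omega>. g x * divergence w x)"
    proof (rule integral_cong_AE)
      have "divergence w \<in> borel_measurable lebesgue"
        by (rule measurable_completion) simp
      then show "(\<lambda>x. f x * divergence w x) \<in> borel_measurable (lebesgue_on \<Omega>)"
        by (intro borel_measurable_times f measurable_restrict_space1)
      show "(\<lambda>x. g x * divergence w x) \<in> borel_measurable (lebesgue_on \<Omega>)"
        by (rule measurable_restrict_space1[OF gl])
      show "AE x in lebesgue_on \<Omega>. f x * divergence w x = g x * divergence w x"
        using ae by eventually_elim simp
    qed
    also have "\<dots> = (LINT x|lebesgue. indicator \<Omega> x *\<^sub>R (g x * divergence w x))"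
      by (rule integral_restrict_space) (use \<Omega>m in simp)
    also have "\<dots> = (LINT x|lebesgue. g x * divergence w x)"
      by (intro Bochner_Integration.integral_cong refl) (use w0 in \<open>auto simp: indicator_def\<close>)
    also have "\<dots> = (LINT x|lborel. g x * divergence w x)"
      by (rule integral_completion[OF gm])
    finally show ?thesis .
  qed
  show ?thesis
  proof
    assume le: "total_variation \<phi> \<Omega> f \<le> ereal T"
    show "tv_le \<phi> \<Omega> g T"
      unfolding tv_le_def
    proof (intro allI impI)
      fix z assume z: "test_field \<Omega> z \<and> admissible \<phi> \<Omega> z"
      have "AE x in lebesgue_on \<Omega>. polar \<phi> x (z x) \<le> 1"
        using z by (intro AE_I2) (auto simp: polar_le_1_iff[OF \<phi>] admissible_def)
      then have "ereal (LINT x|lebesgue_on \<Omega>. f x * divergence z x) \<le> total_variation \<phi> \<Omega> f"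
        unfolding total_variation_def using z test_field_in_C1c by (intro SUP_upper) auto
      then have "ereal (LINT x|lebesgue_on \<Omega>. f x * divergence z x) \<le> ereal T" using le by (rule order_trans)
      then show "(LINT x|lborel. g x * divergence z x) \<le> T" using int[of z z] z by simp
    qed
  next
    assume le: "tv_le \<phi> \<Omega> g T"
    show "total_variation \<phi> \<Omega> f \<le> ereal T"
      unfolding total_variation_def
    proof (rule SUP_least)
      fix z assume z: "z \<in> {z \<in> C1c \<Omega>. AE x in lebesgue_on \<Omega>. polar \<phi> x (z x) \<le> 1}"
      let ?w = "\<lambda>x. if x \<in> \<Omega> then z x else 0"
      have zC: "z \<in> C1c \<Omega>" using z by simp
      note w = C1c_extend_zero[OF \<Omega> zC]
      have "admissible \<phi> \<Omega> z" using z by (intro admissible_if_AE[OF \<Omega> \<phi>]) auto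
      then have "admissible \<phi> \<Omega> ?w" by (simp add: admissible_def)
      then have "(LINT x|lborel. g x * divergence ?w x) \<le> T" using le w(1) unfolding tv_le_def by blast
      moreover have "divergence z x = divergence ?w x" if "x \<in> \<Omega>" for x
        unfolding divergence_def w(2)[OF that] ..
      ultimately show "ereal (LINT x|lebesgue_on \<Omega>. f x * divergence z x) \<le> ereal T"
        using int[OF w(1)] by simp
    qed
  qed
qed

theorem proposition4p2:
  fixes \<Omega> :: "(real ^ 2) set"
    and \<phi> :: "real ^ 2 \<Rightarrow> real ^ 2 \<Rightarrow> real"
    and u :: "real ^ 2 \<Rightarrow> real"
  assumes "open \<Omega>" and "bounded \<Omega>" and "lipschitz_boundary \<Omega>"
    and "metric_integrand \<Omega> \<phi>"
    and "u \<in> BV \<phi> \<Omega>"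
    and "least_gradient \<phi> \<Omega> u"
  shows "u \<in> Linf_loc \<Omega>"
proof -
  note \<Omega> = assms(1,2) and \<phi> = assms(4)
  have \<Omega>m: "\<Omega> \<in> sets lebesgue" using \<Omega> by simp
  have iu: "integrable (lebesgue_on \<Omega>) u" and TVfin: "total_variation \<phi> \<Omega> u < \<infinity>"
    using assms(5) by (auto simp: BV_def)
  have um: "u \<in> borel_measurable (lebesgue_on \<Omega>)" by (rule borel_measurable_integrable[OF iu])
  have iu': "integrable lebesgue (\<lambda>x. indicator \<Omega> x *\<^sub>R u x)"
    using iu integrable_restrict_space[of \<Omega> lebesgue u] \<Omega>m by simp
  \<comment> \<open>A Borel representative of the extension of \<open>u\<close> by zero makes
    translations and Fubini on \<open>lborel\<close> available.\<close>
  obtain f where f: "f \<in> borel_measurable lborel" "AE x in lborel. indicator \<Omega> x *\<^sub>R u x = f x"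
    using completion_ex_borel_measurable_real[OF borel_measurable_integrable[OF iu']] by blast
  have fi: "integrable lborel f"
  proof -
    have "AE x in lebesgue. indicator \<Omega> x *\<^sub>R u x = f x" by (rule AE_completion[OF f(2)])
    then have "integrable lebesgue f"
      using iu' measurable_completion[OF f(1)] by (rule integrable_cong_AE_imp[of lebesgue "\<lambda>x. indicator \<Omega> x *\<^sub>R u x", rotated -1])
    then show ?thesis by (rule integrable_completion[OF f(1), THEN iffD1])
  qed
  have fm: "f \<in> borel_measurable borel" using f(1) by simp
  have uf: "AE x in lebesgue_on \<Omega>. u x = f x"
  proof -
    have "AE x in lebesgue. indicator \<Omega> x *\<^sub>R u x = f x" by (rule AE_completion[OF f(2)])
    then have "AE x in lebesgue. x \<in> \<Omega> \<longrightarrow> u x = f x" by eventually_elim auto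
    then show ?thesis using \<Omega>m by (simp add: AE_restrict_space_iff)
  qed
  have zero: "test_field \<Omega> (\<lambda>x. 0 :: real ^ 2)" "admissible \<phi> \<Omega> (\<lambda>x. 0)"
    using \<phi> closure_subset[of \<Omega>] by (auto simp: test_field_def admissible_def metric_integrand_def C1_const intro!: exI[of _ "{}"])
  \<comment> \<open>The zero field excludes the value minus infinity, so the variation of
    \<open>u\<close> is a real number.\<close>
  obtain T where T: "total_variation \<phi> \<Omega> u = ereal T"
  proof -
    have "ereal (LINT x|lebesgue_on \<Omega>. u x * divergence (\<lambda>x. 0) x) \<le> total_variation \<phi> \<Omega> u"
      unfolding total_variation_def
      using test_field_in_C1c[OF zero(1)] zero(2) polar_le_1_iff[OF \<phi>]
      by (intro SUP_upper) (auto simp: admissible_def intro!: AE_I2)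
    then have "total_variation \<phi> \<Omega> u \<noteq> - \<infinity>" by auto
    then show ?thesis using TVfin that by (cases "total_variation \<phi> \<Omega> u") auto
  qed
  have tvf: "tv_le \<phi> \<Omega> f T"
    using total_variation_le_iff[OF \<Omega>(1) \<phi> um fm uf, of T] T by simp
  have minimal: "T \<le> T'"
    if K: "compact K" "K \<subseteq> \<Omega>" and v: "integrable lborel v" "\<And>x. x \<notin> K \<Longrightarrow> v x = 0"
      and S: "tv_le \<phi> \<Omega> v S" and T': "tv_le \<phi> \<Omega> (\<lambda>x. f x + v x) T'" for K v S T'
  proof -
    have vb: "v \<in> borel_measurable borel" using v(1) by (auto dest: borel_measurable_integrable)
    have vl: "integrable lebesgue v" using v(1) vb by (simp add: integrable_completion)
    have vi: "integrable (lebesgue_on \<Omega>) v"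
      using integrable_restrict_space[of \<Omega> lebesgue v] \<Omega>m Bochner_Integration.integrable_mult_indicator[OF \<Omega>m vl] by simp
    have vm: "v \<in> borel_measurable (lebesgue_on \<Omega>)" by (rule borel_measurable_integrable[OF vi])
    have "total_variation \<phi> \<Omega> v \<le> ereal S"
      using S total_variation_le_iff[OF \<Omega>(1) \<phi> vm vb] by simp
    then have "v \<in> BV \<phi> \<Omega>" using vi by (auto simp: BV_def intro: le_less_trans)
    moreover have "compactly_supported \<Omega> v"
      unfolding compactly_supported_def using K v(2) by (intro exI[of _ K]) auto
    ultimately have "total_variation \<phi> \<Omega> u \<le> total_variation \<phi> \<Omega> (\<lambda>x. u x + v x)"
      using assms(6) unfolding least_gradient_def by blast
    also have "\<dots> \<le> ereal T'"
    proof (rule total_variation_le_iff[OF \<Omega>(1) \<phi>, THEN iffD2, OF _ _ _ T'])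
      show "(\<lambda>x. u x + v x) \<in> borel_measurable (lebesgue_on \<Omega>)" using um vm by simp
      show "(\<lambda>x. f x + v x) \<in> borel_measurable borel" using fm vb by simp
      show "AE x in lebesgue_on \<Omega>. u x + v x = f x + v x" using uf by eventually_elim simp
    qed
    finally show ?thesis by (simp add: T)
  qed
  \<comment> \<open>Perturbing \<open>- f\<close> by \<open>v\<close> is perturbing \<open>f\<close>
    by \<open>- v\<close> up to sign, and the variation is even. The upper bound for
    \<open>- f\<close> is the missing lower bound for \<open>f\<close>.\<close>
  have minimal_uminus: "T \<le> T'"
    if K: "compact K" "K \<subseteq> \<Omega>" and v: "integrable lborel v" "\<And>x. x \<notin> K \<Longrightarrow> v x = 0"
      and S: "tv_le \<phi> \<Omega> v S" and T': "tv_le \<phi> \<Omega> (\<lambda>x. - f x + v x) T'" for K v S T'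
  proof (rule minimal[OF K, of "\<lambda>x. - v x"])
    show "tv_le \<phi> \<Omega> (\<lambda>x. - v x) S" by (rule tv_le_uminus[OF \<phi> S])
    show "tv_le \<phi> \<Omega> (\<lambda>x. f x + - v x) T'" using tv_le_uminus[OF \<phi> T'] by simp
  qed (use v in auto)
  have dim: "DIM(real ^ 2) = 2" by simp
  have loc: "\<exists>d. AE x in lborel. x \<in> cball x0 R \<longrightarrow> \<bar>f x\<bar> \<le> d"
    if R: "0 < R" "cball x0 (2 * R) \<subseteq> \<Omega>" for x0 R
  proof -
    have "\<exists>d. AE x in lborel. x \<in> cball x0 R \<longrightarrow> f x \<le> d"
      by (rule minimizer_local_bound[OF dim \<Omega> \<phi> fi tvf _ R]) (fact minimal)
    then obtain d1 where d1: "AE x in lborel. x \<in> cball x0 R \<longrightarrow> f x \<le> d1" by blast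
    have mi: "integrable lborel (\<lambda>x. - f x)" using fi by simp
    have "\<exists>d. AE x in lborel. x \<in> cball x0 R \<longrightarrow> - f x \<le> d"
      by (rule minimizer_local_bound[OF dim \<Omega> \<phi> mi tv_le_uminus[OF \<phi> tvf] _ R]) (fact minimal_uminus)
    then obtain d2 where d2: "AE x in lborel. x \<in> cball x0 R \<longrightarrow> - f x \<le> d2" by blast
    have "AE x in lborel. x \<in> cball x0 R \<longrightarrow> \<bar>f x\<bar> \<le> max d1 d2"
      using d1 d2 by eventually_elim auto
    then show ?thesis by blast
  qed
  have "\<exists>C. AE x in lebesgue_on K. \<bar>u x\<bar> \<le> C" if K: "compact K" "K \<subseteq> \<Omega>" for K
  proof -
    have "\<exists>R d. 0 < R \<and> (AE x in lborel. x \<in> cball p R \<longrightarrow> \<bar>f x\<bar> \<le> d)" if "p \<in> K" for p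
    proof -
      have "p \<in> \<Omega>" using K(2) that by (rule subsetD)
      then obtain e where e: "0 < e" "cball p e \<subseteq> \<Omega>"
        using \<Omega>(1) open_contains_cball[of \<Omega>] by blast
      then obtain d where "AE x in lborel. x \<in> cball p (e / 2) \<longrightarrow> \<bar>f x\<bar> \<le> d"
        using loc[of "e / 2" p] by auto
      then show ?thesis using e(1) by (intro exI[of _ "e / 2"] exI[of _ d]) simp
    qed
    then have "\<forall>p\<in>K. \<exists>R. \<exists>d. 0 < R \<and> (AE x in lborel. x \<in> cball p R \<longrightarrow> \<bar>f x\<bar> \<le> d)" by blast
    from bchoice[OF this] obtain R where
      "\<forall>p\<in>K. \<exists>d. 0 < R p \<and> (AE x in lborel. x \<in> cball p (R p) \<longrightarrow> \<bar>f x\<bar> \<le> d)" by blast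
    from bchoice[OF this] obtain d where
      Rd: "\<forall>p\<in>K. 0 < R p \<and> (AE x in lborel. x \<in> cball p (R p) \<longrightarrow> \<bar>f x\<bar> \<le> d p)" by blast
    have "K \<subseteq> (\<Union>p\<in>K. ball p (R p))" using Rd by force
    then obtain F where F: "F \<subseteq> K" "finite F" "K \<subseteq> (\<Union>p\<in>F. ball p (R p))"
      using compactE_image[OF K(1), of K "\<lambda>p. ball p (R p)"] by auto
    \<comment> \<open>A sum of absolute values, in place of a maximum, also makes sense when
      \<open>F\<close> is empty.\<close>
    define C where "C = (\<Sum>p\<in>F. \<bar>d p\<bar>)"
    have dC: "d p \<le> C" if "p \<in> F" for p
      using member_le_sum[OF that, of "\<lambda>p. \<bar>d p\<bar>"] F(2) unfolding C_def by (auto intro: order_trans[OF abs_ge_self])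
    have "AE x in lborel. \<forall>p\<in>F. x \<in> cball p (R p) \<longrightarrow> \<bar>f x\<bar> \<le> d p"
      using F(1,2) Rd by (intro AE_finite_allI) auto
    then have "AE x in lborel. x \<in> K \<longrightarrow> \<bar>f x\<bar> \<le> C"
    proof eventually_elim
      case (elim x)
      show ?case
      proof
        assume "x \<in> K"
        then obtain p where "p \<in> F" "x \<in> ball p (R p)" using F(3) by blast
        then show "\<bar>f x\<bar> \<le> C" using elim dC[of p] by force
      qed
    qed
    then have 1: "AE x in lebesgue. x \<in> K \<longrightarrow> \<bar>f x\<bar> \<le> C" by (rule AE_completion)
    have 2: "AE x in lebesgue. x \<in> \<Omega> \<longrightarrow> u x = f x" using uf \<Omega>m by (simp add: AE_restrict_space_iff)
    from 1 2 have "AE x in lebesgue. x \<in> K \<longrightarrow> \<bar>u x\<bar> \<le> C" by eventually_elim (use K(2) in auto)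
    moreover have "K \<in> sets lebesgue" using K(1) by (simp add: compact_imp_closed)
    ultimately have "AE x in lebesgue_on K. \<bar>u x\<bar> \<le> C" by (simp add: AE_restrict_space_iff)
    then show ?thesis by blast
  qed
  then show ?thesis using um by (simp add: Linf_loc_def)
qed

end
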